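(* Let $\mathcal H$ be a complex Hilbert space and let $\mathbf A=(A_1,\dots,A_m)$ be an $m$-tuple of bounded operators on $\mathcal H$. The following conditions are equivalent. (a) $\operatorname{cl}W_k(\mathbf A)$ is polyhedral for every positive integer $k<\dim\mathcal H$. (b) $\operatorname{cl}(\operatorname{conv}W_k(\mathbf A))$ is polyhedral for every positive integer $k<\dim\mathcal H$. (c) There exists an $m$-tuple of diagonal operators $\mathbf D=(R_1\oplus S_1,\dots,R_m\oplus S_m)$, where $\mathbf R=(R_1,\dots,R_m)$ is the compression of $\mathbf A$ to a separable common reducing subspace of $\mathcal H$, and $\mathbf S=(S_1,\dots,S_m)$ is an $m$-tuple of diagonal operators whose diagonal entries are extreme points of $W_{\rm ess}(\mathbf A)$, such that $\operatorname{cl}W_k(\mathbf A)=W_k(\mathbf D)$ is polyhedral for every positive integer $k<\dim\mathcal H$.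
   Context: For an $m$-tuple $\mathbf A=(A_1,\dots,A_m)$ of bounded operators on a complex Hilbert space $\mathcal H$ and a positive integer $k\le\dim\mathcal H$, the joint $k$-numerical range is $$W_k(\mathbf A)=\Big\{\Big(\sum_{\ell=1}^k\langle A_1x_\ell,x_\ell\rangle,\dots,\sum_{\ell=1}^k\langle A_mx_\ell,x_\ell\rangle\Big):\{x_1,\dots,x_k\}\subseteq\mathcal H\text{ orthonormal}\Big\}\subseteq\mathbb C^m.$$ The joint essential numerical range is $W_{\rm ess}(\mathbf A)=\bigcap\{\operatorname{cl}W_1(A_1+K_1,\dots,A_m+K_m):K_1,\dots,K_m\text{ compact operators on }\mathcal H\}$. A set is polyhedral if it is the convex hull of a finite set; $\operatorname{cl}$ and $\operatorname{conv}$ denote closure and convex hull. An $m$-tuple of diagonal operators means that all of its components are diagonal with respect to one fixed orthonormal basis $\{f_i\}$ of the underlying space; its diagonal entries are the points $(\langle S_1f_i,f_i\rangle,\dots,\langle S_mf_i,f_i\rangle)\in\mathbb C^m$. The $S_j$ act on an auxiliary Hilbert space, not a subspace of $\mathcal H$; either of the summands $\mathbf R$, $\mathbf S$ is allowed to be absent (act on the zero space). *)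

theory Defs
  imports "HOL-Analysis.Analysis"
begin

section \<open>Complex Hilbert spaces\<close>

text \<open>A complex inner product space is a real inner product space (which provides norm and
  topology) with a compatible complex structure.  The complex inner product is linear in its
  \<^emph>\<open>first\<close> argument, its real part is the real inner product, and hence
  \<^term>\<open>norm x ^ 2\<close> is the inner product of \<^term>\<open>x\<close> with itself.\<close>

class complex_inner = real_inner +
  fixes scaleC :: "complex \<Rightarrow> 'a \<Rightarrow> 'a"  (infixr "*\<^sub>C" 75)
    and cinner :: "'a \<Rightarrow> 'a \<Rightarrow> complex"
  assumes scaleC_add_right: "c *\<^sub>C (x + y) = c *\<^sub>C x + c *\<^sub>C y"
    and scaleC_add_left: "(c + d) *\<^sub>C x = c *\<^sub>C x + d *\<^sub>C x"
    and scaleC_scaleC: "c *\<^sub>C d *\<^sub>C x = (c * d) *\<^sub>C x"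
    and scaleR_scaleC: "scaleR r x = complex_of_real r *\<^sub>C x"
    and cinner_commute: "cinner x y = cnj (cinner y x)"
    and cinner_add_left: "cinner (x + y) z = cinner x z + cinner y z"
    and cinner_scaleC_left: "cinner (c *\<^sub>C x) y = c * cinner x y"
    and inner_eq_Re_cinner: "inner x y = Re (cinner x y)"

class chilbert_space = complex_inner + complete_space

global_interpretation complex_vector: vector_space "scaleC :: complex \<Rightarrow> 'a \<Rightarrow> 'a::complex_inner"
proof
  show "1 *\<^sub>C x = x" for x :: 'a
    using scaleR_scaleC[of 1 x] by simp
qed (simp_all add: scaleC_add_right scaleC_add_left scaleC_scaleC)

instantiation complex :: complex_inner
begin
definition "scaleC c (x::complex) = c * x"
definition "cinner x (y::complex) = x * cnj y"
instance
  by standard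
    (simp_all add: scaleC_complex_def cinner_complex_def algebra_simps scaleR_conv_of_real
      inner_complex_def)
end

instance complex :: chilbert_space ..

text \<open>The orthogonal direct sum of two Hilbert spaces is their product.\<close>

instantiation prod :: (complex_inner, complex_inner) complex_inner
begin
definition "scaleC c p = (c *\<^sub>C fst p, c *\<^sub>C snd p)"
definition "cinner p q = cinner (fst p) (fst q) + cinner (snd p) (snd q)"
instance
proof
  show "cinner x y = cnj (cinner y x)" for x y :: "'a \<times> 'b"
    by (simp add: cinner_prod_def flip: cinner_commute)
qed (simp_all add: scaleC_prod_def cinner_prod_def prod_eq_iff algebra_simps scaleC_add_right
      scaleC_add_left scaleC_scaleC scaleR_scaleC cinner_add_left cinner_scaleC_left
      inner_prod_def inner_eq_Re_cinner)
end

instance prod :: (chilbert_space, chilbert_space) chilbert_space ..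


section \<open>Subspaces, orthonormal bases, dimension\<close>

text \<open>Closed subspaces serve as Hilbert spaces in their own right; in particular the
  zero space \<^term>\<open>{0}\<close> is one.\<close>

definition closed_csubspace :: "'a::complex_inner set \<Rightarrow> bool" where
  "closed_csubspace V \<longleftrightarrow> complex_vector.subspace V \<and> closed V"

definition ocomp :: "'a::complex_inner set \<Rightarrow> 'a set" where
  "ocomp V = {y. \<forall>x\<in>V. cinner y x = 0}"

definition cproj :: "'a::complex_inner set \<Rightarrow> 'a \<Rightarrow> 'a" where
  "cproj V x = (THE y. y \<in> V \<and> x - y \<in> ocomp V)"

definition orthonormal_set :: "'a::complex_inner set \<Rightarrow> bool" where
  "orthonormal_set B \<longleftrightarrow> (\<forall>x\<in>B. \<forall>y\<in>B. cinner x y = (if x = y then 1 else 0))"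

definition is_onb :: "'a::complex_inner set \<Rightarrow> 'a set \<Rightarrow> bool" where
  "is_onb V B \<longleftrightarrow> B \<subseteq> V \<and> orthonormal_set B \<and> closure (complex_vector.span B) = V"

text \<open>Hilbert space dimension: the cardinality of an orthonormal basis, with all infinite
  cardinalities identified (it is only ever compared with natural numbers).\<close>

definition hdim :: "'a::chilbert_space set \<Rightarrow> enat" where
  "hdim V = (let B = (SOME B. is_onb V B) in if finite B then enat (card B) else \<infinity>)"


section \<open>Operators\<close>

text \<open>A bounded operator on a closed subspace \<^term>\<open>V\<close> is represented by a function whose values
  outside \<^term>\<open>V\<close> are irrelevant.\<close>

definition bounded_op_on :: "'a::complex_inner set \<Rightarrow> ('a \<Rightarrow> 'a) \<Rightarrow> bool" where
  "bounded_op_on V T \<longleftrightarrow>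
     (\<forall>x\<in>V. T x \<in> V) \<and>
     (\<forall>x\<in>V. \<forall>y\<in>V. T (x + y) = T x + T y) \<and>
     (\<forall>c. \<forall>x\<in>V. T (c *\<^sub>C x) = c *\<^sub>C T x) \<and>
     (\<exists>M. \<forall>x\<in>V. norm (T x) \<le> M * norm x)"

lemma bounded_op_on_UNIV:
  "bounded_op_on UNIV T \<longleftrightarrow> bounded_linear T \<and> (\<forall>c x. T (c *\<^sub>C x) = c *\<^sub>C T x)"
proof
  assume T: "bounded_op_on UNIV T"
  then obtain M where "\<forall>x. norm (T x) \<le> M * norm x"
    by (auto simp: bounded_op_on_def)
  with T show "bounded_linear T \<and> (\<forall>c x. T (c *\<^sub>C x) = c *\<^sub>C T x)"
    by (auto simp: bounded_op_on_def scaleR_scaleC mult.commute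
        intro!: bounded_linear_intro[where K = M])
next
  assume T: "bounded_linear T \<and> (\<forall>c x. T (c *\<^sub>C x) = c *\<^sub>C T x)"
  then obtain M where "\<forall>x. norm (T x) \<le> norm x * M"
    using bounded_linear.bounded by blast
  with T show "bounded_op_on UNIV T"
    by (auto simp: bounded_op_on_def linear_add bounded_linear.linear mult.commute)
qed

definition compact_op :: "('a::complex_inner \<Rightarrow> 'a) \<Rightarrow> bool" where
  "compact_op T \<longleftrightarrow> bounded_op_on UNIV T \<and> compact (closure (T ` cball 0 1))"

text \<open>Tuples of operators, and of complex numbers, are indexed by a finite type \<open>'m\<close>.\<close>

definition reducing :: "('m \<Rightarrow> 'a \<Rightarrow> 'a) \<Rightarrow> 'a::complex_inner set \<Rightarrow> bool" where
  "reducing A L \<longleftrightarrow> closed_csubspace L \<and>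
     (\<forall>j. A j ` L \<subseteq> L \<and> A j ` ocomp L \<subseteq> ocomp L)"

definition compression :: "'a::complex_inner set \<Rightarrow> ('m \<Rightarrow> 'a \<Rightarrow> 'a) \<Rightarrow> ('m \<Rightarrow> 'a \<Rightarrow> 'a)" where
  "compression L A = (\<lambda>j x. cproj L (A j x))"

definition direct_sum ::
    "('m \<Rightarrow> 'a \<Rightarrow> 'a) \<Rightarrow> ('m \<Rightarrow> 'b \<Rightarrow> 'b) \<Rightarrow> ('m \<Rightarrow> 'a \<times> 'b \<Rightarrow> 'a \<times> 'b)" where
  "direct_sum R S = (\<lambda>j (x, y). (R j x, S j y))"

definition diagonal_wrt :: "'a::complex_inner set \<Rightarrow> ('m \<Rightarrow> 'a \<Rightarrow> 'a) \<Rightarrow> bool" where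
  "diagonal_wrt B T \<longleftrightarrow> (\<forall>j. \<forall>f\<in>B. \<exists>c. T j f = c *\<^sub>C f)"

definition diagonal_entry :: "('m::finite \<Rightarrow> 'a \<Rightarrow> 'a) \<Rightarrow> 'a::complex_inner \<Rightarrow> complex ^ 'm" where
  "diagonal_entry T f = (\<chi> j. cinner (T j f) f)"


section \<open>Joint numerical ranges\<close>

text \<open>The joint \<open>k\<close>-numerical range of a tuple of operators on the Hilbert space \<^term>\<open>V\<close>.\<close>

definition joint_num_range ::
    "'a::complex_inner set \<Rightarrow> nat \<Rightarrow> ('m::finite \<Rightarrow> 'a \<Rightarrow> 'a) \<Rightarrow> (complex ^ 'm) set" where
  "joint_num_range V k T =
     {(\<chi> j. \<Sum>l<k. cinner (T j (x l)) (x l)) | x.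
        (\<forall>l<k. x l \<in> V) \<and> (\<forall>i<k. \<forall>l<k. cinner (x i) (x l) = (if i = l then 1 else 0))}"

definition joint_ess_num_range ::
    "('m::finite \<Rightarrow> 'a \<Rightarrow> 'a::complex_inner) \<Rightarrow> (complex ^ 'm) set" where
  "joint_ess_num_range A =
     \<Inter> {closure (joint_num_range UNIV 1 (\<lambda>j x. A j x + K j x)) | K. \<forall>j. compact_op (K j)}"

text \<open>
  A tuple \<^term>\<open>R\<close> obtained by compressing \<^term>\<open>A\<close> to a separable common reducing subspace
  \<^term>\<open>L\<close>, a tuple \<^term>\<open>S\<close> of diagonal operators on an auxiliary Hilbert space
  \<^term>\<open>K\<close> with diagonal entries among the extreme points of the joint essential numerical range,
  and the diagonal tuple of the direct sums.  HOL cannot quantify existentially over types, so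
  \<^term>\<open>K\<close> ranges over the closed subspaces of some ambient Hilbert space \<open>'k\<close>, which is
  unrelated to \<open>'a\<close>; the direct sums act on \<^term>\<open>L \<times> K\<close>.  The ambient
  \<open>'k\<close> is meant to be an arbitrary type of at least the dimension of \<open>'a\<close> (as measured by
  \<^term>\<open>hdim\<close>, so merely infinite-dimensional if \<open>'a\<close> is), so that the existence of an
  auxiliary space is not obstructed by a lack of room; \<open>'k = 'a\<close> is one choice.  Taking \<^term>\<open>L = {0}\<close> or
  \<^term>\<open>K = {0}\<close> means that the corresponding summand is absent.
\<close>

definition diagonal_model ::
    "('m::finite \<Rightarrow> 'a \<Rightarrow> 'a) \<Rightarrow> 'a::chilbert_space set \<Rightarrow> 'k::chilbert_space set
      \<Rightarrow> ('m \<Rightarrow> 'a \<times> 'k \<Rightarrow> 'a \<times> 'k) \<Rightarrow> bool" where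
  "diagonal_model A L K D \<longleftrightarrow>
     (\<exists>S. reducing A L \<and> separable_space (top_of_set L) \<and>
          closed_csubspace K \<and> (\<forall>j. bounded_op_on K (S j)) \<and>
          (\<exists>F. is_onb K F \<and> diagonal_wrt F S \<and>
               (\<forall>f\<in>F. diagonal_entry S f extreme_point_of joint_ess_num_range A)) \<and>
          D = direct_sum (compression L A) S \<and>
          (\<exists>E. is_onb (L \<times> K) E \<and> diagonal_wrt E D))"

end

theory Submission
  imports Defs
begin

text \<open>
  The support function of \<open>W\<^sub>k(A)\<close> in a direction \<open>a\<close> is the sum of the \<open>k\<close> largest spectral values
  of the self-adjoint operator belonging to \<open>a\<close>. If the closed convex hulls \<open>P\<^sub>k\<close> are polytopes,
  these support functions are linear near a generic \<open>a\<close>, so the \<open>i\<close>-th spectral value is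
  \<open>b \<mapsto> \<langle>b, d\<^sub>i\<rangle>\<close> for all \<open>b\<close> near \<open>a\<close>, where \<open>d\<^sub>i\<close> is a difference of vertices of \<open>P\<^sub>i\<close> and
  \<open>P\<^sub>i\<^sub>-\<^sub>1\<close>. As long as \<open>d\<^sub>i\<close> is not in the essential range there is a spectral gap, and a maximising
  sequence converges to a joint reducing eigenvector with eigenvalue \<open>d\<^sub>i\<close>; the first essential \<open>d\<^sub>i\<close>
  is an extreme point of the essential range and is repeated from then on. Hence every vertex of \<open>P\<^sub>k\<close>
  is a sum of \<open>k\<close> diagonal entries of an operator \<open>D = R \<oplus> S\<close>, with countably many entries in all.
  Sums of \<open>k\<close> entries of \<open>D\<close> are conversely limits of points of \<open>W\<^sub>k(A)\<close>, and for a diagonal tuple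
  the Schur--Horn theorem identifies \<open>W\<^sub>k(D)\<close> with the hull of these sums.
\<close>

section \<open>Complex inner product spaces\<close>

text \<open>What turns a maximiser into a joint eigenvector is that the support functions are linear
  on a whole ball of directions. At one direction \<open>a\<close>, a maximiser is only an
  eigenvector of the self-adjoint form belonging to \<open>a\<close>. But the defect
  \<open>inner b (d - quad A z)\<close> is nonnegative for all \<open>b\<close> in a ball and zero
  at its centre, so the vector \<open>d - quad A z\<close> itself is zero, and the same argument for
  the polarised form yields all \<open>A j\<close> and their adjoints at once. The obstacle is that
  the eigenvectors found in this way depend on the vertex and on k, whereas one separable reducing
  subspace has to serve all of them. So only the possible eigenvalues are collected, a countable set
  of vertex differences; a maximal orthonormal set \<open>B\<close> of eigenvectors for the
  non-essential ones is fixed beforehand, and a newly found eigenvector is exchanged for a member of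
  \<open>B\<close> with the same eigenvalue. The essential range enters through
  \<open>ess_points\<close>: these points lie in the range of the definition, and support bounds on
  complements of finite codimension pass to that range, which is enough for extremality.\<close>

lemma cinner_add_right: "cinner x (y + z) = cinner x y + cinner x (z::'a::complex_inner)"
  by (metis cinner_add_left cinner_commute complex_cnj_add)

lemma cinner_scaleC_right: "cinner x (c *\<^sub>C y) = cnj c * cinner x (y::'a::complex_inner)"
  by (metis cinner_scaleC_left cinner_commute complex_cnj_mult)

lemma cinner_zero_left [simp]: "cinner 0 (x::'a::complex_inner) = 0"
  using cinner_add_left[of 0 0 x] by simp

lemma cinner_zero_right [simp]: "cinner (x::'a::complex_inner) 0 = 0"
  using cinner_add_right[of x 0 0] by simp

lemma cinner_minus_left [simp]: "cinner (- x) y = - cinner x (y::'a::complex_inner)"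
  using cinner_add_left[of x "-x" y] by (simp add: eq_neg_iff_add_eq_0 add.commute)

lemma cinner_minus_right [simp]: "cinner x (- y) = - cinner x (y::'a::complex_inner)"
  using cinner_add_right[of x y "-y"] by (simp add: eq_neg_iff_add_eq_0 add.commute)

lemma cinner_diff_left: "cinner (x - y) z = cinner x z - cinner y (z::'a::complex_inner)"
  using cinner_add_left[of x "-y" z] by simp

lemma cinner_diff_right: "cinner x (y - z) = cinner x y - cinner x (z::'a::complex_inner)"
  using cinner_add_right[of x y "-z"] by simp

lemma cinner_sum_left: "cinner (sum f S) (y::'a::complex_inner) = (\<Sum>i\<in>S. cinner (f i) y)"
  by (induction S rule: infinite_finite_induct) (auto simp: cinner_add_left)

lemma cinner_sum_right: "cinner (y::'a::complex_inner) (sum f S) = (\<Sum>i\<in>S. cinner y (f i))"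
  by (induction S rule: infinite_finite_induct) (auto simp: cinner_add_right)

lemma cinner_scaleR_left [simp]: "cinner (r *\<^sub>R x) (y::'a::complex_inner) = of_real r * cinner x y"
  by (simp add: scaleR_scaleC cinner_scaleC_left)

lemma cinner_scaleR_right [simp]: "cinner (x::'a::complex_inner) (r *\<^sub>R y) = of_real r * cinner x y"
  by (simp add: scaleR_scaleC cinner_scaleC_right)

lemma cinner_self: "cinner x (x::'a::complex_inner) = complex_of_real ((norm x)\<^sup>2)"
proof -
  have "Im (cinner x x) = 0"
    using cinner_commute[of x x] by (simp add: complex_eq_iff)
  then show ?thesis
    by (simp add: complex_eq_iff power2_norm_eq_inner inner_eq_Re_cinner)
qed

lemma cinner_eq_0_commute: "cinner x y = 0 \<longleftrightarrow> cinner y (x::'a::complex_inner) = 0"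
  by (metis cinner_commute complex_cnj_zero)

lemma cmod_cinner_commute: "cmod (cinner x y) = cmod (cinner y (x::'a::complex_inner))"
  by (metis cinner_commute complex_mod_cnj)

lemma norm_scaleC: "norm (c *\<^sub>C (x::'a::complex_inner)) = cmod c * norm x"
proof -
  have "cinner (c *\<^sub>C x) (c *\<^sub>C x) = (c * cnj c) * cinner x x"
    by (simp add: cinner_scaleC_left cinner_scaleC_right)
  also have "\<dots> = complex_of_real ((cmod c * norm x)\<^sup>2)"
    unfolding complex_norm_square[symmetric] cinner_self[of x] by (simp add: power_mult_distrib)
  finally have "(norm (c *\<^sub>C x))\<^sup>2 = (cmod c * norm x)\<^sup>2"
    unfolding cinner_self of_real_eq_iff .
  then show ?thesis
    by (simp add: power2_eq_iff_nonneg)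
qed

lemma cmod_cinner_le: "cmod (cinner x y) \<le> norm x * norm (y::'a::complex_inner)"
proof (cases "cinner x y = 0")
  case False
  \<comment> \<open>The phase \<open>c\<close> rotates the inner product onto the nonnegative reals,
    where the real Cauchy-Schwarz inequality applies.\<close>
  define c where "c = cnj (cinner x y) / cmod (cinner x y)"
  have c: "cmod c = 1" using False by (simp add: c_def norm_divide)
  have "c * cinner x y = cmod (cinner x y)"
    using False by (simp add: c_def field_simps complex_norm_square[symmetric] power2_eq_square)
  then have "cmod (cinner x y) = Re (cinner (c *\<^sub>C x) y)"
    by (simp add: cinner_scaleC_left)
  also have "\<dots> = inner (c *\<^sub>C x) y" by (simp add: inner_eq_Re_cinner)
  also have "\<dots> \<le> norm (c *\<^sub>C x) * norm y" by (rule norm_cauchy_schwarz)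
  finally show ?thesis by (simp add: norm_scaleC c)
qed auto

lemma bounded_bilinear_cinner: "bounded_bilinear (cinner :: 'a::complex_inner \<Rightarrow> 'a \<Rightarrow> complex)"
proof
  show "\<exists>K. \<forall>a b::'a. cmod (cinner a b) \<le> norm a * norm b * K"
    by (rule exI[of _ 1]) (simp add: cmod_cinner_le)
qed (auto simp: cinner_add_left cinner_add_right scaleR_conv_of_real)

lemma bounded_bilinear_scaleC: "bounded_bilinear (scaleC :: complex \<Rightarrow> 'a::complex_inner \<Rightarrow> 'a)"
proof
  show "\<exists>K. \<forall>a (b::'a). norm (a *\<^sub>C b) \<le> norm a * norm b * K"
    by (rule exI[of _ 1]) (simp add: norm_scaleC)
qed (auto simp: scaleC_add_left scaleC_add_right scaleR_scaleC[where 'a = 'a] scaleC_scaleC scaleR_conv_of_real mult.commute)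

lemmas tendsto_cinner = bounded_bilinear.tendsto[OF bounded_bilinear_cinner]
lemmas tendsto_scaleC = bounded_bilinear.tendsto[OF bounded_bilinear_scaleC]
lemmas continuous_on_cinner = bounded_bilinear.continuous_on[OF bounded_bilinear_cinner]
lemmas continuous_on_scaleC = bounded_bilinear.continuous_on[OF bounded_bilinear_scaleC]

lemma norm_eq_1_iff_cinner: "norm (x::'a::complex_inner) = 1 \<longleftrightarrow> cinner x x = 1"
proof -
  have "cinner x x = 1 \<longleftrightarrow> (norm x)\<^sup>2 = 1" unfolding cinner_self using of_real_eq_1_iff by blast
  then show ?thesis by (simp add: power2_eq_1_iff) (smt (verit) norm_ge_zero)
qed

section \<open>Finite orthonormal systems\<close>

lemma orthonormal_set_norm: "orthonormal_set B \<Longrightarrow> b \<in> B \<Longrightarrow> norm b = 1"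
  by (auto simp: orthonormal_set_def norm_eq_1_iff_cinner)

lemma orthonormal_set_subset: "orthonormal_set B \<Longrightarrow> C \<subseteq> B \<Longrightarrow> orthonormal_set C"
  unfolding orthonormal_set_def by blast

lemma norm_add_cinner_0:
  assumes "cinner x y = 0"
  shows "(norm (x + y))\<^sup>2 = (norm x)\<^sup>2 + (norm (y::'a::complex_inner))\<^sup>2"
  using assms by (intro norm_add_Pythagorean) (simp add: orthogonal_def inner_eq_Re_cinner)

lemma orthonormal_set_insert:
  assumes "orthonormal_set B" "norm x = 1" "\<And>b. b \<in> B \<Longrightarrow> cinner x b = 0"
  shows "orthonormal_set (insert x B)"
  using assms by (auto simp: orthonormal_set_def norm_eq_1_iff_cinner cinner_eq_0_commute[of _ x])

text \<open>For finite orthonormal \<open>G\<close> this is the orthogonal projection onto its span.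
  Being an explicit sum, it is visibly linear and of finite rank.\<close>

definition fproj :: "'a::complex_inner set \<Rightarrow> 'a \<Rightarrow> 'a" where
  "fproj G x = (\<Sum>g\<in>G. cinner x g *\<^sub>C g)"

lemma cinner_orthonormal_sum:
  assumes "orthonormal_set G" "finite G" "h \<in> G"
  shows "cinner (\<Sum>g\<in>G. c g *\<^sub>C g) h = c h"
proof -
  have "cinner (\<Sum>g\<in>G. c g *\<^sub>C g) h = (\<Sum>g\<in>G. c g * cinner g h)"
    by (simp add: cinner_sum_left cinner_scaleC_left)
  also have "\<dots> = (\<Sum>g\<in>G. if g = h then c h else 0)"
    using assms by (intro sum.cong) (auto simp: orthonormal_set_def)
  finally show ?thesis using assms by simp
qed

lemma cinner_fproj: "orthonormal_set G \<Longrightarrow> finite G \<Longrightarrow> g \<in> G \<Longrightarrow> cinner (fproj G x) g = cinner x g"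
  unfolding fproj_def by (rule cinner_orthonormal_sum)

lemma fproj_residual: "orthonormal_set G \<Longrightarrow> finite G \<Longrightarrow> g \<in> G \<Longrightarrow> cinner (x - fproj G x) g = 0"
  by (simp add: cinner_diff_left cinner_fproj)

lemma fproj_pythagoras:
  assumes "orthonormal_set G" "finite G"
  shows "(norm x)\<^sup>2 = (\<Sum>g\<in>G. (cmod (cinner x g))\<^sup>2) + (norm (x - fproj G x))\<^sup>2"
    and "(norm (fproj G x))\<^sup>2 = (\<Sum>g\<in>G. (cmod (cinner x g))\<^sup>2)"
proof -
  let ?p = "fproj G x"
  have r: "cinner (x - ?p) ?p = 0"
    using fproj_residual[OF assms, of _ x]
    by (simp add: fproj_def[of G x] cinner_sum_right cinner_scaleC_right)
  have "cinner ?p ?p = (\<Sum>g\<in>G. cnj (cinner x g) * cinner ?p g)"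
    by (subst (2) fproj_def) (simp add: cinner_sum_right cinner_scaleC_right)
  also have "\<dots> = complex_of_real (\<Sum>g\<in>G. (cmod (cinner x g))\<^sup>2)"
    using assms by (simp add: cinner_fproj complex_norm_square mult.commute del: of_real_power)
  finally show p: "(norm ?p)\<^sup>2 = (\<Sum>g\<in>G. (cmod (cinner x g))\<^sup>2)"
    by (simp only: cinner_self of_real_eq_iff)
  from norm_add_cinner_0[OF r] show "(norm x)\<^sup>2 = (\<Sum>g\<in>G. (cmod (cinner x g))\<^sup>2) + (norm (x - fproj G x))\<^sup>2"
    using p by simp
qed

lemma Bessel_finite:
  assumes "orthonormal_set G" "finite G"
  shows "(\<Sum>g\<in>G. (cmod (cinner x g))\<^sup>2) \<le> (norm x)\<^sup>2"
  using fproj_pythagoras(1)[OF assms, of x] by simp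

lemma fproj_in_span: "fproj G x \<in> complex_vector.span G"
  unfolding fproj_def by (intro complex_vector.span_sum complex_vector.span_scale complex_vector.span_base)

lemma fproj_eq_iff:
  assumes "orthonormal_set G" "finite G"
  shows "fproj G x = x \<longleftrightarrow> x \<in> complex_vector.span G"
proof
  assume "x \<in> complex_vector.span G"
  then obtain u where "x = (\<Sum>g\<in>G. u g *\<^sub>C g)"
    using complex_vector.span_finite[OF assms(2)] by auto
  then show "fproj G x = x"
    using cinner_orthonormal_sum[OF assms] by (simp add: fproj_def)
qed (metis fproj_in_span)

text \<open>Serves to replace a finite set of orthogonality conditions by an orthonormal one that is
  no larger, so that \<open>fproj\<close> can be applied.\<close>

lemma Gram_Schmidt_finite:
  assumes "finite (Y :: 'a::complex_inner set)"
  shows "\<exists>F. finite F \<and> orthonormal_set F \<and> card F \<le> card Y \<and> Y \<subseteq> complex_vector.span F"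
  using assms
proof (induction Y)
  case empty
  then show ?case by (intro exI[of _ "{}"]) (auto simp: orthonormal_set_def)
next
  case (insert y Y)
  then obtain F where F: "finite F" "orthonormal_set F" "card F \<le> card Y"
    "Y \<subseteq> complex_vector.span F" by auto
  show ?case
  proof (cases "fproj F y = y")
    case True
    then show ?thesis using F insert.hyps
      by (intro exI[of _ F]) (auto simp: fproj_eq_iff)
  next
    case False
    define u where "u = (1 / norm (y - fproj F y)) *\<^sub>R (y - fproj F y)"
    have u: "norm u = 1" using False by (simp add: u_def)
    have uF: "cinner u b = 0" if "b \<in> F" for b
      using fproj_residual[OF F(2,1) that, of y] by (simp add: u_def)
    have "y = fproj F y + complex_of_real (norm (y - fproj F y)) *\<^sub>C u"
      using False by (simp add: u_def flip: scaleR_scaleC)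
    moreover have "\<dots> \<in> complex_vector.span (insert u F)"
      by (intro complex_vector.span_add complex_vector.span_scale complex_vector.span_base[of u])
        (use fproj_in_span complex_vector.span_mono[of F "insert u F"] in auto)
    ultimately have "y \<in> complex_vector.span (insert u F)" by simp
    then show ?thesis
      using F insert.hyps orthonormal_set_insert[OF F(2) u uF]
        complex_vector.span_mono[of F "insert u F"] card_insert_le_m1[of "Suc (card Y)" F u]
      by (intro exI[of _ "insert u F"]) auto
  qed
qed

lemma cinner_span_eq_0:
  assumes "\<And>b. b \<in> B \<Longrightarrow> cinner x b = 0" "y \<in> complex_vector.span B"
  shows "cinner x y = 0"
  using assms(2)
  by (induction rule: complex_vector.span_induct_alt)
    (auto simp: cinner_add_right cinner_scaleC_right assms(1))

text \<open>Dimension count: projecting the span of \<open>C\<close> to a space of dimension at most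
  \<open>card Y\<close> cannot be injective, and a normalised kernel vector is orthogonal to
  everything in \<open>Y\<close>.\<close>

lemma exists_unit_orthogonal:
  assumes C: "finite C" "orthonormal_set C" and Y: "finite Y" "card Y < card C"
  shows "\<exists>x \<in> complex_vector.span C. norm x = 1 \<and> (\<forall>y\<in>Y. cinner x (y::'a::complex_inner) = 0)"
proof -
  obtain F where F: "finite F" "orthonormal_set F" "card F \<le> card Y" "Y \<subseteq> complex_vector.span F"
    using Gram_Schmidt_finite[OF Y(1)] by auto
  have lin: "Vector_Spaces.linear scaleC scaleC (fproj F)"
    by unfold_locales (auto simp: fproj_def scaleC_add_left scaleC_add_right cinner_add_left
      cinner_scaleC_left sum.distrib complex_vector.scale_sum_right scaleC_scaleC)
  have ind: "complex_vector.independent C"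
  proof (rule complex_vector.independent_if_scalars_zero[OF C(1)])
    fix f x assume "(\<Sum>x\<in>C. f x *\<^sub>C x) = 0" "x \<in> C"
    then show "f x = 0" using cinner_orthonormal_sum[OF C(2,1), of x f] by simp
  qed
  have "\<exists>x\<in>complex_vector.span C. x \<noteq> 0 \<and> fproj F x = 0"
  proof (rule ccontr)
    assume *: "\<not> ?thesis"
    interpret l: Vector_Spaces.linear scaleC scaleC "fproj F" by (rule lin)
    have inj: "inj_on (fproj F) (complex_vector.span C)"
      using * by (subst l.inj_on_iff_eq_0) auto
    have "complex_vector.independent (fproj F ` C)"
      using l.independent_injective_image[OF ind inj] .
    moreover have "fproj F ` C \<subseteq> complex_vector.span F" using fproj_in_span by auto
    ultimately have "card (fproj F ` C) \<le> card F"
      using complex_vector.independent_span_bound[OF F(1)] by blast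
    moreover have "card (fproj F ` C) = card C"
      by (rule card_image) (use inj complex_vector.span_superset inj_on_subset in blast)
    ultimately show False using Y F(3) by simp
  qed
  then obtain x where x: "x \<in> complex_vector.span C" "x \<noteq> 0" "fproj F x = 0" by blast
  define u where "u = complex_of_real (1 / norm x) *\<^sub>C x"
  have xF: "cinner x f = 0" if "f \<in> F" for f using cinner_fproj[OF F(2,1) that, of x] x by simp
  have "cinner x y = 0" if "y \<in> Y" for y using cinner_span_eq_0[of F x y] xF F that by auto
  then have "\<forall>y\<in>Y. cinner u y = 0" by (simp add: u_def cinner_scaleC_left)
  moreover have "norm u = 1" using x by (simp add: u_def norm_scaleC norm_divide)
  moreover have "u \<in> complex_vector.span C"
    using x by (auto simp: u_def intro: complex_vector.span_scale)
  ultimately show ?thesis by blast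
qed

section \<open>Projections, orthonormal bases and adjoints\<close>

lemma csubspace_closure:
  assumes "complex_vector.subspace (V::'a::complex_inner set)"
  shows "closed_csubspace (closure V)"
  unfolding closed_csubspace_def complex_vector.subspace_def
proof (intro conjI ballI allI)
  show "0 \<in> closure V" using assms closure_subset[of V] by (auto simp: complex_vector.subspace_def)
next
  fix x y assume "x \<in> closure V" "y \<in> closure V"
  then obtain f g where "\<And>n. f n \<in> V" "f \<longlonglongrightarrow> x" "\<And>n. g n \<in> V" "g \<longlonglongrightarrow> y"
    unfolding closure_sequential by metis
  then show "x + y \<in> closure V" unfolding closure_sequential using assms
    by (intro exI[of _ "\<lambda>n. f n + g n"]) (auto intro!: tendsto_add simp: complex_vector.subspace_def)
next
  fix c x assume "x \<in> closure V"
  then obtain f where "\<And>n. f n \<in> V" "f \<longlonglongrightarrow> x"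
    unfolding closure_sequential by metis
  then show "c *\<^sub>C x \<in> closure V" unfolding closure_sequential using assms
    by (intro exI[of _ "\<lambda>n. c *\<^sub>C f n"]) (auto intro!: tendsto_scaleC simp: complex_vector.subspace_def)
qed auto

lemma closed_csubspace_closure_span: "closed_csubspace (closure (complex_vector.span B))"
  by (rule csubspace_closure) simp

lemma closure_span_minimal:
  assumes "closed_csubspace V" "B \<subseteq> V"
  shows "closure (complex_vector.span B) \<subseteq> V"
  using assms unfolding closed_csubspace_def
  by (intro closure_minimal complex_vector.span_minimal) auto

lemma subset_closure_span: "B \<subseteq> closure (complex_vector.span B)"
  using complex_vector.span_superset closure_subset by blast

lemma csubspaceD:
  assumes "complex_vector.subspace V"
  shows "0 \<in> V" "x \<in> V \<Longrightarrow> y \<in> V \<Longrightarrow> x + y \<in> V" "x \<in> V \<Longrightarrow> y \<in> V \<Longrightarrow> x - y \<in> V"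
    "x \<in> V \<Longrightarrow> c *\<^sub>C x \<in> V" "x \<in> V \<Longrightarrow> r *\<^sub>R x \<in> V"
  using assms by (auto simp: scaleR_scaleC complex_vector.subspace_def
      intro: complex_vector.subspace_diff)

lemma closed_csubspace_ocomp: "closed_csubspace (ocomp V)"
proof -
  have "ocomp V = (\<Inter>x\<in>V. {y. cinner y x = 0})" by (auto simp: ocomp_def)
  moreover have "closed {y. cinner y x = 0}" for x :: 'a
    by (intro closed_Collect_eq continuous_on_cinner continuous_on_id continuous_on_const)
  ultimately have "closed (ocomp V)" by auto
  then show ?thesis
    by (auto simp: closed_csubspace_def complex_vector.subspace_def ocomp_def
        cinner_add_left cinner_scaleC_left)
qed

text \<open>The distance from \<open>x\<close> to \<open>V\<close> is attained because a minimising
  sequence is Cauchy; a residual not orthogonal to \<open>V\<close> could be shortened.\<close>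

lemma projection_exists:
  fixes x :: "'a::chilbert_space"
  assumes "closed_csubspace V"
  shows "\<exists>y\<in>V. x - y \<in> ocomp V"
proof -
  have V: "complex_vector.subspace V" "closed V" using assms by (auto simp: closed_csubspace_def)
  define \<delta> where "\<delta> = (INF y\<in>V. (norm (x - y))\<^sup>2)"
  have bdd: "bdd_below ((\<lambda>y. (norm (x - y))\<^sup>2) ` V)" by (rule bdd_belowI[of _ 0]) auto
  have \<delta>_le: "\<delta> \<le> (norm (x - y))\<^sup>2" if "y \<in> V" for y
    unfolding \<delta>_def by (rule cINF_lower[OF bdd that])
  have "\<exists>y\<in>V. (norm (x - y))\<^sup>2 < \<delta> + 1 / real (Suc n)" for n
    using cINF_less_iff[OF _ bdd, of "\<delta> + 1 / real (Suc n)"] csubspaceD(1)[OF V(1)]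
    by (auto simp: \<delta>_def)
  then obtain y where y: "\<And>n. y n \<in> V" "\<And>n. (norm (x - y n))\<^sup>2 < \<delta> + 1 / real (Suc n)"
    by metis
  \<comment> \<open>Parallelogram law: the midpoint of \<open>y n\<close> and \<open>y m\<close>
    stays in \<open>V\<close>, so its squared distance from \<open>x\<close> is at least \<delta>,
    which leaves only the two errors.\<close>
  have par: "(norm (y n - y m))\<^sup>2 \<le> 2 / real (Suc n) + 2 / real (Suc m)" for n m
  proof -
    have "(norm (y n - y m))\<^sup>2 =
        2 * (norm (x - y n))\<^sup>2 + 2 * (norm (x - y m))\<^sup>2 - 4 * (norm (x - (1/2) *\<^sub>R (y n + y m)))\<^sup>2"
      by (simp add: power2_norm_eq_inner algebra_simps inner_commute)
    moreover have "(1/2) *\<^sub>R (y n + y m) \<in> V" by (intro csubspaceD[OF V(1)] y)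
    ultimately show ?thesis using \<delta>_le[of "(1/2) *\<^sub>R (y n + y m)"] y(2)[of n] y(2)[of m] by simp
  qed
  have "Cauchy y"
  proof (rule metric_CauchyI)
    fix e :: real assume e: "e > 0"
    then obtain M where M: "4 / e\<^sup>2 < real M" using reals_Archimedean2 by blast
    have "dist (y m) (y n) < e" if "m \<ge> M" "n \<ge> M" for m n
    proof -
      have "real M > 0" using M e by (smt (verit) zero_less_divide_iff zero_less_power)
      then have "2 / real (Suc m) + 2 / real (Suc n) \<le> 2 / real M + 2 / real M"
        using that by (intro add_mono divide_left_mono) auto
      also have "\<dots> < e\<^sup>2" using M e \<open>real M > 0\<close> by (simp add: field_simps)
      finally have "(norm (y m - y n))\<^sup>2 < e\<^sup>2" using par[of m n] by linarith
      then show ?thesis using e by (simp add: dist_norm power2_less_imp_less)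
    qed
    then show "\<exists>M. \<forall>m\<ge>M. \<forall>n\<ge>M. dist (y m) (y n) < e" by blast
  qed
  then obtain z where z: "y \<longlonglongrightarrow> z" using Cauchy_convergent convergent_def by blast
  have zV: "z \<in> V" using V(2) y(1) z closed_sequentially by blast
  have "(\<lambda>n. (norm (x - y n))\<^sup>2) \<longlonglongrightarrow> (norm (x - z))\<^sup>2" by (intro tendsto_intros z)
  moreover have "(\<lambda>n. \<delta> + 1 / real (Suc n)) \<longlonglongrightarrow> \<delta> + 0"
    by (intro tendsto_intros LIMSEQ_Suc[OF lim_1_over_n])
  ultimately have "(norm (x - z))\<^sup>2 \<le> \<delta> + 0"
    by (rule LIMSEQ_le) (auto intro!: exI[of _ 0] less_imp_le y(2) simp del: of_nat_Suc)
  then have z\<delta>: "(norm (x - z))\<^sup>2 \<le> \<delta>" by simp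
  have "cinner (x - z) v = 0" if v: "v \<in> V" for v
  proof (cases "v = 0")
    case False
    \<comment> \<open>\<open>c\<close> is the coefficient of \<open>v\<close> in the residual; by
      Pythagoras, removing this component shortens the residual unless \<open>c\<close> is
      zero.\<close>
    define c where "c = cinner (x - z) v / (norm v)\<^sup>2"
    have "z + c *\<^sub>C v \<in> V" by (intro csubspaceD[OF V(1)] zV v)
    then have "(norm (x - z))\<^sup>2 \<le> (norm (x - (z + c *\<^sub>C v)))\<^sup>2" using \<delta>_le z\<delta> order_trans by blast
    moreover have "cinner (x - (z + c *\<^sub>C v)) v = 0"
      using False by (simp add: c_def cinner_diff_left cinner_add_left cinner_scaleC_left cinner_self)
    then have "cinner (x - (z + c *\<^sub>C v)) (c *\<^sub>C v) = 0"
      by (simp add: cinner_scaleC_right)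
    from norm_add_cinner_0[OF this]
    have "(norm (x - z))\<^sup>2 = (norm (x - (z + c *\<^sub>C v)))\<^sup>2 + (norm (c *\<^sub>C v))\<^sup>2"
      by simp
    ultimately have "norm (c *\<^sub>C v) = 0" by simp
    then have "c = 0" using False by (simp add: norm_scaleC)
    then show ?thesis using False by (simp add: c_def)
  qed simp
  then show ?thesis using zV by (auto simp: ocomp_def)
qed

text \<open>\<open>hdim\<close> picks a basis by choice, so it is meaningful only once a basis is
  known to exist. If the closed span of a maximal orthonormal set missed a point, the normalised
  residual of that point would enlarge the set.\<close>

lemma onb_exists: "\<exists>B. is_onb (UNIV :: 'a::chilbert_space set) B"
proof -
  have "\<exists>B\<in>{B::'a set. orthonormal_set B}. \<forall>X\<in>{B. orthonormal_set B}. B \<subseteq> X \<longrightarrow> X = B"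
  proof (rule subset_Zorn')
    fix C :: "'a set set" assume C: "subset.chain {B. orthonormal_set B} C"
    then show "\<Union> C \<in> {B. orthonormal_set B}"
    proof (clarsimp simp: orthonormal_set_def)
      fix X Y x y assume X: "X \<in> C" "x \<in> X" and Y: "Y \<in> C" "y \<in> Y"
      obtain Z where "Z \<in> C" "x \<in> Z" "y \<in> Z"
        using C X Y unfolding subset_chain_def by (metis in_mono)
      moreover from this have "orthonormal_set Z" using C by (auto simp: subset_chain_def)
      ultimately show "(x = y \<longrightarrow> cinner y y = 1) \<and> (x \<noteq> y \<longrightarrow> cinner x y = 0)"
        by (auto simp: orthonormal_set_def)
    qed
  qed
  then obtain B :: "'a set" where B: "orthonormal_set B"
    "\<And>X. orthonormal_set X \<Longrightarrow> B \<subseteq> X \<Longrightarrow> X = B" by auto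
  have "x \<in> closure (complex_vector.span B)" for x
  proof (rule ccontr)
    assume x: "x \<notin> closure (complex_vector.span B)"
    obtain y where y: "y \<in> closure (complex_vector.span B)" "x - y \<in> ocomp (closure (complex_vector.span B))"
      using projection_exists[OF closed_csubspace_closure_span] by blast
    define u where "u = (1 / norm (x - y)) *\<^sub>R (x - y)"
    have "x \<noteq> y" using x y by auto
    then have u: "norm u = 1" by (simp add: u_def)
    have uB: "cinner u b = 0" if "b \<in> B" for b
      using y(2) that subset_closure_span[of B] by (auto simp: u_def ocomp_def)
    have "insert u B = B" using B(2)[OF orthonormal_set_insert[OF B(1) u uB]] by auto
    then show False using uB[of u] u by (auto simp: cinner_self)
  qed
  then show ?thesis using B(1) by (auto simp: is_onb_def)
qed

section \<open>Adjoints and dimension\<close>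

lemma bounded_opD:
  assumes "bounded_op_on UNIV T"
  shows "T (x + y) = T x + T y" "T (c *\<^sub>C x) = c *\<^sub>C T x" "T 0 = 0" "T (x - y) = T x - T y"
    "bounded_linear T"
proof -
  show "bounded_linear T" using assms bounded_op_on_UNIV by blast
  then show "T 0 = 0" "T (x - y) = T x - T y" by (simp_all add: bounded_linear.linear linear_0 linear_diff)
qed (use assms in \<open>auto simp: bounded_op_on_def\<close>)

text \<open>Riesz representation of the functional \<open>cinner (T x) y\<close> of
  \<open>x\<close>: its kernel \<open>N\<close> is closed, and a vector \<open>u\<close> orthogonal
  to \<open>N\<close> represents it up to a scalar.\<close>

lemma adjoint_exists:
  fixes T :: "'a::chilbert_space \<Rightarrow> 'a"
  assumes T: "bounded_op_on UNIV T"
  shows "\<exists>z. \<forall>x. cinner (T x) y = cinner x z"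
proof -
  define N where "N = {x. cinner (T x) y = 0}"
  have "closed N" unfolding N_def
    by (intro closed_Collect_eq continuous_on_cinner continuous_on_const
        linear_continuous_on bounded_opD(5)[OF T])
  then have N: "closed_csubspace N"
    by (auto simp: closed_csubspace_def N_def complex_vector.subspace_def bounded_opD[OF T]
        cinner_add_left cinner_scaleC_left)
  show ?thesis
  proof (cases "N = UNIV")
    case True
    then show ?thesis by (intro exI[of _ 0]) (auto simp: N_def)
  next
    case False
    then obtain x0 where "x0 \<notin> N" by auto
    moreover obtain p where "p \<in> N" "x0 - p \<in> ocomp N" using projection_exists[OF N] by blast
    moreover define u where "u = x0 - p"
    ultimately have u: "u \<in> ocomp N" "cinner (T u) y \<noteq> 0"
      by (auto simp: N_def bounded_opD[OF T] cinner_diff_left)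
    have "u \<noteq> 0" using u(2) by (auto simp: bounded_opD[OF T])
    define z where "z = (cnj (cinner (T u) y) / (norm u)\<^sup>2) *\<^sub>C u"
    have "cinner (T x) y = cinner x z" for x
    proof -
      \<comment> \<open>The combination of \<open>x\<close> and \<open>u\<close> on which the
        functional vanishes; it lies in \<open>N\<close> and is therefore orthogonal to
        \<open>u\<close>.\<close>
      define v where "v = cinner (T u) y *\<^sub>C x - cinner (T x) y *\<^sub>C u"
      have "v \<in> N" by (simp add: v_def N_def bounded_opD[OF T] cinner_diff_left cinner_scaleC_left)
      then have "cinner v u = 0" using u(1) by (simp add: ocomp_def cinner_eq_0_commute[of v u])
      then have "cinner (T u) y * cinner x u = cinner (T x) y * (norm u)\<^sup>2"
        by (simp add: v_def cinner_diff_left cinner_scaleC_left cinner_self)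
      then show ?thesis using \<open>u \<noteq> 0\<close> by (simp add: z_def cinner_scaleC_right field_simps)
    qed
    then show ?thesis by blast
  qed
qed

lemma hdim_UNIV_onb:
  obtains B where "is_onb (UNIV::'a::chilbert_space set) B"
    "hdim (UNIV::'a set) = (if finite B then enat (card B) else \<infinity>)"
  using someI_ex[OF onb_exists] unfolding hdim_def Let_def by metis

lemma orthonormal_of_card_le_hdim:
  assumes "enat n \<le> hdim (UNIV::'a::chilbert_space set)"
  shows "\<exists>C::'a set. finite C \<and> orthonormal_set C \<and> card C = n"
proof -
  obtain B where B: "is_onb (UNIV::'a set) B"
    "hdim (UNIV::'a set) = (if finite B then enat (card B) else \<infinity>)"
    by (rule hdim_UNIV_onb)
  have "\<exists>C\<subseteq>B. finite C \<and> card C = n"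
  proof (cases "finite B")
    case True
    then show ?thesis using B(2) assms obtain_subset_with_card_n[of n B] finite_subset by auto
  next
    case False
    then show ?thesis using infinite_arbitrarily_large by blast
  qed
  then show ?thesis using B(1) orthonormal_set_subset unfolding is_onb_def by blast
qed

section \<open>Joint numerical ranges and diagonal weights\<close>

text \<open>The formula of \<open>diagonal_entry\<close>, but meant for arbitrary vectors: it is
  unnormalised and hence homogeneous of degree two, which lets bounds on unit vectors pass to all
  vectors.\<close>

definition quad :: "('m::finite \<Rightarrow> 'a \<Rightarrow> 'a::complex_inner) \<Rightarrow> 'a \<Rightarrow> complex ^ 'm" where
  "quad T x = (\<chi> j. cinner (T j x) x)"

lemma joint_num_range_quad:
  "joint_num_range V k T = {(\<Sum>l<k. quad T (x l)) | x.
     (\<forall>l<k. x l \<in> V) \<and> (\<forall>i<k. \<forall>l<k. cinner (x i) (x l) = (if i = l then 1 else 0))}"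
proof -
  have "(\<chi> j. \<Sum>l<k. cinner (T j (x l)) (x l)) = (\<Sum>l<k. quad T (x l))" for x
    by (simp add: vec_eq_iff quad_def)
  then show ?thesis unfolding joint_num_range_def by simp
qed

text \<open>Orthonormality forces a family to be injective, so tuples can be traded for sets; sums
  over sets suit the exchange, union and insertion arguments below.\<close>

lemma joint_num_range_eq:
  "joint_num_range V k T =
     {(\<Sum>g\<in>G. quad T g) | G. G \<subseteq> V \<and> finite G \<and> card G = k \<and> orthonormal_set G}" (is "_ = ?R")
proof
  show "joint_num_range V k T \<subseteq> ?R"
  proof
    fix z assume "z \<in> joint_num_range V k T"
    then obtain x where z: "z = (\<Sum>l<k. quad T (x l))" and x: "\<And>l. l < k \<Longrightarrow> x l \<in> V"
      "\<And>i l. i < k \<Longrightarrow> l < k \<Longrightarrow> cinner (x i) (x l) = (if i = l then 1 else 0)"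
      unfolding joint_num_range_quad by blast
    have inj: "inj_on x {..<k}"
      using x(2) by (intro inj_onI) (metis lessThan_iff zero_neq_one)
    have "orthonormal_set (x ` {..<k})" using x(2) inj by (auto simp: orthonormal_set_def inj_on_def)
    moreover have "z = (\<Sum>g\<in>x ` {..<k}. quad T g)" by (simp add: z sum.reindex[OF inj])
    moreover have "card (x ` {..<k}) = k" by (simp add: card_image[OF inj])
    ultimately show "z \<in> ?R" using x(1) by blast
  qed
  show "?R \<subseteq> joint_num_range V k T"
  proof
    fix z assume "z \<in> ?R"
    then obtain G where z: "z = (\<Sum>g\<in>G. quad T g)" and G: "G \<subseteq> V" "finite G" "card G = k" "orthonormal_set G"
      by blast
    obtain h where h: "bij_betw h {0..<k} G" using ex_bij_betw_nat_finite[OF G(2)] G(3) by auto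
    then have h: "bij_betw h {..<k} G" by (simp add: atLeast0LessThan)
    have "z = (\<Sum>l<k. quad T (h l))" unfolding z by (rule sum.reindex_bij_betw[OF h, symmetric])
    moreover have "\<forall>i<k. \<forall>l<k. cinner (h i) (h l) = (if i = l then 1 else 0)"
      using G(4) h by (auto simp: orthonormal_set_def bij_betw_def inj_on_def)
    moreover have "\<forall>l<k. h l \<in> V" using h G(1) by (auto simp: bij_betw_def)
    ultimately show "z \<in> joint_num_range V k T" unfolding joint_num_range_quad by blast
  qed
qed

lemma joint_num_rangeI:
  "G \<subseteq> V \<Longrightarrow> finite G \<Longrightarrow> card G = k \<Longrightarrow> orthonormal_set G \<Longrightarrow> (\<Sum>g\<in>G. quad T g) \<in> joint_num_range V k T"
  unfolding joint_num_range_eq by blast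

text \<open>\<open>X\<close> is a matrix with \<open>k\<close> orthonormal rows and columns indexed
  by \<open>G\<close>, and \<open>t\<close> collects its squared column norms. Equivalently,
  \<open>t\<close> is the diagonal of an orthogonal projection of rank \<open>k\<close>.\<close>

definition frame_weights :: "'g set \<Rightarrow> nat \<Rightarrow> ('g \<Rightarrow> real) \<Rightarrow> bool" where
  "frame_weights G k t \<longleftrightarrow> (\<exists>X::nat \<Rightarrow> 'g \<Rightarrow> complex.
     (\<forall>i<k. \<forall>l<k. (\<Sum>g\<in>G. X i g * cnj (X l g)) = (if i = l then 1 else 0)) \<and>
     (\<forall>g\<in>G. (\<Sum>l<k. (cmod (X l g))\<^sup>2) = t g))"

text \<open>Rotating the columns \<open>p\<close> and \<open>q\<close> of \<open>X\<close> into each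
  other keeps the rows orthonormal and the sum of the two weights. As the angle runs from 0 to pi/2,
  the weight at \<open>p\<close> moves continuously from \<open>t p\<close> to \<open>t q\<close>,
  so it takes the value \<open>s p\<close> on the way.\<close>

lemma frame_weights_transform:
  assumes G: "finite G" "p \<in> G" "q \<in> G" "p \<noteq> q" and t: "frame_weights G k t"
    and s: "s p + s q = t p + t q" "t q \<le> s p" "s p \<le> t p" "\<And>g. g \<in> G - {p, q} \<Longrightarrow> s g = t g"
  shows "frame_weights G k s"
proof -
  obtain X :: "nat \<Rightarrow> 'a \<Rightarrow> complex" where
    X: "\<And>i l. i < k \<Longrightarrow> l < k \<Longrightarrow> (\<Sum>g\<in>G. X i g * cnj (X l g)) = (if i = l then 1 else 0)"
      "\<And>g. g \<in> G \<Longrightarrow> (\<Sum>l<k. (cmod (X l g))\<^sup>2) = t g"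
    using t unfolding frame_weights_def by blast
  define f where "f \<theta> = (\<Sum>l<k. (cmod (of_real (cos \<theta>) * X l p + of_real (sin \<theta>) * X l q))\<^sup>2)" for \<theta>
  have "\<exists>\<theta>\<ge>0. \<theta> \<le> pi / 2 \<and> f \<theta> = s p"
  proof (rule IVT2')
    show "f (pi / 2) \<le> s p" using s X(2)[OF G(3)] by (simp add: f_def)
    show "s p \<le> f 0" using s X(2)[OF G(2)] by (simp add: f_def)
    show "continuous_on {0..pi / 2} f" unfolding f_def by (intro continuous_intros)
  qed simp
  then obtain \<theta> where \<theta>: "f \<theta> = s p" by blast
  define c d where "c = complex_of_real (cos \<theta>)" and "d = complex_of_real (sin \<theta>)"
  have cd: "c * c + d * d = 1"
    unfolding c_def d_def of_real_mult[symmetric] of_real_add[symmetric] by simp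
  have cnj: "cnj c = c" "cnj d = d" by (simp_all add: c_def d_def)
  define Y where "Y l g = (if g = p then c * X l p + d * X l q
      else if g = q then c * X l q - d * X l p else X l g)" for l g
  have split: "sum h G = h p + h q + sum h (G - {p, q})" for h :: "'a \<Rightarrow> 'c::comm_monoid_add"
  proof -
    have "sum h G = h p + sum h (G - {p})" using G by (simp add: sum.remove)
    also have "sum h (G - {p}) = h q + sum h (G - {p} - {q})" using G by (simp add: sum.remove)
    also have "G - {p} - {q} = G - {p, q}" by auto
    finally show ?thesis by (simp add: add.assoc)
  qed
  have mix: "(c * a + d * b) * cnj (c * a' + d * b') + (c * b - d * a) * cnj (c * b' - d * a') =
      a * cnj a' + b * cnj b'" for a b a' b'
  proof -
    have "(c * a + d * b) * cnj (c * a' + d * b') + (c * b - d * a) * cnj (c * b' - d * a') =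
        (c * c + d * d) * (a * cnj a' + b * cnj b')"
      by (simp add: cnj algebra_simps)
    then show ?thesis by (simp add: cd)
  qed
  have YX: "(\<Sum>g\<in>G. Y i g * cnj (Y l g)) = (\<Sum>g\<in>G. X i g * cnj (X l g))" for i l
    unfolding split using G(4) mix[of "X i p" "X i q" "X l p" "X l q"] by (simp add: Y_def)
  have Yp: "(\<Sum>l<k. (cmod (Y l p))\<^sup>2) = s p" using \<theta> by (simp add: f_def Y_def c_def d_def)
  have "(cmod (Y l p))\<^sup>2 + (cmod (Y l q))\<^sup>2 = (cmod (X l p))\<^sup>2 + (cmod (X l q))\<^sup>2" for l
  proof -
    have "complex_of_real ((cmod (Y l p))\<^sup>2 + (cmod (Y l q))\<^sup>2) =
        complex_of_real ((cmod (X l p))\<^sup>2 + (cmod (X l q))\<^sup>2)"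
      unfolding of_real_add complex_norm_square using mix[of "X l p" "X l q" "X l p" "X l q"] G(4)
      by (simp add: Y_def)
    then show ?thesis unfolding of_real_eq_iff .
  qed
  then have "(\<Sum>l<k. (cmod (Y l p))\<^sup>2) + (\<Sum>l<k. (cmod (Y l q))\<^sup>2) =
      (\<Sum>l<k. (cmod (X l p))\<^sup>2) + (\<Sum>l<k. (cmod (X l q))\<^sup>2)"
    unfolding sum.distrib[symmetric] by simp
  then have "(\<Sum>l<k. (cmod (Y l p))\<^sup>2) + (\<Sum>l<k. (cmod (Y l q))\<^sup>2) = t p + t q"
    using X(2) G by simp
  then have Yq: "(\<Sum>l<k. (cmod (Y l q))\<^sup>2) = s q" using Yp s(1) by simp
  have "(\<Sum>l<k. (cmod (Y l g))\<^sup>2) = s g" if "g \<in> G" for g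
    using Yp Yq X(2)[OF that] s(4)[of g] that by (cases "g = p \<or> g = q") (auto simp: Y_def)
  then show ?thesis unfolding frame_weights_def using X(1) YX by (intro exI[of _ Y]) auto
qed

text \<open>The Schur--Horn theorem for projections. A weight vector with a fractional entry lies on the
  segment between a vector with fewer fractional entries and its image under a transposition.\<close>

lemma frame_weights_exist:
  assumes "finite G" "\<And>g. g \<in> G \<Longrightarrow> 0 \<le> t g \<and> t g \<le> 1" "sum t G = real k"
  shows "frame_weights G k t"
  using assms(2,3)
proof (induction "card {g \<in> G. t g \<noteq> 0 \<and> t g \<noteq> 1}" arbitrary: t rule: less_induct)
  case less
  let ?Fr = "\<lambda>t. {g \<in> G. t g \<noteq> 0 \<and> t g \<noteq> (1::real)}"
  show ?case
  proof (cases "?Fr t = {}")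
    case True
    \<comment> \<open>Without fractional weights, the coordinate vectors of the \<open>k\<close>
      indices of weight one serve as rows.\<close>
    define S where "S = {g \<in> G. t g = 1}"
    have "sum t G = (\<Sum>g\<in>G. if t g = 1 then 1 else 0)" using True by (intro sum.cong) auto
    also have "\<dots> = real (card S)" by (simp add: S_def sum.inter_filter[OF assms(1), symmetric])
    finally have S: "card S = k" "finite S" using less.prems assms(1) by (auto simp: S_def)
    then obtain h where "bij_betw h {0..<k} S" using ex_bij_betw_nat_finite by blast
    then have h: "inj_on h {..<k}" "h ` {..<k} = S" by (auto simp: atLeast0LessThan bij_betw_def)
    define X where "X l g = (if g = h l then 1 else 0 :: complex)" for l g
    have "(\<Sum>g\<in>G. X i g * cnj (X l g)) = (if i = l then 1 else 0)" if "i < k" "l < k" for i l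
    proof -
      have "(\<Sum>g\<in>G. X i g * cnj (X l g)) = (\<Sum>g\<in>G. if g = h i then (if h i = h l then 1 else 0) else 0)"
        by (intro sum.cong) (auto simp: X_def)
      moreover have "h i \<in> G" using h(2) that by (auto simp: S_def)
      ultimately show ?thesis using that h(1) assms(1) by (auto simp: inj_on_def)
    qed
    moreover have "(\<Sum>l<k. (cmod (X l g))\<^sup>2) = t g" if g: "g \<in> G" for g
    proof (cases "g \<in> S")
      case gS: True
      then obtain l where l: "l < k" "g = h l" using h(2) by auto
      have "(\<Sum>i<k. (cmod (X i g))\<^sup>2) = (\<Sum>i<k. if i = l then 1 else 0)"
        using l h(1) by (intro sum.cong) (auto simp: X_def inj_on_def)
      then show ?thesis using l gS by (simp add: S_def)
    next
      case gS: False
      then have "t g = 0" using True g by (auto simp: S_def)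
      moreover have "X l g = 0" if "l < k" for l using gS that h(2) by (auto simp: X_def)
      ultimately show ?thesis by simp
    qed
    ultimately show ?thesis unfolding frame_weights_def by blast
  next
    case False
    then obtain p0 where p0: "p0 \<in> G" "t p0 \<noteq> 0" "t p0 \<noteq> 1" by auto
    \<comment> \<open>A single fractional entry would make the total non-integral.\<close>
    have "\<exists>q0\<in>?Fr t. q0 \<noteq> p0"
    proof (rule ccontr)
      assume no: "\<not> ?thesis"
      have "sum t (G - {p0}) = (\<Sum>g\<in>G - {p0}. real (if t g = 1 then 1 else 0))"
        using no by (intro sum.cong) auto
      then have "sum t (G - {p0}) = real (\<Sum>g\<in>G - {p0}. if t g = 1 then 1 else 0)" by simp
      moreover have "sum t G = t p0 + sum t (G - {p0})" using p0 assms(1) by (simp add: sum.remove)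
      ultimately obtain n :: nat where "t p0 + real n = real k" using less.prems(2) by metis
      moreover have "0 < t p0" "t p0 < 1" using less.prems(1)[OF p0(1)] p0 by auto
      ultimately have "n < k" "k < n + 1" by linarith+
      then show False by simp
    qed
    then obtain p q where pq: "p \<in> ?Fr t" "q \<in> ?Fr t" "p \<noteq> q" "t q \<le> t p"
      using p0 by (metis (mono_tags, lifting) linear mem_Collect_eq)
    have b: "0 < t p" "t p < 1" "0 < t q" "t q < 1"
      using less.prems(1)[of p] less.prems(1)[of q] pq by auto
    \<comment> \<open>The largest amount that can be moved from \<open>q\<close> to \<open>p\<close>
      within [0,1]; it settles at least one of the two entries, so \<open>t'\<close> has fewer
      fractional ones.\<close>
    define u where "u = min (1 - t p) (t q)"
    define t' where "t' = t(p := t p + u, q := t q - u)"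
    have u: "0 < u" "u \<le> 1 - t p" "u \<le> t q" using b by (auto simp: u_def)
    have t'pq: "t' p = t p + u" "t' q = t q - u" "\<And>g. g \<noteq> p \<Longrightarrow> g \<noteq> q \<Longrightarrow> t' g = t g"
      using pq by (auto simp: t'_def)
    have sub: "?Fr t' \<subset> ?Fr t"
    proof -
      have "t' p = 1 \<or> t' q = 0" by (auto simp: t'pq u_def)
      then have "\<exists>g\<in>?Fr t. g \<notin> ?Fr t'" using pq by auto
      moreover have "?Fr t' \<subseteq> ?Fr t" using pq t'pq by (auto, metis+)
      ultimately show ?thesis by blast
    qed
    have split: "sum h G = h p + h q + sum h (G - {p, q})" for h :: "'a \<Rightarrow> real"
    proof -
      have "sum h G = h p + sum h (G - {p})" using pq assms(1) by (simp add: sum.remove)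
      also have "sum h (G - {p}) = h q + sum h (G - {p} - {q})" using pq assms(1) by (simp add: sum.remove)
      also have "G - {p} - {q} = G - {p, q}" by auto
      finally show ?thesis by (simp add: add.assoc)
    qed
    have "frame_weights G k t'"
    proof (rule less.hyps)
      show "card (?Fr t') < card (?Fr t)" using sub assms(1) by (intro psubset_card_mono) auto
      show "0 \<le> t' g \<and> t' g \<le> 1" if "g \<in> G" for g
        using less.prems(1)[OF that] t'pq u b by (cases "g = p"; cases "g = q") auto
      have "sum t' (G - {p, q}) = sum t (G - {p, q})" by (intro sum.cong) (auto simp: t'pq)
      then show "sum t' G = real k" using split[of t] split[of t'] less.prems(2) t'pq by simp
    qed
    show ?thesis
    proof (rule frame_weights_transform[OF assms(1) _ _ pq(3) \<open>frame_weights G k t'\<close>])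
      show "p \<in> G" "q \<in> G" using pq by auto
      show "t p + t q = t' p + t' q" "t' q \<le> t p" "t p \<le> t' p" using t'pq(1,2) u pq(4) by auto
      show "t g = t' g" if "g \<in> G - {p, q}" for g using t'pq(3)[of g] that by auto
    qed
  qed
qed

section \<open>Weighted values of orthonormal systems and Ky Fan estimates\<close>

lemma orthonormal_family_sum:
  assumes G: "finite G"
    and b: "\<And>g h. g \<in> G \<Longrightarrow> h \<in> G \<Longrightarrow> cinner (b g) (b h) = (if g = h then 1 else 0)"
  shows "cinner (\<Sum>g\<in>G. x g *\<^sub>C b g) (\<Sum>g\<in>G. y g *\<^sub>C b g) = (\<Sum>g\<in>G. x g * cnj (y g))"
proof -
  have "cinner (\<Sum>g\<in>G. x g *\<^sub>C b g) (\<Sum>g\<in>G. y g *\<^sub>C b g) =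
      (\<Sum>h\<in>G. \<Sum>g\<in>G. x h * cnj (y g) * cinner (b h) (b g))"
    by (simp add: cinner_sum_left cinner_sum_right cinner_scaleC_left cinner_scaleC_right
        sum_distrib_left mult_ac) (rule sum.swap)
  also have "\<dots> = (\<Sum>h\<in>G. \<Sum>g\<in>G. if g = h then x h * cnj (y h) else 0)"
    by (intro sum.cong) (auto simp: b)
  finally show ?thesis using G by simp
qed

lemma bounded_op_on_sum:
  assumes "complex_vector.subspace V" "bounded_op_on V T" "\<And>g. g \<in> G \<Longrightarrow> b g \<in> V"
  shows "T (\<Sum>g\<in>G. x g *\<^sub>C b g) = (\<Sum>g\<in>G. x g *\<^sub>C T (b g)) \<and> (\<Sum>g\<in>G. x g *\<^sub>C b g) \<in> V"
proof -
  have z: "T 0 = 0"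
  proof -
    have "T (0 + 0) = T 0 + T 0" using assms csubspaceD(1)[OF assms(1)] unfolding bounded_op_on_def by blast
    then show ?thesis by simp
  qed
  show ?thesis using assms(3)
  proof (induction G rule: infinite_finite_induct)
    case (insert g G)
    then have "x g *\<^sub>C b g \<in> V" "(\<Sum>g\<in>G. x g *\<^sub>C b g) \<in> V" "b g \<in> V"
      using csubspaceD(4)[OF assms(1)] by auto
    moreover from this have "T (x g *\<^sub>C b g + (\<Sum>g\<in>G. x g *\<^sub>C b g)) = x g *\<^sub>C T (b g) + T (\<Sum>g\<in>G. x g *\<^sub>C b g)"
      using assms(2) unfolding bounded_op_on_def by metis
    ultimately show ?case using insert csubspaceD(2)[OF assms(1)] by simp
  qed (use z csubspaceD(1)[OF assms(1)] in auto)
qed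

text \<open>Combining the \<open>b g\<close> with the rows of a frame as coefficients gives
  orthonormal vectors again. As mixed terms vanish, their values add up to the column weights times
  \<open>quad T (b g)\<close>. This realises weighted sums inside the range itself, without passing
  to a hull.\<close>

lemma weighted_quad_in_range:
  fixes T :: "'m::finite \<Rightarrow> 'a \<Rightarrow> 'a::complex_inner"
  assumes V: "complex_vector.subspace V" and T: "\<And>j. bounded_op_on V (T j)"
    and G: "finite G" "\<And>g. g \<in> G \<Longrightarrow> b g \<in> V"
    and b: "\<And>g h. g \<in> G \<Longrightarrow> h \<in> G \<Longrightarrow> cinner (b g) (b h) = (if g = h then 1 else 0)"
    and cross: "\<And>j g h. g \<in> G \<Longrightarrow> h \<in> G \<Longrightarrow> g \<noteq> h \<Longrightarrow> cinner (T j (b g)) (b h) = 0"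
    and t: "\<And>g. g \<in> G \<Longrightarrow> 0 \<le> t g \<and> t g \<le> 1" "sum t G = real k"
  shows "(\<Sum>g\<in>G. t g *\<^sub>R quad T (b g)) \<in> joint_num_range V k T"
proof -
  obtain X :: "nat \<Rightarrow> 'b \<Rightarrow> complex" where
    X: "\<And>i l. i < k \<Longrightarrow> l < k \<Longrightarrow> (\<Sum>g\<in>G. X i g * cnj (X l g)) = (if i = l then 1 else 0)"
      "\<And>g. g \<in> G \<Longrightarrow> (\<Sum>l<k. (cmod (X l g))\<^sup>2) = t g"
    using frame_weights_exist[OF G(1) t] unfolding frame_weights_def by blast
  define y where "y l = (\<Sum>g\<in>G. X l g *\<^sub>C b g)" for l
  have lin: "T j (y l) = (\<Sum>g\<in>G. X l g *\<^sub>C T j (b g))" "y l \<in> V" for j l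
    using bounded_op_on_sum[OF V T G(2), of G "\<lambda>x. x"] unfolding y_def by auto
  have q: "cinner (T j (y l)) (y l) = (\<Sum>g\<in>G. of_real ((cmod (X l g))\<^sup>2) * cinner (T j (b g)) (b g))" for j l
  proof -
    have "cinner (T j (y l)) (y l) =
        (\<Sum>h\<in>G. \<Sum>g\<in>G. X l h * cnj (X l g) * cinner (T j (b h)) (b g))"
      unfolding lin by (simp add: y_def cinner_sum_left cinner_sum_right cinner_scaleC_left
          cinner_scaleC_right sum_distrib_left mult_ac) (rule sum.swap)
    also have "\<dots> = (\<Sum>h\<in>G. \<Sum>g\<in>G. if g = h then X l h * cnj (X l h) * cinner (T j (b h)) (b h) else 0)"
      by (intro sum.cong) (auto simp: cross)
    finally show ?thesis using G(1) by (simp add: complex_norm_square del: of_real_power)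
  qed
  have "(\<Sum>l<k. quad T (y l)) = (\<Sum>g\<in>G. t g *\<^sub>R quad T (b g))"
  proof (rule vec_eq_iff[THEN iffD2], rule allI)
    fix j
    have "(\<Sum>l<k. quad T (y l)) $ j = (\<Sum>l<k. \<Sum>g\<in>G. of_real ((cmod (X l g))\<^sup>2) * cinner (T j (b g)) (b g))"
      by (simp add: quad_def q)
    also have "\<dots> = (\<Sum>g\<in>G. (\<Sum>l<k. of_real ((cmod (X l g))\<^sup>2)) * cinner (T j (b g)) (b g))"
      by (subst sum.swap) (simp add: sum_distrib_right)
    also have "\<dots> = (\<Sum>g\<in>G. of_real (t g) * cinner (T j (b g)) (b g))"
      using X(2) by (intro sum.cong refl arg_cong2[where f = times]) (simp flip: of_real_sum del: of_real_power)
    finally show "(\<Sum>l<k. quad T (y l)) $ j = (\<Sum>g\<in>G. t g *\<^sub>R quad T (b g)) $ j"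
      by (simp add: quad_def scaleR_conv_of_real[where 'a = complex])
  qed
  moreover have "\<forall>i<k. \<forall>l<k. cinner (y i) (y l) = (if i = l then 1 else 0)"
    using orthonormal_family_sum[OF G(1) b] X(1) by (simp add: y_def)
  ultimately show ?thesis unfolding joint_num_range_quad
    by (auto intro!: exI[of _ y] lin(2))
qed

text \<open>Indicator functions of k-subsets belong to the hypersimplex of weights in [0,1] with
  total \<open>k\<close>. That set is convex, and so is its linear image, which therefore contains
  the hull.\<close>

lemma subset_sums_hull_weights:
  fixes d :: "'g \<Rightarrow> 'v::real_vector"
  assumes G: "finite G" and z: "z \<in> convex hull {sum d H | H. H \<subseteq> G \<and> card H = k}"
  shows "\<exists>t. (\<forall>g\<in>G. 0 \<le> t g \<and> t g \<le> 1) \<and> sum t G = real k \<and> z = (\<Sum>g\<in>G. t g *\<^sub>R d g)"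
proof -
  let ?S = "{z. \<exists>t. (\<forall>g\<in>G. 0 \<le> t g \<and> t g \<le> 1) \<and> sum t G = real k \<and> z = (\<Sum>g\<in>G. t g *\<^sub>R d g)}"
  have "convex hull {sum d H | H. H \<subseteq> G \<and> card H = k} \<subseteq> ?S"
  proof (rule hull_minimal)
    show "{sum d H | H. H \<subseteq> G \<and> card H = k} \<subseteq> ?S"
    proof clarify
      fix H assume H: "H \<subseteq> G" "k = card H"
      have "sum d H = (\<Sum>g\<in>G. if g \<in> H then d g else 0)"
        using H G by (simp add: sum.If_cases Int_absorb1)
      also have "\<dots> = (\<Sum>g\<in>G. (if g \<in> H then 1 else 0::real) *\<^sub>R d g)" by (intro sum.cong) auto
      finally show "\<exists>t. (\<forall>g\<in>G. 0 \<le> t g \<and> t g \<le> 1) \<and> sum t G = real (card H) \<and> sum d H = (\<Sum>g\<in>G. t g *\<^sub>R d g)"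
        using H G by (intro exI[of _ "\<lambda>g. if g \<in> H then 1 else 0"]) (auto simp: sum.If_cases Int_absorb1)
    qed
    show "convex ?S"
    proof (rule convexI, clarify)
      fix u v :: real and t s :: "'g \<Rightarrow> real"
      assume *: "0 \<le> u" "0 \<le> v" "u + v = 1" "\<forall>g\<in>G. 0 \<le> t g \<and> t g \<le> 1" "sum t G = real k"
        "\<forall>g\<in>G. 0 \<le> s g \<and> s g \<le> 1" "sum s G = real k"
      let ?r = "\<lambda>g. u * t g + v * s g"
      have "0 \<le> ?r g \<and> ?r g \<le> 1" if "g \<in> G" for g
        using convex_bound_le[of "t g" 1 "s g" u v] * that by auto
      moreover have "sum ?r G = real k"
      proof -
        have "sum ?r G = u * sum t G + v * sum s G" by (simp add: sum.distrib sum_distrib_left)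
        also have "\<dots> = (u + v) * real k" using *(5,7) by (simp add: algebra_simps)
        finally show ?thesis using *(3) by simp
      qed
      moreover have "u *\<^sub>R (\<Sum>g\<in>G. t g *\<^sub>R d g) + v *\<^sub>R (\<Sum>g\<in>G. s g *\<^sub>R d g) = (\<Sum>g\<in>G. ?r g *\<^sub>R d g)"
        by (simp add: scaleR_sum_right sum.distrib scaleR_add_left)
      ultimately show "\<exists>t'. (\<forall>g\<in>G. 0 \<le> t' g \<and> t' g \<le> 1) \<and> sum t' G = real k \<and>
          u *\<^sub>R (\<Sum>g\<in>G. t g *\<^sub>R d g) + v *\<^sub>R (\<Sum>g\<in>G. s g *\<^sub>R d g) = (\<Sum>g\<in>G. t' g *\<^sub>R d g)"
        by (intro exI[of _ ?r]) simp
    qed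
  qed
  then show ?thesis using z by blast
qed

text \<open>After summing over \<open>X\<close> and exchanging the sums, each \<open>c g\<close> is
  multiplied by the squared coefficients of \<open>g\<close> along \<open>X\<close>, whose total is
  at most one by Bessel. This is the upper half of Ky Fan's maximum principle.\<close>

lemma Ky_Fan_bound:
  assumes X: "finite X" "orthonormal_set X" and N: "\<And>g. g \<in> N \<Longrightarrow> norm g = 1 \<and> 0 \<le> c g"
    and \<tau>: "\<And>x. x \<in> X \<Longrightarrow> \<tau> x \<le> (\<Sum>g\<in>N. c g * (cmod (cinner x g))\<^sup>2) + \<mu> * (norm (x::'a::complex_inner))\<^sup>2"
  shows "sum \<tau> X \<le> sum c N + real (card X) * \<mu>"
proof -
  have "sum \<tau> X \<le> (\<Sum>x\<in>X. (\<Sum>g\<in>N. c g * (cmod (cinner x g))\<^sup>2) + \<mu>)"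
    using \<tau> orthonormal_set_norm[OF X(2)] by (intro sum_mono) fastforce
  also have "\<dots> = (\<Sum>g\<in>N. c g * (\<Sum>x\<in>X. (cmod (cinner g x))\<^sup>2)) + real (card X) * \<mu>"
    unfolding sum.distrib sum_distrib_left by (subst sum.swap) (simp add: cmod_cinner_commute)
  also have "\<dots> \<le> (\<Sum>g\<in>N. c g * 1) + real (card X) * \<mu>"
  proof (intro add_right_mono sum_mono mult_left_mono)
    fix g assume "g \<in> N"
    then show "(\<Sum>x\<in>X. (cmod (cinner g x))\<^sup>2) \<le> 1" "0 \<le> c g"
      using Bessel_finite[OF X(2,1), of g] N[of g] by auto
  qed
  finally show ?thesis by simp
qed

text \<open>Supplies the hypothesis of \<open>Ky_Fan_bound\<close> for a diagonal tuple. On the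
  algebraic span of \<open>E\<close> the form is diagonal with entries at most \<mu> outside
  \<open>N\<close>; boundedness carries the estimate to the closure.\<close>

lemma onb_quad_bound:
  fixes T :: "'m::finite \<Rightarrow> 'a \<Rightarrow> 'a::complex_inner"
  assumes V: "closed_csubspace V" and T: "\<And>j. bounded_op_on V (T j)"
    and E: "is_onb V E" "diagonal_wrt E T" and N: "finite N" "N \<subseteq> E"
    and \<mu>: "\<And>e. e \<in> E - N \<Longrightarrow> inner b (quad T e) \<le> \<mu>" and x: "x \<in> V"
  shows "inner b (quad T x) \<le>
    (\<Sum>g\<in>N. (inner b (quad T g) - \<mu>) * (cmod (cinner x g))\<^sup>2) + \<mu> * (norm x)\<^sup>2"
proof -
  have sV: "complex_vector.subspace V" using V by (simp add: closed_csubspace_def)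
  have EV: "E \<subseteq> V" and oE: "orthonormal_set E" and cE: "closure (complex_vector.span E) = V"
    using E by (auto simp: is_onb_def)
  have span: "inner b (quad T y) \<le>
      (\<Sum>g\<in>N. (inner b (quad T g) - \<mu>) * (cmod (cinner y g))\<^sup>2) + \<mu> * (norm y)\<^sup>2"
    if y: "y \<in> complex_vector.span E" for y
  proof -
    obtain H' u' where H': "finite H'" "H' \<subseteq> E" "y = (\<Sum>h\<in>H'. u' h *\<^sub>C h)"
      using y unfolding complex_vector.span_explicit by auto
    \<comment> \<open>The support is padded by \<open>N\<close> with zero coefficients, so that the
      sum over \<open>N\<close> can be split off.\<close>
    define H u where "H = H' \<union> N" and "u h = (if h \<in> H' then u' h else 0)" for h
    have H: "finite H" "H \<subseteq> E" "N \<subseteq> H" "orthonormal_set H"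
      using H' N oE orthonormal_set_subset[of E H] by (auto simp: H_def)
    have yH: "y = (\<Sum>h\<in>H. u h *\<^sub>C h)"
      unfolding H'(3) using H(1) by (intro sum.mono_neutral_cong_left) (auto simp: H_def u_def)
    have uy: "cinner y h = u h" if "h \<in> H" for h
      unfolding yH by (rule cinner_orthonormal_sum[OF H(4,1) that])
    have ny: "(norm y)\<^sup>2 = (\<Sum>h\<in>H. (cmod (cinner y h))\<^sup>2)"
      using fproj_pythagoras(2)[OF H(4,1), of y] uy by (simp add: fproj_def yH[symmetric])
    have ev: "T j h = cinner (T j h) h *\<^sub>C h" if h: "h \<in> H" for j h
    proof -
      obtain c where "T j h = c *\<^sub>C h" using E(2) H(2) h unfolding diagonal_wrt_def by blast
      moreover have "cinner h h = 1" using H(4) h by (simp add: orthonormal_set_def)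
      ultimately show ?thesis by (simp add: cinner_scaleC_left)
    qed
    have "quad T y = (\<Sum>h\<in>H. (cmod (cinner y h))\<^sup>2 *\<^sub>R quad T h)"
    proof (rule vec_eq_iff[THEN iffD2], rule allI)
      fix j
      have "T j y = (\<Sum>h\<in>H. u h *\<^sub>C T j h)"
        using bounded_op_on_sum[OF sV T, of H "\<lambda>h. h" j u] H EV by (auto simp: yH)
      also have "\<dots> = (\<Sum>h\<in>H. (u h * cinner (T j h) h) *\<^sub>C h)"
        using ev by (intro sum.cong) (auto simp flip: scaleC_scaleC)
      finally have "cinner (T j y) y = (\<Sum>h\<in>H. u h * cinner (T j h) h * cinner h y)"
        by (simp add: cinner_sum_left cinner_scaleC_left)
      also have "\<dots> = (\<Sum>h\<in>H. of_real ((cmod (cinner y h))\<^sup>2) * cinner (T j h) h)"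
      proof (intro sum.cong refl)
        fix h assume h: "h \<in> H"
        have "cinner h y = cnj (u h)" using uy[OF h] cinner_commute[of h y] by simp
        then show "u h * cinner (T j h) h * cinner h y = of_real ((cmod (cinner y h))\<^sup>2) * cinner (T j h) h"
          by (simp add: uy[OF h] complex_norm_square del: of_real_power)
      qed
      finally show "quad T y $ j = (\<Sum>h\<in>H. (cmod (cinner y h))\<^sup>2 *\<^sub>R quad T h) $ j"
        by (simp add: quad_def scaleR_conv_of_real[where 'a = complex])
    qed
    then have "inner b (quad T y) - \<mu> * (norm y)\<^sup>2 = (\<Sum>h\<in>H. (inner b (quad T h) - \<mu>) * (cmod (cinner y h))\<^sup>2)"
      by (simp add: inner_sum_right ny sum_distrib_left algebra_simps sum_subtractf)
    also have "\<dots> = (\<Sum>g\<in>N. (inner b (quad T g) - \<mu>) * (cmod (cinner y g))\<^sup>2) +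
        (\<Sum>h\<in>H - N. (inner b (quad T h) - \<mu>) * (cmod (cinner y h))\<^sup>2)"
      by (subst sum.subset_diff[OF H(3,1)]) (simp add: add.commute)
    also have "(\<Sum>h\<in>H - N. (inner b (quad T h) - \<mu>) * (cmod (cinner y h))\<^sup>2) \<le> 0"
      using \<mu> H(2) by (intro sum_nonpos mult_nonpos_nonneg) auto
    finally show ?thesis by simp
  qed
  obtain f where f: "\<And>n. f n \<in> complex_vector.span E" "f \<longlonglongrightarrow> x"
    using x unfolding cE[symmetric] closure_sequential by blast
  have fV: "f n \<in> V" for n using f(1) cE closure_subset by blast
  have Tlim: "(\<lambda>n. T j (f n)) \<longlonglongrightarrow> T j x" for j
  proof -
    obtain M where M: "\<And>y. y \<in> V \<Longrightarrow> norm (T j y) \<le> M * norm y"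
      using T[of j] unfolding bounded_op_on_def by blast
    have "T j (f n) - T j x = T j (f n - x)" for n
    proof -
      have "T j ((f n - x) + x) = T j (f n - x) + T j x"
        using T[of j] fV[of n] x csubspaceD(3)[OF sV] unfolding bounded_op_on_def by blast
      then show ?thesis by simp
    qed
    then have "norm (T j (f n) - T j x) \<le> M * norm (f n - x)" for n
      using M[of "f n - x"] csubspaceD(3)[OF sV fV x] by simp
    moreover have "(\<lambda>n. M * norm (f n - x)) \<longlonglongrightarrow> M * norm (x - x)"
      by (intro tendsto_intros f)
    ultimately have "(\<lambda>n. T j (f n) - T j x) \<longlonglongrightarrow> 0"
      using Lim_null_comparison[OF always_eventually, of "\<lambda>n. T j (f n) - T j x" "\<lambda>n. M * norm (f n - x)" sequentially]
      by simp
    then show ?thesis by (simp add: LIM_zero_iff)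
  qed
  have "(\<lambda>n. quad T (f n)) \<longlonglongrightarrow> quad T x"
    unfolding quad_def by (intro tendsto_vec_lambda tendsto_cinner Tlim f)
  then have "(\<lambda>n. inner b (quad T (f n))) \<longlonglongrightarrow> inner b (quad T x)"
    by (intro tendsto_intros)
  moreover have "(\<lambda>n. (\<Sum>g\<in>N. (inner b (quad T g) - \<mu>) * (cmod (cinner (f n) g))\<^sup>2) + \<mu> * (norm (f n))\<^sup>2)
     \<longlonglongrightarrow> (\<Sum>g\<in>N. (inner b (quad T g) - \<mu>) * (cmod (cinner x g))\<^sup>2) + \<mu> * (norm x)\<^sup>2"
    by (intro tendsto_intros tendsto_cinner f)
  ultimately show ?thesis by (rule LIMSEQ_le) (use span f(1) in blast)
qed

section \<open>Polytopes whose vertices are subset sums\<close>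

lemma polytope_hull_extreme:
  fixes P :: "'v::euclidean_space set"
  assumes "polytope P"
  shows "P = convex hull {w. w extreme_point_of P}" "finite {w. w extreme_point_of P}"
  by (rule Krein_Milman_Minkowski[OF polytope_imp_compact[OF assms] polytope_imp_convex[OF assms]])
    (rule finite_polyhedron_extreme_points[OF polytope_imp_polyhedron[OF assms]])

text \<open>There are finitely many vertices, each using finitely many entries, so one finite
  \<open>G\<close> accommodates all of them and \<open>subset_sums_hull_weights\<close>
  applies.\<close>

lemma polytope_subset_sum_weights:
  fixes P :: "'v::euclidean_space set"
  assumes P: "polytope P" and z: "z \<in> P"
    and ext: "\<And>w. w extreme_point_of P \<Longrightarrow> \<exists>N\<subseteq>E. finite N \<and> card N = k \<and> w = sum d N"
  obtains G t where "finite G" "G \<subseteq> E" "\<And>g. g \<in> G \<Longrightarrow> 0 \<le> t g \<and> t g \<le> 1" "sum t G = real k"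
    "z = (\<Sum>g\<in>G. t g *\<^sub>R d g)"
proof -
  let ?X = "{w. w extreme_point_of P}"
  note hull = polytope_hull_extreme[OF P]
  obtain N where N: "\<And>w. w \<in> ?X \<Longrightarrow> N w \<subseteq> E \<and> finite (N w) \<and> card (N w) = k \<and> w = sum d (N w)"
    using ext by (metis mem_Collect_eq)
  define G where "G = (\<Union>w\<in>?X. N w)"
  have G: "finite G" "G \<subseteq> E" using N hull(2) by (auto simp: G_def)
  have "?X \<subseteq> {sum d H | H. H \<subseteq> G \<and> card H = k}" using N by (fastforce simp: G_def)
  then have "z \<in> convex hull {sum d H | H. H \<subseteq> G \<and> card H = k}"
    using z hull(1) hull_mono by blast
  then obtain t where "\<forall>g\<in>G. 0 \<le> t g \<and> t g \<le> 1" "sum t G = real k" "z = (\<Sum>g\<in>G. t g *\<^sub>R d g)"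
    using subset_sums_hull_weights[OF G(1)] by blast
  then show ?thesis using G that by blast
qed

text \<open>A subset of \<open>E\<close> whose sum maximises a functional over \<open>P\<close> consists of largest entries,
  since exchanging one of its elements stays in \<open>P\<close>.\<close>

lemma diagonal_joint_num_range:
  fixes T :: "'m::finite \<Rightarrow> 'a \<Rightarrow> 'a::complex_inner"
  assumes V: "closed_csubspace V" and T: "\<And>j. bounded_op_on V (T j)"
    and E: "is_onb V E" "diagonal_wrt E T" and P: "polytope P" "P \<noteq> {}" and k: "0 < k"
    and sub: "\<And>N. N \<subseteq> E \<Longrightarrow> finite N \<Longrightarrow> card N = k \<Longrightarrow> sum (quad T) N \<in> P"
    and ext: "\<And>w. w extreme_point_of P \<Longrightarrow> \<exists>N\<subseteq>E. finite N \<and> card N = k \<and> w = sum (quad T) N"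
  shows "joint_num_range V k T = P"
proof
  have sV: "complex_vector.subspace V" using V by (simp add: closed_csubspace_def)
  have EV: "E \<subseteq> V" and oE: "orthonormal_set E" using E by (auto simp: is_onb_def)
  let ?X = "{w. w extreme_point_of P}"
  note hull = polytope_hull_extreme[OF P(1)]
  obtain N where N: "\<And>w. w \<in> ?X \<Longrightarrow> N w \<subseteq> E \<and> finite (N w) \<and> card (N w) = k \<and> w = sum (quad T) (N w)"
    using ext by (metis mem_Collect_eq)
  show "P \<subseteq> joint_num_range V k T"
  proof
    fix z assume z: "z \<in> P"
    then obtain G t where G: "finite G" "G \<subseteq> E" and
      t: "\<And>g. g \<in> G \<Longrightarrow> 0 \<le> t g \<and> t g \<le> 1" "sum t G = real k" "z = (\<Sum>g\<in>G. t g *\<^sub>R quad T g)"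
      using polytope_subset_sum_weights[OF P(1) _ ext] by metis
    show "z \<in> joint_num_range V k T" unfolding t(3)
    proof (rule weighted_quad_in_range[OF sV T G(1)])
      show "g \<in> V" if "g \<in> G" for g using that G EV by auto
      show o: "cinner g h = (if g = h then 1 else 0)" if "g \<in> G" "h \<in> G" for g h
        using oE that G(2) unfolding orthonormal_set_def by blast
      show "cinner (T j g) h = 0" if g: "g \<in> G" "h \<in> G" "g \<noteq> h" for j g h
      proof -
        obtain c where "T j g = c *\<^sub>C g" using E(2) G(2) g unfolding diagonal_wrt_def by blast
        then show ?thesis using o[of g h] g by (simp add: cinner_scaleC_left)
      qed
    qed (use t in auto)
  qed
  show "joint_num_range V k T \<subseteq> P"
  proof (rule ccontr)
    assume "\<not> ?thesis"
    then obtain z where z: "z \<in> joint_num_range V k T" "z \<notin> P" by blast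
    obtain X where X: "X \<subseteq> V" "finite X" "card X = k" "orthonormal_set X" "z = sum (quad T) X"
      using z(1) unfolding joint_num_range_eq by blast
    obtain a c where ac: "inner a z < c" "\<forall>x\<in>P. c < inner a x"
      using separating_hyperplane_closed_point[OF polytope_imp_convex[OF P(1)] polytope_imp_closed[OF P(1)] z(2)]
      by blast
    \<comment> \<open>Separation puts \<open>z\<close> strictly below \<open>P\<close> in direction
      \<open>a\<close>. In direction \<open>b\<close> it lies strictly above the maximum over
      \<open>P\<close>, which the Ky Fan bound refutes.\<close>
    define b where "b = - a"
    have X0: "?X \<noteq> {}" using hull P(2) by auto
    obtain w where w: "w \<in> ?X" "\<And>v. v \<in> ?X \<Longrightarrow> inner b v \<le> inner b w"
      using ex_is_arg_min_if_finite[OF hull(2) X0, of "\<lambda>v. - inner b v"]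
      unfolding is_arg_min_def by (auto simp: not_less)
    have "P \<subseteq> {p. inner b p \<le> inner b w}"
      by (subst hull(1), rule hull_minimal) (use w in \<open>auto simp: convex_halfspace_le\<close>)
    then have maxw: "inner b p \<le> inner b w" if "p \<in> P" for p using that by auto
    have wP: "w \<in> P" using w(1) by (simp add: extreme_point_of_def)
    note Nw = N[OF w(1)]
    have Nne: "N w \<noteq> {}" using Nw k by auto
    obtain g0 where g0: "g0 \<in> N w" "\<And>g. g \<in> N w \<Longrightarrow> inner b (quad T g0) \<le> inner b (quad T g)"
      using ex_is_arg_min_if_finite[of "N w" "\<lambda>g. inner b (quad T g)"] Nw Nne
      unfolding is_arg_min_def by (auto simp: not_less)
    define \<mu> where "\<mu> = inner b (quad T g0)"
    have \<mu>: "inner b (quad T e) \<le> \<mu>" if e: "e \<in> E - N w" for e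
    proof -
      have "sum (quad T) (insert e (N w - {g0})) = quad T e + sum (quad T) (N w - {g0})"
        using e Nw by (subst sum.insert) auto
      also have "sum (quad T) (N w - {g0}) = w - quad T g0"
        using Nw g0(1) by (simp add: sum_diff1)
      finally have s: "sum (quad T) (insert e (N w - {g0})) = quad T e + (w - quad T g0)" .
      have "card (insert e (N w - {g0})) = k" using e Nw g0(1) k by (subst card_insert_disjoint) auto
      then have "sum (quad T) (insert e (N w - {g0})) \<in> P" using e Nw by (intro sub) auto
      from maxw[OF this] show ?thesis unfolding s by (simp add: \<mu>_def inner_add_right inner_diff_right)
    qed
    \<comment> \<open>\<mu> is the least value on \<open>N w\<close> and bounds all values outside,
      so the \<open>k\<close> copies of \<mu> cancel and the bound is exactly
      \<open>inner b w\<close>.\<close>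
    have "(\<Sum>x\<in>X. inner b (quad T x)) \<le> (\<Sum>g\<in>N w. inner b (quad T g) - \<mu>) + real (card X) * \<mu>"
    proof (rule Ky_Fan_bound[OF X(2,4)])
      show "norm g = 1 \<and> 0 \<le> inner b (quad T g) - \<mu>" if "g \<in> N w" for g
        using g0(2)[OF that] orthonormal_set_norm[OF oE, of g] Nw that by (auto simp: \<mu>_def)
      show "inner b (quad T x) \<le>
          (\<Sum>g\<in>N w. (inner b (quad T g) - \<mu>) * (cmod (cinner x g))\<^sup>2) + \<mu> * (norm x)\<^sup>2" if "x \<in> X" for x
        using onb_quad_bound[OF V T E, of "N w" b \<mu> x] Nw \<mu> that X(1) by blast
    qed
    also have "\<dots> = inner b (sum (quad T) (N w))"
      using Nw[THEN conjunct2, THEN conjunct2, THEN conjunct1] X(3) by (simp add: sum_subtractf inner_sum_right)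
    also have "sum (quad T) (N w) = w" by (rule sym) (use Nw in blast)
    finally have "inner b z \<le> inner b w" using X(5) by (simp add: inner_sum_right)
    then show False using ac wP by (auto simp: b_def)
  qed
qed

section \<open>Essential points\<close>

text \<open>The description of essential values by weakly null sequences, with finite orthogonality
  conditions in place of sequences: its negation then directly yields a gap on a complement of
  finite codimension.\<close>

definition ess_points :: "('m::finite \<Rightarrow> 'a \<Rightarrow> 'a::complex_inner) \<Rightarrow> (complex ^ 'm) set" where
  "ess_points A = {z. \<forall>Y e. finite Y \<and> 0 < e \<longrightarrow>
     (\<exists>x. norm x = 1 \<and> (\<forall>y\<in>Y. cinner x y = 0) \<and> norm (quad A x - z) < e)}"

lemma ess_pointsE:
  assumes "z \<in> ess_points A" "finite Y" "0 < e"
  obtains x where "norm x = 1" "\<And>y. y \<in> Y \<Longrightarrow> cinner x y = 0" "norm (quad A x - z) < e"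
proof -
  have "\<exists>x. norm x = 1 \<and> (\<forall>y\<in>Y. cinner x y = 0) \<and> norm (quad A x - z) < e"
    using assms by (simp add: ess_points_def)
  then show ?thesis using that by blast
qed

text \<open>The second clause says that the adjoint of \<open>A j\<close> maps \<open>e\<close> to
  \<open>cnj (v $ j)\<close> times \<open>e\<close>, without naming an adjoint. It makes the line
  through \<open>e\<close> reducing, and eigenvectors for different eigenvalues orthogonal.\<close>

definition joint_eigenvector :: "('m::finite \<Rightarrow> 'a \<Rightarrow> 'a::complex_inner) \<Rightarrow> complex ^ 'm \<Rightarrow> 'a \<Rightarrow> bool" where
  "joint_eigenvector A v e \<longleftrightarrow>
     (\<forall>j. A j e = (v $ j) *\<^sub>C e \<and> (\<forall>y. cinner (A j y) e = (v $ j) * cinner y e))"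

lemma quad_joint_eigenvector: "joint_eigenvector A v e \<Longrightarrow> quad A e = (norm e)\<^sup>2 *\<^sub>R v"
proof -
  assume "joint_eigenvector A v e"
  then have "cinner (A j e) e = v $ j * of_real ((norm e)\<^sup>2)" for j
    unfolding joint_eigenvector_def by (metis cinner_self)
  then show ?thesis
    by (simp add: quad_def vec_eq_iff scaleR_conv_of_real[where 'a = complex] mult.commute)
qed

lemma norm_vec_le_sum: "norm (v::complex ^ 'm::finite) \<le> (\<Sum>j\<in>UNIV. cmod (v $ j))"
  using L2_set_le_sum[of UNIV "\<lambda>j. norm (v $ j)"] by (simp add: norm_vec_def)

lemma joint_num_range_1: "joint_num_range UNIV 1 T = {quad T x | x. norm x = 1}"
proof (intro set_eqI iffI)
  fix z assume "z \<in> joint_num_range UNIV 1 T"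
  then obtain G where "z = sum (quad T) G" "card G = 1" "orthonormal_set G"
    unfolding joint_num_range_eq by blast
  moreover from this obtain x where "G = {x}" using card_1_singletonE by blast
  ultimately show "z \<in> {quad T x | x. norm x = 1}" using orthonormal_set_norm[of G x] by auto
next
  fix z assume "z \<in> {quad T x | x. norm x = 1}"
  then obtain x where x: "norm x = 1" "z = quad T x" by blast
  then show "z \<in> joint_num_range UNIV 1 T"
    using joint_num_rangeI[of "{x}" UNIV 1 T] by (simp add: orthonormal_set_def norm_eq_1_iff_cinner)
qed

text \<open>A compact \<open>K j\<close> maps the unit ball into a small neighbourhood of a finite
  set. For a unit vector orthogonal to that set \<open>cinner (K j x) x\<close> is small, so the
  perturbation does not move an essential value.\<close>

lemma ess_points_subset: "ess_points A \<subseteq> joint_ess_num_range (A :: 'm::finite \<Rightarrow> 'a \<Rightarrow> 'a::complex_inner)"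
  unfolding joint_ess_num_range_def
proof (intro subsetI InterI, clarify)
  fix z and K :: "'m \<Rightarrow> 'a \<Rightarrow> 'a"
  assume z: "z \<in> ess_points A" and K: "\<forall>j. compact_op (K j)"
  show "z \<in> closure (joint_num_range UNIV 1 (\<lambda>j x. A j x + K j x))"
    unfolding closure_approachable
  proof (intro allI impI)
    fix e :: real assume e: "0 < e"
    \<comment> \<open>One \<delta> is spent on approximating \<open>z\<close> and one on each
      component of \<open>K\<close>, in total \<open>e / 2\<close>.\<close>
    define \<delta> where "\<delta> = e / (2 * (real CARD('m) + 1))"
    have \<delta>: "0 < \<delta>" using e by (simp add: \<delta>_def)
    have "\<exists>Y. finite Y \<and> (\<forall>x\<in>cball 0 1. \<exists>y\<in>Y. norm (K j x - y) < \<delta>)" for j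
    proof -
      have "compact (closure (K j ` cball 0 1))" using K by (simp add: compact_op_def)
      then obtain Y where "finite Y" "closure (K j ` cball 0 1) \<subseteq> (\<Union>y\<in>Y. ball y \<delta>)"
        using \<delta> unfolding compact_eq_totally_bounded by blast
      then show ?thesis using closure_subset[of "K j ` cball 0 1"]
        by (intro exI[of _ Y]) (fastforce simp: dist_norm norm_minus_commute)
    qed
    then obtain Y where Y: "\<And>j. finite (Y j)" "\<And>j x. x \<in> cball 0 1 \<Longrightarrow> \<exists>y\<in>Y j. norm (K j x - y) < \<delta>"
      by metis
    have "finite (\<Union>j. Y j)" using Y(1) by simp
    with z obtain x where x': "norm x = 1" "\<And>y. y \<in> (\<Union>j. Y j) \<Longrightarrow> cinner x y = 0" "norm (quad A x - z) < \<delta>"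
      using \<delta> by (rule ess_pointsE) blast
    have x: "norm x = 1" "\<And>y j. y \<in> Y j \<Longrightarrow> cinner x y = 0" "norm (quad A x - z) < \<delta>"
      using x' by auto
    have Kx: "cmod (cinner (K j x) x) \<le> \<delta>" for j
    proof -
      obtain y where y: "y \<in> Y j" "norm (K j x - y) < \<delta>" using Y(2)[of x j] x(1) by auto
      have "cinner (K j x) x = cinner (K j x - y) x"
        using x(2)[OF y(1)] by (simp add: cinner_diff_left cinner_eq_0_commute[of x y])
      also have "cmod \<dots> \<le> norm (K j x - y) * norm x" by (rule cmod_cinner_le)
      finally show ?thesis using y(2) x(1) by simp
    qed
    have "quad (\<lambda>j x. A j x + K j x) x = quad A x + quad K x"
      by (simp add: quad_def vec_eq_iff cinner_add_left)
    then have "norm (quad (\<lambda>j x. A j x + K j x) x - z) \<le> norm (quad A x - z) + norm (quad K x)"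
      by (metis add_diff_eq add.commute norm_triangle_ineq)
    also have "norm (quad K x) \<le> (\<Sum>j\<in>(UNIV::'m set). \<delta>)"
      using norm_vec_le_sum[of "quad K x"] Kx by (intro order_trans[OF norm_vec_le_sum] sum_mono) (simp add: quad_def)
    also have "norm (quad A x - z) + (\<Sum>j\<in>(UNIV::'m set). \<delta>) < e"
    proof -
      have "(real CARD('m) + 1) * \<delta> = e / 2" by (simp add: \<delta>_def field_simps)
      then show ?thesis using x(3) e by (simp add: algebra_simps)
    qed
    finally have "dist (quad (\<lambda>j x. A j x + K j x) x) z < e" by (simp add: dist_norm)
    then show "\<exists>y\<in>joint_num_range UNIV 1 (\<lambda>j x. A j x + K j x). dist y z < e"
      unfolding joint_num_range_1 using x(1) by blast
  qed
qed

text \<open>Induction on sums of compact discs. It serves both for the compactness of finite-rank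
  perturbations and for extracting convergent subsequences of projected vectors.\<close>

lemma compact_coefficient_set:
  "finite (G::'a::complex_inner set) \<Longrightarrow> compact {(\<Sum>g\<in>G. c g *\<^sub>C g) | c. \<forall>g\<in>G. cmod (c g) \<le> R}"
proof (induction G rule: finite_induct)
  case (insert h G)
  have "compact ((\<lambda>c. c *\<^sub>C h) ` cball 0 R)"
    by (intro compact_continuous_image continuous_on_scaleC continuous_on_id continuous_on_const compact_cball)
  note compact_sums[OF this insert.IH]
  also have "{x + y |x y. x \<in> (\<lambda>c. c *\<^sub>C h) ` cball 0 R \<and> y \<in> {(\<Sum>g\<in>G. c g *\<^sub>C g) | c. \<forall>g\<in>G. cmod (c g) \<le> R}} =
      {(\<Sum>g\<in>insert h G. c g *\<^sub>C g) | c. \<forall>g\<in>insert h G. cmod (c g) \<le> R}" (is "?L = ?R")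
  proof
    show "?L \<subseteq> ?R"
    proof clarify
      fix u :: complex and c assume uc: "u \<in> cball 0 R" "\<forall>g\<in>G. cmod (c g) \<le> R"
      have "(\<Sum>g\<in>G. (c(h := u)) g *\<^sub>C g) = (\<Sum>g\<in>G. c g *\<^sub>C g)"
        using insert.hyps by (intro sum.cong) auto
      then show "\<exists>c'. u *\<^sub>C h + (\<Sum>g\<in>G. c g *\<^sub>C g) = (\<Sum>g\<in>insert h G. c' g *\<^sub>C g) \<and> (\<forall>g\<in>insert h G. cmod (c' g) \<le> R)"
        using uc insert.hyps by (intro exI[of _ "c(h := u)"]) auto
    qed
    show "?R \<subseteq> ?L" using insert.hyps by (fastforce simp: image_iff)
  qed
  finally show ?case .
qed simp

lemma compact_opI:
  assumes "bounded_op_on UNIV T" "compact C" "T ` cball 0 1 \<subseteq> C"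
  shows "compact_op T"
proof -
  have "closure (T ` cball 0 1) \<subseteq> C" using assms by (intro closure_minimal compact_imp_closed)
  then have "C \<inter> closure (T ` cball 0 1) = closure (T ` cball 0 1)" by auto
  then show ?thesis using compact_Int_closed[OF assms(2), of "closure (T ` cball 0 1)"] assms(1)
    by (simp add: compact_op_def)
qed

lemma bounded_op_fproj:
  assumes "finite G" "orthonormal_set G"
  shows "bounded_op_on UNIV (fproj G)"
  unfolding bounded_op_on_def
proof (intro conjI allI ballI exI[of _ 1])
  show "norm (fproj G x) \<le> 1 * norm x" for x
    using fproj_pythagoras[OF assms(2,1), of x] power2_le_imp_le[of "norm (fproj G x)" "norm x"] by simp
qed (auto simp: fproj_def cinner_add_left cinner_scaleC_left scaleC_add_left sum.distrib
    complex_vector.scale_sum_right scaleC_scaleC)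

lemma bounded_op_fun:
  assumes "bounded_op_on UNIV (S::'a::complex_inner \<Rightarrow> 'a)" "bounded_op_on UNIV T"
  shows "bounded_op_on UNIV (\<lambda>x. S x + T x)" "bounded_op_on UNIV (\<lambda>x. S x - T x)"
    "bounded_op_on UNIV (\<lambda>x. S (T x))" "bounded_op_on UNIV (\<lambda>x. c *\<^sub>C T x)" "bounded_op_on UNIV (\<lambda>x::'a. x)"
proof -
  have b: "bounded_linear S" "bounded_linear T" using assms by (simp_all add: bounded_opD(5))
  note lin = bounded_opD(2)[OF assms(1)] bounded_opD(2)[OF assms(2)]
  show "bounded_op_on UNIV (\<lambda>x. S x + T x)" unfolding bounded_op_on_UNIV
    using bounded_linear_add[OF b] by (simp add: lin scaleC_add_right)
  show "bounded_op_on UNIV (\<lambda>x. S x - T x)" unfolding bounded_op_on_UNIV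
    using bounded_linear_sub[OF b] by (simp add: lin complex_vector.scale_right_diff_distrib)
  show "bounded_op_on UNIV (\<lambda>x. S (T x))" unfolding bounded_op_on_UNIV
    using bounded_linear_compose[OF b] by (simp add: lin)
  show "bounded_op_on UNIV (\<lambda>x. c *\<^sub>C T x)" unfolding bounded_op_on_UNIV
    using bounded_linear_compose[OF bounded_bilinear.bounded_linear_right[OF bounded_bilinear_scaleC] b(2)]
    by (simp add: lin scaleC_scaleC mult.commute)
  show "bounded_op_on UNIV (\<lambda>x::'a. x)" unfolding bounded_op_on_UNIV
    by (simp add: bounded_linear_ident)
qed

section \<open>Finite-rank perturbations and approximating families\<close>

locale op_tuple =
  fixes A :: "'m::finite \<Rightarrow> 'a::chilbert_space \<Rightarrow> 'a"
  assumes bounded: "bounded_op_on UNIV (A j)"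
begin

text \<open>The tuple is compressed to the complement of \<open>G\<close> and set to the constant \<open>d\<close> on \<open>G\<close>;
  this is a finite-rank perturbation.\<close>

lemma joint_ess_num_range_le:
  assumes G: "finite G" "orthonormal_set G" and s: "s \<in> joint_ess_num_range A"
    and le: "\<And>x. (\<forall>g\<in>G. cinner x g = 0) \<Longrightarrow> inner b (quad A x) \<le> inner b d * (norm x)\<^sup>2"
  shows "inner b s \<le> inner b d"
proof -
  define Q P where "Q = fproj G" and "P x = x - Q x" for x
  define K where "K j x = (P (A j (P x)) + (d $ j) *\<^sub>C Q x) - A j x" for j x
  have Q: "bounded_op_on UNIV Q" unfolding Q_def by (rule bounded_op_fproj[OF G])
  have P: "bounded_op_on UNIV P" unfolding P_def by (intro bounded_op_fun(2) bounded_op_fun(5)[OF Q Q] Q)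
  have bK: "bounded_op_on UNIV (K j)" for j
    unfolding K_def using bounded_op_fun(3)[OF P bounded_op_fun(3)[OF bounded P]]
    by (intro bounded_op_fun(1,2) bounded_op_fun(4)[OF Q Q] bounded)
  note lin = bounded_opD[OF bounded] bounded_opD(1-4)[OF Q]
  have "compact_op (K j)" for j
  proof -
    let ?C = "\<lambda>R. {(\<Sum>g\<in>G. c g *\<^sub>C g) | c. \<forall>g\<in>G. cmod (c g) \<le> R}"
    have QC: "Q x \<in> ?C (norm x)" for x
    proof -
      have "cmod (cinner x g) \<le> norm x" if "g \<in> G" for g
        using cmod_cinner_le[of x g] orthonormal_set_norm[OF G(2) that] by simp
      then show ?thesis unfolding Q_def fproj_def by blast
    qed
    obtain M where M: "0 \<le> M" "\<And>x. norm (A j (P x)) \<le> norm x * M"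
      using bounded_linear.nonneg_bounded[OF bounded_opD(5)[OF bounded_op_fun(3)[OF bounded P]]] by blast
    have C1: "compact ((\<lambda>v. (d $ j) *\<^sub>C v - A j v) ` ?C 1)"
      by (intro compact_continuous_image compact_coefficient_set G(1) continuous_on_diff continuous_on_scaleC
          continuous_on_const continuous_on_id linear_continuous_on lin)
    have C2: "compact (uminus ` ?C M)"
      by (intro compact_continuous_image compact_coefficient_set G(1) continuous_intros)
    have "K j ` cball 0 1 \<subseteq> {x + y |x y. x \<in> uminus ` ?C M \<and> y \<in> (\<lambda>v. (d $ j) *\<^sub>C v - A j v) ` ?C 1}"
    proof
      fix y assume "y \<in> K j ` cball 0 1"
      then obtain x where x: "norm x \<le> 1" "y = K j x" by auto
      \<comment> \<open>With \<open>A j x\<close> split into \<open>A j (P x) + A j (Q x)\<close>,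
        only \<open>Q\<close> of the first term survives, and both remaining terms are continuous
        images of bounded sets in the span of \<open>G\<close>.\<close>
      have y: "y = - Q (A j (P x)) + ((d $ j) *\<^sub>C Q x - A j (Q x))"
        unfolding x K_def by (simp add: P_def lin algebra_simps)
      have mono: "?C R \<subseteq> ?C R'" if "R \<le> R'" for R R' using that by fastforce
      have "norm (A j (P x)) \<le> M"
        using M(2)[of x] mult_right_mono[OF x(1) M(1)] by simp
      then have "Q (A j (P x)) \<in> ?C M" using QC mono by blast
      moreover have "Q x \<in> ?C 1" using QC mono x(1) by blast
      ultimately show "y \<in> {x + y |x y. x \<in> uminus ` ?C M \<and> y \<in> (\<lambda>v. (d $ j) *\<^sub>C v - A j v) ` ?C 1}"
        unfolding y by blast
    qed
    then show ?thesis by (rule compact_opI[OF bK compact_sums[OF C2 C1]])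
  qed
  then have "s \<in> closure (joint_num_range UNIV 1 (\<lambda>j x. A j x + K j x))"
    using s unfolding joint_ess_num_range_def by blast
  moreover have "closure (joint_num_range UNIV 1 (\<lambda>j x. A j x + K j x)) \<subseteq> {z. inner b z \<le> inner b d}"
  proof (rule closure_minimal)
    show "joint_num_range UNIV 1 (\<lambda>j x. A j x + K j x) \<subseteq> {z. inner b z \<le> inner b d}"
      unfolding joint_num_range_1
    proof clarify
      fix x :: 'a assume x: "norm x = 1"
      have sa: "cinner (Q u) y = cinner u (Q y)" for u y
        unfolding Q_def fproj_def by (simp add: cinner_sum_left cinner_sum_right cinner_scaleC_left
            cinner_scaleC_right mult.commute flip: cinner_commute)
      have QQ: "Q (Q u) = Q u" for u
        unfolding Q_def using fproj_eq_iff[OF G(2,1)] fproj_in_span by blast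
      have Qx: "cinner (Q x) x = of_real ((norm (Q x))\<^sup>2)"
        using sa[of "Q x" x] QQ[of x] by (simp add: cinner_self)
      \<comment> \<open>The component along \<open>G\<close> contributes \<open>d\<close> with
        weight \<open>(norm (Q x))\<^sup>2\<close>, and \<open>le\<close> bounds the rest with the
        complementary weight.\<close>
      have "quad (\<lambda>j x. A j x + K j x) x = quad A (P x) + (norm (Q x))\<^sup>2 *\<^sub>R d"
        by (simp add: vec_eq_iff quad_def K_def cinner_add_left cinner_scaleC_left Qx
            scaleR_conv_of_real[where 'a = complex] mult.commute)
          (simp add: P_def cinner_diff_left cinner_diff_right sa)
      moreover have "inner b (quad A (P x)) \<le> inner b d * (norm (P x))\<^sup>2"
        by (rule le) (simp add: P_def Q_def fproj_residual[OF G(2,1)])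
      moreover have "inner b d * (norm (P x))\<^sup>2 + (norm (Q x))\<^sup>2 * inner b d = inner b d"
      proof -
        have "(norm (P x))\<^sup>2 + (norm (Q x))\<^sup>2 = 1"
          using fproj_pythagoras[OF G(2,1), of x] x by (simp add: P_def Q_def)
        then show ?thesis by (metis distrib_left mult.commute mult.right_neutral)
      qed
      ultimately show "inner b (quad (\<lambda>j x. A j x + K j x) x) \<le> inner b d"
        by (simp add: inner_add_right)
    qed
  qed (rule closed_halfspace_le)
  ultimately show ?thesis by blast
qed

lemma adjoint_tuple_exists: "\<exists>B. \<forall>j x y. cinner (A j x) y = cinner x (B j y)"
proof -
  have "\<forall>j y. \<exists>z. \<forall>x. cinner (A j x) y = cinner x z" using adjoint_exists[OF bounded] by blast
  then show ?thesis by metis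
qed

text \<open>Induction on \<open>H\<close>: the vector for the next essential point is chosen
  orthogonal to the earlier vectors and to their images under all \<open>A j\<close> and all
  adjoints, which kills the mixed terms in both orders.\<close>

lemma approximating_family:
  assumes H: "finite H" and G: "finite G" "G \<inter> H = {}"
    and b0: "\<forall>g\<in>G. \<forall>h\<in>G. cinner (b0 g) (b0 h) = (if g = h then 1 else 0)"
    and ev: "\<forall>g\<in>G. joint_eigenvector A (d g) (b0 g)"
    and ess: "\<forall>h\<in>H. d h \<in> ess_points A" and e: "0 < e"
  shows "\<exists>b. (\<forall>g\<in>G \<union> H. \<forall>h\<in>G \<union> H. cinner (b g) (b h) = (if g = h then 1 else 0) \<and>
      (g \<noteq> h \<longrightarrow> (\<forall>j. cinner (A j (b g)) (b h) = 0))) \<and>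
      (\<forall>g\<in>G \<union> H. norm (quad A (b g) - d g) < e)"
  using H G(2) ess
proof (induction H rule: finite_induct)
  case empty
  have "norm (quad A (b0 g) - d g) < e" if "g \<in> G" for g
    using quad_joint_eigenvector[OF ev[rule_format, OF that]] b0[rule_format, OF that that] e norm_eq_1_iff_cinner[of "b0 g"] by simp
  moreover have "cinner (A j (b0 g)) (b0 h) = 0" if "g \<in> G" "h \<in> G" "g \<noteq> h" for g h j
    using ev[rule_format, OF that(1)] b0[rule_format, OF that(1,2)] that by (simp add: joint_eigenvector_def cinner_scaleC_left)
  ultimately show ?case using b0 by (intro exI[of _ b0]) auto
next
  case (insert h0 H)
  have "G \<inter> H = {}" "\<forall>h\<in>H. d h \<in> ess_points A" using insert.prems by auto
  from insert.IH[OF this] obtain b where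
    bo: "\<forall>g\<in>G \<union> H. \<forall>h\<in>G \<union> H. cinner (b g) (b h) = (if g = h then 1 else 0) \<and>
      (g \<noteq> h \<longrightarrow> (\<forall>j. cinner (A j (b g)) (b h) = 0))" and
    bq: "\<forall>g\<in>G \<union> H. norm (quad A (b g) - d g) < e"
    by (elim exE conjE)
  have b: "cinner (b g) (b h) = (if g = h then 1 else 0)" "g \<noteq> h \<Longrightarrow> cinner (A j (b g)) (b h) = 0"
    if "g \<in> G \<union> H" "h \<in> G \<union> H" for g h j
    using bo[rule_format, OF that] by simp_all
  obtain B where B: "\<And>j x y. cinner (A j x) y = cinner x (B j y)" 
    using adjoint_tuple_exists by blast
  define Y where "Y = b ` (G \<union> H) \<union> (\<Union>j. A j ` b ` (G \<union> H)) \<union> (\<Union>j. B j ` b ` (G \<union> H))"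
  have "finite Y" using G insert by (simp add: Y_def)
  with insert.prems(2)[rule_format, OF insertI1] obtain x where
    x: "norm x = 1" "\<And>y. y \<in> Y \<Longrightarrow> cinner x y = 0" "norm (quad A x - d h0) < e"
    using e by (rule ess_pointsE) blast+
  have x0: "cinner x (b g) = 0" "cinner (b g) x = 0" "cinner (A j (b g)) x = 0" "cinner (A j x) (b g) = 0"
    if "g \<in> G \<union> H" for g j
  proof -
    have "b g \<in> Y" "A j (b g) \<in> Y" "B j (b g) \<in> Y" unfolding Y_def using that by blast+
    then show "cinner x (b g) = 0" "cinner (b g) x = 0" "cinner (A j (b g)) x = 0" "cinner (A j x) (b g) = 0"
      using x(2)[of "b g"] x(2)[of "A j (b g)"] x(2)[of "B j (b g)"]
        cinner_eq_0_commute[of x "b g"] cinner_eq_0_commute[of x "A j (b g)"] B[of j x "b g"] by simp_all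
  qed
  have xx: "cinner x x = 1" using x(1) norm_eq_1_iff_cinner by blast
  have h0: "h0 \<notin> G \<union> H" using insert by auto
  define b' where "b' = b(h0 := x)"
  have b': "b' h0 = x" "\<And>g. g \<in> G \<union> H \<Longrightarrow> b' g = b g" using h0 by (auto simp: b'_def)
  have "cinner (b' g) (b' h) = (if g = h then 1 else 0) \<and> (g \<noteq> h \<longrightarrow> (\<forall>j. cinner (A j (b' g)) (b' h) = 0))"
    if gh: "g \<in> G \<union> insert h0 H" "h \<in> G \<union> insert h0 H" for g h
  proof (cases "g = h0"; cases "h = h0")
    assume "g \<noteq> h0" "h \<noteq> h0"
    then have "g \<in> G \<union> H" "h \<in> G \<union> H" using gh by auto
    then show ?thesis using b b'(2) by simp
  next
    assume *: "g \<noteq> h0" "h = h0"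
    then have "g \<in> G \<union> H" using gh by auto
    then show ?thesis using x0[of g] b' * by simp
  next
    assume *: "g = h0" "h \<noteq> h0"
    then have "h \<in> G \<union> H" using gh by auto
    then show ?thesis using x0[of h] b' * by simp
  qed (use b' xx in auto)
  moreover have "norm (quad A (b' g) - d g) < e" if "g \<in> G \<union> insert h0 H" for g
  proof (cases "g = h0")
    case False
    then have "g \<in> G \<union> H" using that by auto
    then show ?thesis using b'(2) bq by simp
  qed (use x(3) b' in simp)
  ultimately show ?case by (intro exI[of _ b']) blast
qed

text \<open>In an approximating family orthogonality and vanishing of mixed terms are exact and only
  the values are approximate, so \<open>weighted_quad_in_range\<close> applies to it.\<close>

lemma weighted_sum_in_closure:
  assumes H: "finite H" and G: "finite G" "G \<inter> H = {}"
    and b0: "\<forall>g\<in>G. \<forall>h\<in>G. cinner (b0 g) (b0 h) = (if g = h then 1 else 0)"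
    and ev: "\<forall>g\<in>G. joint_eigenvector A (d g) (b0 g)"
    and ess: "\<forall>h\<in>H. d h \<in> ess_points A"
    and t: "\<And>g. g \<in> G \<union> H \<Longrightarrow> 0 \<le> t g \<and> t g \<le> 1" "sum t (G \<union> H) = real k"
  shows "(\<Sum>g\<in>G \<union> H. t g *\<^sub>R d g) \<in> closure (joint_num_range UNIV k A)"
  unfolding closure_approachable
proof (intro allI impI)
  fix e :: real assume e: "0 < e"
  \<comment> \<open>The weights add up to \<open>k\<close>, so the total error stays below
    \<open>e\<close>; the added one covers \<open>k = 0\<close>.\<close>
  have "0 < e / (real k + 1)" using e by simp
  from approximating_family[OF H G b0 ev ess this] obtain b where
    bo: "\<forall>g\<in>G \<union> H. \<forall>h\<in>G \<union> H. cinner (b g) (b h) = (if g = h then 1 else 0) \<and>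
      (g \<noteq> h \<longrightarrow> (\<forall>j. cinner (A j (b g)) (b h) = 0))" and
    bq: "\<forall>g\<in>G \<union> H. norm (quad A (b g) - d g) < e / (real k + 1)"
    by (elim exE conjE)
  let ?z = "\<Sum>g\<in>G \<union> H. t g *\<^sub>R quad A (b g)"
  have "?z \<in> joint_num_range UNIV k A"
  proof (rule weighted_quad_in_range[OF complex_vector.subspace_UNIV bounded])
    show "finite (G \<union> H)" using H G by simp
    show "cinner (b g) (b h) = (if g = h then 1 else 0)" if "g \<in> G \<union> H" "h \<in> G \<union> H" for g h
      using bo[rule_format, OF that] by simp
    show "cinner (A j (b g)) (b h) = 0" if "g \<in> G \<union> H" "h \<in> G \<union> H" "g \<noteq> h" for g h j
      using bo[rule_format, OF that(1,2)] that(3) by simp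
  qed (use t in auto)
  moreover have "dist ?z (\<Sum>g\<in>G \<union> H. t g *\<^sub>R d g) < e"
  proof -
    have "dist ?z (\<Sum>g\<in>G \<union> H. t g *\<^sub>R d g) = norm (\<Sum>g\<in>G \<union> H. t g *\<^sub>R (quad A (b g) - d g))"
      by (simp add: dist_norm sum_subtractf scaleR_diff_right)
    also have "\<dots> \<le> (\<Sum>g\<in>G \<union> H. t g * (e / (real k + 1)))"
    proof (rule sum_norm_le)
      fix g assume g: "g \<in> G \<union> H"
      show "norm (t g *\<^sub>R (quad A (b g) - d g)) \<le> t g * (e / (real k + 1))"
        using mult_left_mono[OF less_imp_le[OF bq[rule_format, OF g]], of "t g"] t(1)[OF g] by simp
    qed
    also have "\<dots> = real k * (e / (real k + 1))" by (simp only: sum_distrib_right[symmetric] t(2))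
    also have "\<dots> < e" using e by (simp add: field_simps)
    finally show ?thesis .
  qed
  ultimately show "\<exists>y\<in>joint_num_range UNIV k A. dist y (\<Sum>g\<in>G \<union> H. t g *\<^sub>R d g) < e" by blast
qed

lemma subset_sum_in_closure:
  assumes H: "finite H" and G: "finite G" "G \<inter> H = {}"
    and b0: "\<forall>g\<in>G. \<forall>h\<in>G. cinner (b0 g) (b0 h) = (if g = h then 1 else 0)"
    and ev: "\<forall>g\<in>G. joint_eigenvector A (d g) (b0 g)"
    and ess: "\<forall>h\<in>H. d h \<in> ess_points A"
    and k: "card (G \<union> H) = k"
  shows "sum d (G \<union> H) \<in> closure (joint_num_range UNIV k A)"
  using weighted_sum_in_closure[OF H G b0 ev ess, of "\<lambda>_. 1" k] k by simp

end

text \<open>Test with the direction moved from \<open>a\<close> against \<open>z\<close> by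
  \<open>r / 2\<close>, which keeps it inside the open ball. The quantitative form is what later
  produces a spectral gap.\<close>

lemma open_ball_functional_bound:
  fixes z :: "'v::real_inner"
  assumes "0 < r" "\<And>b. b \<in> ball a r \<Longrightarrow> 0 \<le> inner b z"
  shows "r / 2 * norm z \<le> inner a z"
proof (cases "z = 0")
  case False
  define b where "b = a - (r / (2 * norm z)) *\<^sub>R z"
  have "dist a b = r / 2" using False assms(1) by (simp add: b_def dist_norm)
  then have "0 \<le> inner b z" using assms by simp
  also have "inner b z = inner a z - r / (2 * norm z) * (norm z)\<^sup>2"
    by (simp add: b_def inner_diff_left power2_norm_eq_inner)
  also have "\<dots> = inner a z - r / 2 * norm z" using False by (simp add: power2_eq_square)
  finally show ?thesis by simp
qed simp

lemma open_ball_functional_eq_0: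
  fixes z :: "'v::real_inner"
  assumes "0 < r" "\<And>b. b \<in> ball a r \<Longrightarrow> 0 \<le> inner b z" "inner a z \<le> 0"
  shows "z = 0"
proof -
  have "r / 2 * norm z \<le> 0" using open_ball_functional_bound[of r a z] assms by auto
  then show ?thesis using assms(1) by (simp add: mult_le_0_iff)
qed

text \<open>For nonzero \<open>c\<close>, a small \<open>t\<close> of opposite sign lets the
  negative linear term dominate; \<open>t = - c / s\<close> does so since \<open>s\<close> is
  positive and exceeds \<open>e\<close>.\<close>

lemma nonneg_quadratic_coefficient_0:
  fixes c e :: real
  assumes "\<And>t. 0 \<le> 2 * t * c + t\<^sup>2 * e"
  shows "c = 0"
proof (rule ccontr)
  assume c: "c \<noteq> 0"
  define s where "s = \<bar>e\<bar> + 1"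
  have s: "0 < s" "e < s" by (auto simp: s_def)
  have "2 * (- c / s) * c + (- c / s)\<^sup>2 * e = (c\<^sup>2 / s) * (e / s - 2)"
    using s by (simp add: field_simps power2_eq_square)
  moreover have "e / s - 2 < 0" "0 < c\<^sup>2 / s" using s c by (auto simp: field_simps)
  ultimately show False using assms[of "- c / s"] mult_pos_neg[of "c\<^sup>2 / s" "e / s - 2"] by linarith
qed

section \<open>Joint eigenvectors from a gap in the form\<close>

context op_tuple
begin

lemma quad_scaleR: "quad A (r *\<^sub>R x) = r\<^sup>2 *\<^sub>R quad A x"
  by (simp add: quad_def vec_eq_iff scaleR_scaleC[where 'a = 'a] bounded_opD(2)[OF bounded] cinner_scaleC_left
      cinner_scaleC_right scaleR_conv_of_real[where 'a = complex] power2_eq_square)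

lemma quad_homogeneous_le:
  assumes "\<And>u. norm u = 1 \<Longrightarrow> (\<forall>g\<in>G. cinner u g = 0) \<Longrightarrow> inner b (quad A u) \<le> c"
    and "\<forall>g\<in>G. cinner x g = 0"
  shows "inner b (quad A x) \<le> c * (norm x)\<^sup>2"
proof (cases "x = 0")
  case True
  then show ?thesis using quad_scaleR[of 0 0] by simp
next
  case False
  define u where "u = (1 / norm x) *\<^sub>R x"
  have "inner b (quad A u) \<le> c" using False assms(2) by (intro assms(1)) (auto simp: u_def)
  then have "(norm x)\<^sup>2 * inner b (quad A u) \<le> (norm x)\<^sup>2 * c" by (intro mult_left_mono) auto
  moreover have "x = norm x *\<^sub>R u" using False by (simp add: u_def)
  then have "quad A x = (norm x)\<^sup>2 *\<^sub>R quad A u" using quad_scaleR by metis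
  ultimately show ?thesis by (simp add: mult.commute)
qed

text \<open>A real-bilinear polarisation of \<open>inner b (quad A x)\<close>. The
  \<open>A j\<close> need not be self-adjoint, so it is in general not symmetric, and the defect
  form used later symmetrises it.\<close>

definition form :: "complex ^ 'm \<Rightarrow> 'a \<Rightarrow> 'a \<Rightarrow> real" where
  "form b x y = inner b (\<chi> j. cinner (A j x) y)"

lemma bounded_bilinear_form: "bounded_bilinear (form b)"
proof
  have ad: "(\<chi> j. cinner (A j (x + x')) y) = (\<chi> j. cinner (A j x) y) + (\<chi> j. cinner (A j x') y)" for x x' y
    by (simp add: vec_eq_iff bounded_opD(1)[OF bounded] cinner_add_left)
  have ad': "(\<chi> j. cinner (A j x) (y + y')) = (\<chi> j. cinner (A j x) y) + (\<chi> j. cinner (A j x) y')" for x y y'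
    by (simp add: vec_eq_iff cinner_add_right)
  have sc: "(\<chi> j. cinner (A j (r *\<^sub>R x)) y) = r *\<^sub>R (\<chi> j. cinner (A j x) y)" for r x y
    by (simp add: vec_eq_iff scaleR_scaleC[where 'a = 'a] bounded_opD(2)[OF bounded] cinner_scaleC_left
        scaleR_conv_of_real[where 'a = complex])
  have sc': "(\<chi> j. cinner (A j x) (r *\<^sub>R y)) = r *\<^sub>R (\<chi> j. cinner (A j x) y)" for r x y
    by (simp add: vec_eq_iff scaleR_conv_of_real[where 'a = complex])
  show "form b (x + x') y = form b x y + form b x' y" for x x' y
    by (simp add: form_def ad inner_add_right)
  show "form b x (y + y') = form b x y + form b x y'" for x y y'
    by (simp add: form_def ad' inner_add_right)
  show "form b (r *\<^sub>R x) y = r *\<^sub>R form b x y" for r x y by (simp add: form_def sc)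
  show "form b x (r *\<^sub>R y) = r *\<^sub>R form b x y" for r x y
    unfolding form_def sc' by simp
  have "\<forall>j. \<exists>M. \<forall>x. norm (A j x) \<le> norm x * M"
    using bounded_linear.bounded[OF bounded_opD(5)[OF bounded]] by blast
  then obtain M where M: "\<And>j x. norm (A j x) \<le> norm x * M j" by metis
  show "\<exists>K. \<forall>x y. norm (form b x y) \<le> norm x * norm y * K"
  proof (intro exI allI)
    fix x y
    have "norm (form b x y) \<le> norm b * norm ((\<chi> j. cinner (A j x) y) :: complex ^ 'm)"
      by (simp add: form_def Cauchy_Schwarz_ineq2)
    also have "\<dots> \<le> norm b * (\<Sum>j\<in>UNIV. norm x * norm y * M j)"
    proof (intro mult_left_mono order_trans[OF norm_vec_le_sum] sum_mono)
      fix j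
      have "cmod (cinner (A j x) y) \<le> norm (A j x) * norm y" by (rule cmod_cinner_le)
      also have "\<dots> \<le> (norm x * M j) * norm y" by (intro mult_right_mono M) auto
      finally show "cmod ((\<chi> j. cinner (A j x) y) $ j) \<le> norm x * norm y * M j" by (simp add: mult_ac)
    qed simp
    also have "\<dots> = norm x * norm y * (norm b * sum M UNIV)" by (simp add: sum_distrib_left mult_ac)
    finally show "norm (form b x y) \<le> norm x * norm y * (norm b * sum M UNIV)" .
  qed
qed

lemma form_self: "form b x x = inner b (quad A x)"
  by (simp add: form_def quad_def)

text \<open>A maximising sequence for the top of the spectrum is Cauchy when the form has a gap on a
  complement of finite codimension; the positivity of all nearby forms turns the limit into a
  joint eigenvector.\<close>

lemma joint_eigenvector_of_gap:
  assumes G: "finite G" "orthonormal_set G" "\<And>g. g \<in> G \<Longrightarrow> joint_eigenvector A (v g) g"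
    and Y: "finite Y" and pos: "0 < r" "0 < \<delta>"
    and le: "\<And>b x. b \<in> ball a r \<Longrightarrow> (\<forall>g\<in>G. cinner x g = 0) \<Longrightarrow> inner b (quad A x) \<le> inner b d * (norm x)\<^sup>2"
    and sup: "\<And>e. 0 < e \<Longrightarrow> \<exists>x. norm x = 1 \<and> (\<forall>g\<in>G. cinner x g = 0) \<and> inner a d - e < inner a (quad A x)"
    and gap: "\<And>x. (\<forall>y\<in>Y. cinner x y = 0) \<Longrightarrow> inner a (quad A x) \<le> (inner a d - \<delta>) * (norm x)\<^sup>2"
  shows "\<exists>x. norm x = 1 \<and> (\<forall>g\<in>G. cinner x g = 0) \<and> joint_eigenvector A d x"
proof -
  \<comment> \<open>The defect form: symmetric, nonnegative on the complement of \<open>G\<close>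
    for every \<open>b\<close> near \<open>a\<close>, and zero on the diagonal exactly where the
    bound is attained.\<close>
  define \<beta> where "\<beta> b x y = inner b d * inner x y - (form b x y + form b y x) / 2" for b x y
  note bil = bounded_bilinear.add_left[OF bounded_bilinear_form] bounded_bilinear.add_right[OF bounded_bilinear_form]
    bounded_bilinear.diff_left[OF bounded_bilinear_form] bounded_bilinear.diff_right[OF bounded_bilinear_form]
    bounded_bilinear.scaleR_left[OF bounded_bilinear_form] bounded_bilinear.scaleR_right[OF bounded_bilinear_form]
  have \<beta>_add: "\<beta> b (x + y) (x + y) = \<beta> b x x + 2 * \<beta> b x y + \<beta> b y y" for b x y
    by (simp add: \<beta>_def bil inner_add_left inner_add_right inner_commute[of y x] field_simps)
  have \<beta>_diff: "\<beta> b (x - y) (x - y) = \<beta> b x x - 2 * \<beta> b x y + \<beta> b y y" for b x y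
    by (simp add: \<beta>_def bil inner_diff_left inner_diff_right inner_commute[of y x] field_simps)
  have \<beta>_scale: "\<beta> b x (t *\<^sub>R y) = t * \<beta> b x y" "\<beta> b (t *\<^sub>R x) y = t * \<beta> b x y" for b x y t
    by (simp_all add: \<beta>_def bil field_simps)
  have \<beta>_self: "\<beta> b x x = inner b d * (norm x)\<^sup>2 - inner b (quad A x)" for b x
    by (simp add: \<beta>_def form_self power2_norm_eq_inner)
  have \<beta>_nonneg: "0 \<le> \<beta> b x x" if "b \<in> ball a r" "\<forall>g\<in>G. cinner x g = 0" for b x
    using le[OF that] by (simp add: \<beta>_self)
  have a: "a \<in> ball a r" using pos by simp
  obtain C where C: "0 < C" "\<And>x y. \<bar>\<beta> a x y\<bar> \<le> C * norm x * norm y"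
  proof -
    obtain K where K: "\<And>x y. norm (form a x y) \<le> norm x * norm y * K"
      using bounded_bilinear.bounded[OF bounded_bilinear_form] by blast
    have "\<bar>\<beta> a x y\<bar> \<le> (\<bar>inner a d\<bar> + \<bar>K\<bar> + 1) * norm x * norm y" for x y
    proof -
      have "\<bar>inner a d * inner x y\<bar> \<le> \<bar>inner a d\<bar> * (norm x * norm y)"
        unfolding abs_mult by (intro mult_left_mono Cauchy_Schwarz_ineq2) auto
      moreover have "norm (form a u w) \<le> \<bar>K\<bar> * (norm u * norm w)" for u w
        using K[of u w] mult_left_mono[OF abs_ge_self[of K], of "norm u * norm w"] by (simp add: mult_ac)
      from this[of x y] this[of y x] have "\<bar>(form a x y + form a y x) / 2\<bar> \<le> \<bar>K\<bar> * (norm x * norm y)"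
        by (simp add: mult.commute[of "norm y"])
      moreover have "0 \<le> norm x * norm y" by simp
      moreover have "\<bar>\<beta> a x y\<bar> \<le> \<bar>inner a d * inner x y\<bar> + \<bar>(form a x y + form a y x) / 2\<bar>"
        unfolding \<beta>_def by (rule abs_triangle_ineq4)
      ultimately have "\<bar>\<beta> a x y\<bar> \<le> \<bar>inner a d\<bar> * (norm x * norm y) + \<bar>K\<bar> * (norm x * norm y) + norm x * norm y"
        by linarith
      then show ?thesis by (simp add: algebra_simps)
    qed
    then show ?thesis by (intro that[of "\<bar>inner a d\<bar> + \<bar>K\<bar> + 1"]) auto
  qed
  have "\<exists>x. norm x = 1 \<and> (\<forall>g\<in>G. cinner x g = 0) \<and> \<beta> a x x < 1 / real (Suc n)" for n
  proof -
    have "0 < 1 / real (Suc n)" by simp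
    from sup[OF this] obtain x where x: "norm x = 1" "\<forall>g\<in>G. cinner x g = 0"
      "inner a d - 1 / real (Suc n) < inner a (quad A x)" by blast
    then have "\<beta> a x x < 1 / real (Suc n)" by (simp add: \<beta>_self del: of_nat_Suc)
    then show ?thesis using x by blast
  qed
  then obtain x where x: "\<And>n. norm (x n) = 1" "\<And>n g. g \<in> G \<Longrightarrow> cinner (x n) g = 0"
    "\<And>n. \<beta> a (x n) (x n) < 1 / real (Suc n)" by metis
  \<comment> \<open>The gap holds only on the complement of \<open>Y\<close>. Projections to the
    span of \<open>F\<close>, which contains \<open>Y\<close>, range in a compact set and converge
    along a subsequence; the gap controls the remaining component.\<close>
  obtain F where F: "finite F" "orthonormal_set F" "Y \<subseteq> complex_vector.span F"
    using Gram_Schmidt_finite[OF Y] by blast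
  have FY: "\<forall>y\<in>Y. cinner u y = 0" if "\<And>f. f \<in> F \<Longrightarrow> cinner u f = 0" for u
    using cinner_span_eq_0[of F u] that F(3) by blast
  let ?Q = "fproj F"
  have Q: "bounded_op_on UNIV ?Q" by (rule bounded_op_fproj[OF F(1,2)])
  let ?C = "{(\<Sum>g\<in>F. c g *\<^sub>C g) | c. \<forall>g\<in>F. cmod (c g) \<le> 1}"
  have "cmod (cinner (x n) g) \<le> 1" if "g \<in> F" for n g
    using cmod_cinner_le[of "x n" g] orthonormal_set_norm[OF F(2) that] x(1) by simp
  then have "\<forall>n. ?Q (x n) \<in> ?C" unfolding fproj_def by blast
  with compact_imp_seq_compact[OF compact_coefficient_set[OF F(1)]]
  obtain p s where s: "strict_mono s" "((\<lambda>n. ?Q (x n)) \<circ> s) \<longlonglongrightarrow> p"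
    by (rule seq_compactE) (rule that; assumption)
  define y where "y = x \<circ> s"
  have y: "\<And>n. norm (y n) = 1" "\<And>n g. g \<in> G \<Longrightarrow> cinner (y n) g = 0"
    using x by (simp_all add: y_def)
  have \<beta>y: "\<beta> a (y n) (y n) < 1 / real (Suc n)" for n
  proof -
    have "1 / real (Suc (s n)) \<le> 1 / real (Suc n)"
      using seq_suble[OF s(1), of n] by (intro divide_left_mono) auto
    then show ?thesis using x(3)[of "s n"] by (simp add: y_def)
  qed
  have Qy: "Cauchy (\<lambda>n. ?Q (y n))"
    using LIMSEQ_imp_Cauchy[OF s(2)] by (simp add: y_def comp_def)
  have "Cauchy y"
  proof (rule metric_CauchyI)
    fix e :: real assume e: "0 < e"
    \<comment> \<open>Passing from \<open>u\<close> to \<open>u - P\<close> costs at most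
      \<open>2 * \<bar>\<beta> a u P\<bar> + \<bar>\<beta> a P P\<bar>\<close>, which is at most
      \<open>6 * C * \<eta>\<close>; the choice of \<eta> makes this at most an eighth of
      \<open>\<delta> * e\<^sup>2\<close>.\<close>
    define \<eta> where "\<eta> = min (e / 2) (\<delta> * e\<^sup>2 / (48 * C))"
    have \<eta>: "0 < \<eta>" "\<eta> \<le> e / 2" "6 * C * \<eta> \<le> \<delta> * e\<^sup>2 / 8"
    proof -
      have "6 * C * \<eta> \<le> 6 * C * (\<delta> * e\<^sup>2 / (48 * C))" using C(1) by (intro mult_left_mono) (auto simp: \<eta>_def)
      then show "6 * C * \<eta> \<le> \<delta> * e\<^sup>2 / 8" using C(1) by simp
    qed (use e pos C(1) in \<open>auto simp: \<eta>_def\<close>)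
    obtain N1 where N1: "\<And>m n. N1 \<le> m \<Longrightarrow> N1 \<le> n \<Longrightarrow> dist (?Q (y m)) (?Q (y n)) < \<eta>"
      using metric_CauchyD[OF Qy \<eta>(1)] by blast
    \<comment> \<open>Makes each \<open>\<beta> a (y i) (y i)\<close> at most
      \<open>\<delta> * e\<^sup>2 / 32\<close>; the parallelogram law for \<open>\<beta> a\<close>
      below uses four of them.\<close>
    obtain N2 where N2: "32 / (\<delta> * e\<^sup>2) < real N2" using reals_Archimedean2 by blast
    have de: "0 < \<delta> * e\<^sup>2" using pos e by simp
    have "dist (y m) (y n) < e" if mn: "max N1 N2 \<le> m" "max N1 N2 \<le> n" for m n
    proof -
      define u P where "u = y m - y n" and "P = ?Q u"
      have P: "norm P < \<eta>" using N1[of m n] mn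
        by (simp add: P_def u_def bounded_opD(4)[OF Q] dist_norm)
      have small: "1 / real (Suc i) \<le> \<delta> * e\<^sup>2 / 32" if "max N1 N2 \<le> i" for i
      proof -
        have "32 / (\<delta> * e\<^sup>2) \<le> real (Suc i)" using N2 that by linarith
        then show ?thesis using de by (simp add: field_simps)
      qed
      have "\<beta> a u u \<le> \<beta> a u u + \<beta> a (y m + y n) (y m + y n)"
        using \<beta>_nonneg[OF a, of "y m + y n"] y(2) by (simp add: cinner_add_left)
      also have "\<dots> = 2 * \<beta> a (y m) (y m) + 2 * \<beta> a (y n) (y n)" by (simp add: u_def \<beta>_add \<beta>_diff)
      also have "\<dots> \<le> \<delta> * e\<^sup>2 / 8"
        using small[OF mn(1)] small[OF mn(2)] \<beta>y[of m] \<beta>y[of n] by linarith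
      finally have 1: "\<beta> a u u \<le> \<delta> * e\<^sup>2 / 8" .
      have nu: "norm u \<le> 2" using norm_triangle_ineq4[of "y m" "y n"] y(1) by (simp add: u_def)
      have nP: "norm P \<le> norm u"
        using fproj_pythagoras[OF F(2,1), of u] power2_le_imp_le[of "norm P" "norm u"] by (simp add: P_def)
      have "\<bar>\<beta> a u P\<bar> \<le> C * norm u * norm P" by (rule C(2))
      also have "\<dots> \<le> C * 2 * \<eta>" using C(1) nu P by (intro mult_mono) auto
      finally have 2: "\<bar>\<beta> a u P\<bar> \<le> 2 * C * \<eta>" by simp
      have "\<bar>\<beta> a P P\<bar> \<le> C * norm P * norm P" by (rule C(2))
      also have "\<dots> \<le> C * 2 * \<eta>" using C(1) nu nP P by (intro mult_mono) auto
      finally have 3: "\<bar>\<beta> a P P\<bar> \<le> 2 * C * \<eta>" by simp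
      have "\<forall>f\<in>Y. cinner (u - P) f = 0" by (rule FY) (simp add: P_def fproj_residual[OF F(2,1)])
      from gap[OF this] have "\<delta> * (norm (u - P))\<^sup>2 \<le> \<beta> a (u - P) (u - P)"
        by (simp add: \<beta>_self algebra_simps)
      also have "\<dots> \<le> \<delta> * e\<^sup>2 / 8 + 6 * C * \<eta>" using 1 2 3 by (simp add: \<beta>_diff)
      also have "\<dots> \<le> \<delta> * (e / 2)\<^sup>2" using \<eta>(3) by (simp add: power_divide)
      finally have "(norm (u - P))\<^sup>2 \<le> (e / 2)\<^sup>2" using pos by simp
      then have "norm (u - P) \<le> e / 2" by (rule power2_le_imp_le) (use e in simp)
      then have "norm u < e" using norm_triangle_ineq[of "u - P" P] P \<eta>(2) by simp
      then show ?thesis by (simp add: u_def dist_norm)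
    qed
    then show "\<exists>M. \<forall>m\<ge>M. \<forall>n\<ge>M. dist (y m) (y n) < e" by blast
  qed
  then obtain z where z: "y \<longlonglongrightarrow> z" using Cauchy_convergent convergent_def by blast
  have nz: "norm z = 1" using tendsto_norm[OF z] y(1) by (simp add: LIMSEQ_const_iff)
  have zG: "\<forall>g\<in>G. cinner z g = 0"
  proof
    fix g assume "g \<in> G"
    then have "(\<lambda>n. 0) \<longlonglongrightarrow> cinner z g"
      using tendsto_cinner[OF z tendsto_const, of g] y(2) by simp
    then show "cinner z g = 0" by (simp add: LIMSEQ_const_iff)
  qed
  have "(\<lambda>n. \<beta> a (y n) (y n)) \<longlonglongrightarrow> \<beta> a z z"
    unfolding \<beta>_def by (intro tendsto_intros bounded_bilinear.tendsto[OF bounded_bilinear_form] z) simp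
  moreover have "(\<lambda>n. 1 / real (Suc n)) \<longlonglongrightarrow> 0" by (rule LIMSEQ_Suc[OF lim_1_over_n])
  ultimately have az: "\<beta> a z z \<le> 0"
    by (rule LIMSEQ_le) (auto intro!: exI[of _ 0] less_imp_le \<beta>y simp del: of_nat_Suc)
  have "d - quad A z = 0"
  proof (rule open_ball_functional_eq_0[OF pos(1)])
    show "0 \<le> inner b (d - quad A z)" if "b \<in> ball a r" for b
      using \<beta>_nonneg[OF that zG] by (simp add: \<beta>_self nz inner_diff_right)
    show "inner a (d - quad A z) \<le> 0" using az by (simp add: \<beta>_self nz inner_diff_right)
  qed
  then have \<beta>z: "\<beta> b z z = 0" for b by (simp add: \<beta>_self nz)
  \<comment> \<open>\<open>z\<close> minimises the nonnegative form \<open>\<beta> b\<close> on the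
    complement of \<open>G\<close>, so the first variation in every direction \<open>u\<close> of
    that complement vanishes.\<close>
  have perp: "\<beta> b z u = 0" if b: "b \<in> ball a r" and u: "\<forall>g\<in>G. cinner u g = 0" for b u
  proof (rule nonneg_quadratic_coefficient_0)
    fix t
    have "0 \<le> \<beta> b (z + t *\<^sub>R u) (z + t *\<^sub>R u)"
      using zG u by (intro \<beta>_nonneg[OF b]) (simp add: cinner_add_left)
    then show "0 \<le> 2 * t * \<beta> b z u + t\<^sup>2 * \<beta> b u u"
      by (simp add: \<beta>_add \<beta>_scale \<beta>z power2_eq_square)
  qed
  \<comment> \<open>Collects all components \<open>j\<close> in one vector:
    \<open>\<beta> b z u\<close> is the pairing of \<open>b\<close> with \<open>W u\<close>, and a
    vector that pairs to zero with a whole ball is zero.\<close>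
  define W where "W u = inner z u *\<^sub>R d - (1/2) *\<^sub>R (\<chi> j. cinner (A j z) u + cinner (A j u) z)" for u
  have \<beta>W: "\<beta> b z u = inner b (W u)" for b u
  proof -
    have "(\<chi> j. cinner (A j z) u + cinner (A j u) z) = (\<chi> j. cinner (A j z) u) + (\<chi> j. cinner (A j u) z)"
      by (simp add: vec_eq_iff)
    then show ?thesis by (simp add: \<beta>_def W_def form_def inner_diff_right inner_add_right)
  qed
  \<comment> \<open>Directions along \<open>G\<close> contribute nothing, as \<open>G\<close>
    consists of eigenvectors of the tuple and of its adjoints; this extends \<open>perp\<close> from
    the complement of \<open>G\<close> to all \<open>u\<close>.\<close>
  have Gz: "cinner (A j z) (fproj G u) = 0" "cinner (A j (fproj G u)) z = 0" "cinner z (fproj G u) = 0" for j u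
  proof -
    have "cinner (A j z) g = 0" "cinner (A j g) z = 0" if "g \<in> G" for g
      using G(3)[OF that] zG that
      by (auto simp: joint_eigenvector_def cinner_scaleC_left cinner_eq_0_commute[of _ z])
    moreover have "A j (fproj G u) = (\<Sum>g\<in>G. cinner u g *\<^sub>C A j g)" unfolding fproj_def
      using bounded_op_on_sum[OF complex_vector.subspace_UNIV bounded, of G "\<lambda>g. g" j] by simp
    ultimately show "cinner (A j z) (fproj G u) = 0" "cinner (A j (fproj G u)) z = 0"
      by (simp_all add: cinner_sum_left cinner_scaleC_left, simp add: fproj_def cinner_sum_right cinner_scaleC_right)
    show "cinner z (fproj G u) = 0"
      using zG by (simp add: fproj_def cinner_sum_right cinner_scaleC_right)
  qed
  have "W u = 0" for u
  proof (rule open_ball_functional_eq_0[OF pos(1)])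
    define q where "q = u - fproj G u"
    have u: "u = q + fproj G u" by (simp add: q_def)
    have q: "\<forall>g\<in>G. cinner q g = 0" by (simp add: q_def fproj_residual[OF G(2,1)])
    have "cinner (A j z) u = cinner (A j z) q" "cinner (A j u) z = cinner (A j q) z" for j
      using Gz(1)[of j u] Gz(2)[of j u]
      by (simp_all add: q_def cinner_diff_right cinner_diff_left bounded_opD(4)[OF bounded])
    moreover have "inner z u = inner z q" using Gz(3)[of u]
      by (simp add: inner_eq_Re_cinner q_def cinner_diff_right)
    ultimately have "W u = W q" by (simp add: W_def)
    then have *: "inner b (W u) = 0" if "b \<in> ball a r" for b
      using perp[OF that q] \<beta>W by simp
    show "0 \<le> inner b (W u)" if "b \<in> ball a r" for b using *[OF that] by simp
    show "inner a (W u) \<le> 0" using *[OF a] by simp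
  qed
  then have S: "cinner (A j z) u + cinner (A j u) z = 2 * of_real (Re (cinner z u)) * d $ j" for u j
  proof -
    assume "\<And>u. W u = 0"
    then have "W u $ j = 0" by simp
    then have "complex_of_real (Re (cinner z u)) * d $ j * 2 = cinner (A j z) u + cinner (A j u) z"
      by (simp add: W_def inner_eq_Re_cinner scaleR_conv_of_real[where 'a = complex])
    from this[symmetric] show ?thesis by (simp add: mult_ac)
  qed
  \<comment> \<open>The identity \<open>S\<close> is only real-linear in \<open>u\<close>; inserting
    \<open>\<i> *\<^sub>C u\<close> separates \<open>cinner (A j z) u\<close> from
    \<open>cinner (A j u) z\<close>.\<close>
  have D: "cinner (A j z) u - cinner (A j u) z = 2 * \<i> * of_real (Im (cinner z u)) * d $ j" for u j
  proof -
    have "- \<i> * cinner (A j z) u + \<i> * cinner (A j u) z = 2 * of_real (Im (cinner z u)) * d $ j"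
      using S[of j "\<i> *\<^sub>C u"] by (simp add: cinner_scaleC_right cinner_scaleC_left bounded_opD(2)[OF bounded])
    moreover have "p - q = \<i> * (- \<i> * p + \<i> * q)" for p q by (simp add: complex_eq_iff)
    ultimately have "cinner (A j z) u - cinner (A j u) z = \<i> * (2 * of_real (Im (cinner z u)) * d $ j)"
      by metis
    then show ?thesis by (simp add: mult_ac)
  qed
  have e1: "cinner (A j z) u = d $ j * cinner z u" and e2: "cinner (A j u) z = d $ j * cinner u z" for u j
  proof -
    have zu: "cinner z u = of_real (Re (cinner z u)) + \<i> * of_real (Im (cinner z u))"
      by (rule complex_eq)
    have uz: "cinner u z = of_real (Re (cinner z u)) - \<i> * of_real (Im (cinner z u))"
      by (subst cinner_commute) (simp add: complex_eq_iff)
    have "2 * cinner (A j z) u = (cinner (A j z) u + cinner (A j u) z) + (cinner (A j z) u - cinner (A j u) z)"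
      by simp
    also have "\<dots> = 2 * (d $ j * cinner z u)" unfolding S D by (subst (3) zu) (simp add: algebra_simps)
    finally have "2 * cinner (A j z) u = 2 * (d $ j * cinner z u)" .
    then show "cinner (A j z) u = d $ j * cinner z u" by simp
    have "2 * cinner (A j u) z = (cinner (A j z) u + cinner (A j u) z) - (cinner (A j z) u - cinner (A j u) z)"
      by simp
    also have "\<dots> = 2 * (d $ j * cinner u z)" unfolding S D by (subst uz) (simp add: algebra_simps)
    finally have "2 * cinner (A j u) z = 2 * (d $ j * cinner u z)" .
    then show "cinner (A j u) z = d $ j * cinner u z" by simp
  qed
  have "A j z = (d $ j) *\<^sub>C z" for j
  proof -
    have "cinner (A j z - (d $ j) *\<^sub>C z) (A j z - (d $ j) *\<^sub>C z) = 0"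
      by (simp add: cinner_diff_left e1 cinner_scaleC_left)
    then show ?thesis by (simp add: cinner_self)
  qed
  then show ?thesis using nz zG e2 by (auto simp: joint_eigenvector_def)
qed


text \<open>The adjoint clause of \<open>joint_eigenvector\<close> makes the span of
  \<open>G\<close> reducing, so mixed terms between it and its complement vanish.\<close>

lemma quad_split_eigenvectors:
  assumes G: "finite G" "orthonormal_set G" "\<And>g. g \<in> G \<Longrightarrow> joint_eigenvector A (v g) g"
  shows "quad A x = (\<Sum>g\<in>G. (cmod (cinner x g))\<^sup>2 *\<^sub>R quad A g) + quad A (x - fproj G x)"
proof (rule vec_eq_iff[THEN iffD2], rule allI)
  fix j
  define p q where "p = fproj G x" and "q = x - p"
  have x: "x = p + q" by (simp add: q_def)
  have qG: "cinner q g = 0" if "g \<in> G" for g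
    using that by (simp add: q_def p_def fproj_residual[OF G(2,1)])
  have gq: "cinner g q = 0" if "g \<in> G" for g
    using qG[OF that] cinner_eq_0_commute by blast
  have ev: "A j g = (v g $ j) *\<^sub>C g" "cinner (A j y) g = v g $ j * cinner y g" if "g \<in> G" for g y
    using G(3)[OF that] by (simp_all add: joint_eigenvector_def)
  have gg: "cinner g g = 1" if "g \<in> G" for g using G(2) that by (simp add: orthonormal_set_def)
  have Ap: "A j p = (\<Sum>g\<in>G. cinner x g *\<^sub>C A j g)" unfolding p_def fproj_def
    using bounded_op_on_sum[OF complex_vector.subspace_UNIV bounded, of G "\<lambda>g. g" j] by simp
  have 1: "cinner (A j p) q = 0"
    unfolding Ap using gq by (simp add: cinner_sum_left cinner_scaleC_left ev)
  have 2: "cinner (A j q) p = 0"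
    unfolding p_def fproj_def using qG by (simp add: cinner_sum_right cinner_scaleC_right ev)
  have 3: "cinner (A j p) p = (\<Sum>g\<in>G. of_real ((cmod (cinner x g))\<^sup>2) * cinner (A j g) g)"
  proof -
    have "cinner (A j p) p = (\<Sum>g\<in>G. cinner x g * (v g $ j * cinner g p))"
      unfolding Ap by (simp add: cinner_sum_left cinner_scaleC_left ev mult.assoc)
    also have "\<dots> = (\<Sum>g\<in>G. of_real ((cmod (cinner x g))\<^sup>2) * cinner (A j g) g)"
    proof (intro sum.cong refl)
      fix g assume g: "g \<in> G"
      have "cinner g p = cnj (cinner x g)"
        using cinner_fproj[OF G(2,1) g, of x] cinner_commute[of g p] by (simp add: p_def)
      then show "cinner x g * (v g $ j * cinner g p) = of_real ((cmod (cinner x g))\<^sup>2) * cinner (A j g) g"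
        using ev(2)[OF g, of g] gg[OF g] by (simp add: complex_norm_square del: of_real_power)
    qed
    finally show ?thesis .
  qed
  have "cinner (A j x) x = cinner (A j p) p + cinner (A j p) q + (cinner (A j q) p + cinner (A j q) q)"
    unfolding x by (simp add: bounded_opD(1)[OF bounded] cinner_add_left cinner_add_right)
  then show "quad A x $ j = ((\<Sum>g\<in>G. (cmod (cinner x g))\<^sup>2 *\<^sub>R quad A g) + quad A (x - fproj G x)) $ j"
    unfolding 1 2 3 by (simp add: quad_def q_def p_def scaleR_conv_of_real[where 'a = complex])
qed

section \<open>Support functions of the ranges and extreme points of the essential range\<close>

lemma closure_hull_le:
  fixes S :: "'v::real_inner set"
  assumes "\<And>z. z \<in> S \<Longrightarrow> inner b z \<le> c" "z \<in> closure (convex hull S)"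
  shows "inner b z \<le> c"
proof -
  have "closure (convex hull S) \<subseteq> {z. inner b z \<le> c}"
    using assms(1) by (intro closure_minimal hull_minimal closed_halfspace_le convex_halfspace_le) auto
  then show ?thesis using assms(2) by auto
qed

text \<open>\<open>quad_split_eigenvectors\<close> brings the form into the shape required by
  \<open>Ky_Fan_bound\<close>, with \<mu> bounding whatever \<open>G\<close> does not
  capture.\<close>

lemma joint_num_range_le_eigenvectors:
  assumes G: "finite G" "orthonormal_set G" "\<And>g. g \<in> G \<Longrightarrow> joint_eigenvector A (v g) g"
    and \<mu>: "\<And>g. g \<in> G \<Longrightarrow> \<mu> \<le> inner b (quad A g)"
      "\<And>x. (\<forall>g\<in>G. cinner x g = 0) \<Longrightarrow> inner b (quad A x) \<le> \<mu> * (norm x)\<^sup>2"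
    and z: "z \<in> closure (convex hull (joint_num_range UNIV n A))"
  shows "inner b z \<le> inner b (sum (quad A) G) + (real n - real (card G)) * \<mu>"
proof (rule closure_hull_le[OF _ z])
  fix z assume "z \<in> joint_num_range UNIV n A"
  then obtain X where X: "finite X" "card X = n" "orthonormal_set X" "z = sum (quad A) X"
    unfolding joint_num_range_eq by blast
  have "(\<Sum>x\<in>X. inner b (quad A x)) \<le> (\<Sum>g\<in>G. inner b (quad A g) - \<mu>) + real (card X) * \<mu>"
  proof (rule Ky_Fan_bound[OF X(1,3)])
    show "norm g = 1 \<and> 0 \<le> inner b (quad A g) - \<mu>" if "g \<in> G" for g
      using \<mu>(1)[OF that] orthonormal_set_norm[OF G(2) that] by simp
    show "inner b (quad A x) \<le>
        (\<Sum>g\<in>G. (inner b (quad A g) - \<mu>) * (cmod (cinner x g))\<^sup>2) + \<mu> * (norm x)\<^sup>2" for x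
    proof -
      let ?q = "x - fproj G x"
      have "inner b (quad A x) = (\<Sum>g\<in>G. (cmod (cinner x g))\<^sup>2 * inner b (quad A g)) + inner b (quad A ?q)"
        by (subst quad_split_eigenvectors[OF G]) (auto simp: inner_add_right inner_sum_right)
      also have "\<dots> \<le> (\<Sum>g\<in>G. (cmod (cinner x g))\<^sup>2 * inner b (quad A g)) + \<mu> * (norm ?q)\<^sup>2"
        by (intro add_left_mono \<mu>(2)) (simp add: fproj_residual[OF G(2,1)])
      also have "(norm ?q)\<^sup>2 = (norm x)\<^sup>2 - (\<Sum>g\<in>G. (cmod (cinner x g))\<^sup>2)"
        using fproj_pythagoras(1)[OF G(2,1), of x] by simp
      finally show ?thesis
        by (simp add: left_diff_distrib right_diff_distrib sum_subtractf sum_distrib_left mult.commute)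
    qed
  qed
  then show "inner b z \<le> inner b (sum (quad A) G) + (real n - real (card G)) * \<mu>"
    by (simp add: X(2,4) inner_sum_right sum_subtractf algebra_simps)
qed

text \<open>Every \<open>b\<close> near \<open>a\<close> attains its maximum over the essential
  range at \<open>d\<close>, so \<open>d\<close> is the only maximiser of \<open>a\<close>, and a
  unique maximiser is extreme.\<close>

lemma extreme_point_of_joint_ess:
  assumes G: "finite G" "orthonormal_set G" and d: "d \<in> ess_points A" and r: "0 < r"
    and le: "\<And>b x. b \<in> ball a r \<Longrightarrow> (\<forall>g\<in>G. cinner x g = 0) \<Longrightarrow> inner b (quad A x) \<le> inner b d * (norm x)\<^sup>2"
  shows "d extreme_point_of joint_ess_num_range A"
proof -
  have s: "inner b s \<le> inner b d" if "b \<in> ball a r" "s \<in> joint_ess_num_range A" for b s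
    using joint_ess_num_range_le[OF G that(2), of b d] le[OF that(1)] by blast
  have a: "a \<in> ball a r" using r by simp
  have eq: "d = s" if "s \<in> joint_ess_num_range A" "inner a d \<le> inner a s" for s
  proof -
    have "d - s = 0"
      by (rule open_ball_functional_eq_0[OF r, of a]) (use s that in \<open>auto simp: inner_diff_right\<close>)
    then show ?thesis by simp
  qed
  have "d \<notin> open_segment x y" if xy: "x \<in> joint_ess_num_range A" "y \<in> joint_ess_num_range A" for x y
  proof
    assume "d \<in> open_segment x y"
    then obtain u where u: "x \<noteq> y" "0 < u" "u < 1" "d = (1 - u) *\<^sub>R x + u *\<^sub>R y"
      unfolding in_segment by blast
    have "inner a d = (1 - u) * inner a x + u * inner a y" by (simp add: u(4) inner_add_right)
    moreover have "(1 - u) * inner a x \<le> (1 - u) * inner a d" "u * inner a y \<le> u * inner a d"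
      using s[OF a xy(1)] s[OF a xy(2)] u by (auto intro: mult_left_mono)
    ultimately have "(1 - u) * inner a d \<le> (1 - u) * inner a x" "u * inner a d \<le> u * inner a y"
      by (auto simp: algebra_simps)
    then have "inner a d \<le> inner a x" "inner a d \<le> inner a y" using u by simp_all
    then show False using eq xy u(1) by metis
  qed
  then show ?thesis using d ess_points_subset unfolding extreme_point_of_def by blast
qed

lemma eigenvectors_plus_essential_in_closure:
  assumes G: "finite G" "orthonormal_set G" "\<And>g. g \<in> G \<Longrightarrow> joint_eigenvector A (v g) g"
    and d: "d \<in> ess_points A" and k: "card G \<le> k"
  shows "sum (quad A) G + real (k - card G) *\<^sub>R d \<in> closure (joint_num_range UNIV k A)"
proof -
  \<comment> \<open>The tagged copies in \<open>HI\<close> are distinct indices for the one repeated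
    point \<open>d\<close>.\<close>
  define GI HI where "GI = (Inl ` G :: ('a + nat) set)" and "HI = (Inr ` {..<k - card G} :: ('a + nat) set)"
  define D where "D = case_sum (quad A) (\<lambda>_::nat. d)"
  have q: "quad A g = v g" if "g \<in> G" for g
    using quad_joint_eigenvector[OF G(3)[OF that]] orthonormal_set_norm[OF G(2) that] by simp
  have disj: "GI \<inter> HI = {}" by (auto simp: GI_def HI_def)
  have fin: "finite GI" "finite HI" using G by (simp_all add: GI_def HI_def)
  have "card (GI \<union> HI) = k"
    using card_Un_disjoint[OF fin disj] k by (simp add: GI_def HI_def card_image)
  then have "sum D (GI \<union> HI) \<in> closure (joint_num_range UNIV k A)"
    using G d fin disj q
    by (intro subset_sum_in_closure[where ?b0.0 = "case_sum (\<lambda>g. g) (\<lambda>_. 0)"])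
      (auto simp: GI_def HI_def D_def orthonormal_set_def)
  also have "sum D (GI \<union> HI) = sum D GI + sum D HI" by (rule sum.union_disjoint[OF fin disj])
  also have "sum D GI = sum (quad A) G" by (simp add: GI_def D_def sum.reindex)
  also have "sum D HI = real (k - card G) *\<^sub>R d" by (simp add: HI_def D_def sum.reindex sum_constant_scaleR del: sum_constant)
  finally show ?thesis .
qed

text \<open>Along a direction \<open>a\<close> in which all the support functions of the first \<open>k\<close> ranges are linear,
  the differences \<open>w (Suc i) - w i\<close> are successive joint eigenvalues until the first one that is an
  essential point, which is then repeated.\<close>

lemma generic_vertex_decomposition:
  assumes r: "0 < r" and w0: "w 0 = 0"
    and top: "\<And>i b z. i \<le> k \<Longrightarrow> b \<in> ball a r \<Longrightarrow> z \<in> closure (convex hull (joint_num_range UNIV i A)) \<Longrightarrow>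
      inner b z \<le> inner b (w i)"
    and mem: "\<And>i. i \<le> k \<Longrightarrow> w i \<in> closure (convex hull (joint_num_range UNIV i A))"
    and B: "orthonormal_set B" "\<And>e. e \<in> B \<Longrightarrow> \<exists>v\<in>U. joint_eigenvector A v e"
    and max: "\<And>x v. v \<in> U \<Longrightarrow> joint_eigenvector A v x \<Longrightarrow> norm x = 1 \<Longrightarrow> \<exists>e\<in>B. cinner x e \<noteq> 0"
    and U: "\<And>i. i < k \<Longrightarrow> w (Suc i) - w i \<notin> ess_points A \<Longrightarrow> w (Suc i) - w i \<in> U"
  shows "\<exists>G\<subseteq>B. finite G \<and> (card G = k \<and> w k = sum (quad A) G \<or>
    card G < k \<and> (\<exists>d. d = w (Suc (card G)) - w (card G) \<and> d \<in> ess_points A \<and>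
      d extreme_point_of joint_ess_num_range A \<and> w k = sum (quad A) G + real (k - card G) *\<^sub>R d))"
    (is "?Done")
proof -
  have a: "a \<in> ball a r" using r by simp
  \<comment> \<open>The last clause of the invariant says that \<open>G\<close> collects top
    spectral values in direction \<open>a\<close>; it provides the ordering that the Ky Fan
    estimates below rely on.\<close>
  have step: "?Done \<or> (\<exists>G\<subseteq>B. finite G \<and> card G = i \<and> sum (quad A) G = w i \<and>
      (\<forall>x. (\<forall>g\<in>G. cinner x g = 0) \<longrightarrow> (\<forall>g\<in>G. inner a (quad A x) \<le> inner a (quad A g) * (norm x)\<^sup>2)))"
    if "i \<le> k" for i
    using that
  proof (induction i)
    case 0
    show ?case by (intro disjI2 exI[of _ "{}"]) (simp add: w0)
  next
    case (Suc i)
    show ?case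
    proof (cases ?Done)
      case False
      then obtain G where G: "G \<subseteq> B" "finite G" "card G = i" "sum (quad A) G = w i" and
        Gle: "\<And>x g. (\<forall>g\<in>G. cinner x g = 0) \<Longrightarrow> g \<in> G \<Longrightarrow> inner a (quad A x) \<le> inner a (quad A g) * (norm x)\<^sup>2"
        using Suc by fastforce
      have oG: "orthonormal_set G" using B(1) G(1) orthonormal_set_subset by blast
      obtain v where v: "\<And>g. g \<in> G \<Longrightarrow> v g \<in> U \<and> joint_eigenvector A (v g) g" using B(2) G(1) by (metis subsetD)
      have ev: "joint_eigenvector A (v g) g" if "g \<in> G" for g using v that by blast
      define d where "d = w (Suc i) - w i"
      have ik: "Suc i \<le> k" using Suc.prems .
      \<comment> \<open>Adjoining to \<open>G\<close> a unit vector orthogonal to it gives a point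
        of the next range, which \<open>top\<close> compares with \<open>w (Suc i)\<close>.\<close>
      have le: "inner b (quad A x) \<le> inner b d * (norm x)\<^sup>2" if b: "b \<in> ball a r" and x: "\<forall>g\<in>G. cinner x g = 0" for b x
      proof (rule quad_homogeneous_le[OF _ x])
        fix u assume u: "norm u = 1" "\<forall>g\<in>G. cinner u g = 0"
        then have "u \<notin> G" using norm_eq_1_iff_cinner[of u] by auto
        have "sum (quad A) (insert u G) \<in> joint_num_range UNIV (Suc i) A"
          using G \<open>u \<notin> G\<close> orthonormal_set_insert[OF oG u(1)] u(2) by (intro joint_num_rangeI) auto
        then have "sum (quad A) (insert u G) \<in> closure (convex hull (joint_num_range UNIV (Suc i) A))"
          using closure_subset hull_subset by (metis subsetD)
        from top[OF ik b this] show "inner b (quad A u) \<le> inner b d"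
          using G \<open>u \<notin> G\<close> by (simp add: d_def inner_add_right inner_diff_right)
      qed
      have sup: "\<exists>x. norm x = 1 \<and> (\<forall>g\<in>G. cinner x g = 0) \<and> inner a d - e < inner a (quad A x)" if e: "0 < e" for e
      proof (rule ccontr)
        assume no: "\<not> ?thesis"
        \<comment> \<open>If the supremum stayed below \<open>inner a d\<close>, Ky Fan with this
          \<mu> would keep the next range strictly below \<open>w (Suc i)\<close>. The values on
          \<open>G\<close> enter the minimum because \<mu> must not exceed them.\<close>
        define \<mu> where "\<mu> = Min (insert (inner a d - e) ((\<lambda>g. inner a (quad A g)) ` G))"
        have \<mu>: "\<mu> \<le> inner a d - e" "\<And>g. g \<in> G \<Longrightarrow> \<mu> \<le> inner a (quad A g)"
          unfolding \<mu>_def using G(2) by auto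
        have "inner a (quad A u) \<le> \<mu>" if "norm u = 1" "\<forall>g\<in>G. cinner u g = 0" for u
          unfolding \<mu>_def using G(2) no that Gle[OF that(2)] by (fastforce simp: not_less)
        then have "inner a (quad A x) \<le> \<mu> * (norm x)\<^sup>2" if "\<forall>g\<in>G. cinner x g = 0" for x
          using quad_homogeneous_le[OF _ that] by blast
        from joint_num_range_le_eigenvectors[OF G(2) oG ev \<mu>(2) this mem[OF ik]]
        have "inner a (w (Suc i)) \<le> inner a (w i) + \<mu>" using G by simp
        then show False using \<mu>(1) e by (simp add: d_def inner_diff_right)
      qed
      show ?thesis
      proof (cases "d \<in> ess_points A")
        case True
        \<comment> \<open>Repeating \<open>d\<close> gives a competitor in the closed k-th range. Ky
          Fan shows that it is at least as good as \<open>w k\<close> in direction \<open>a\<close>,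
          and the ball of directions then identifies the two.\<close>
        define w' where "w' = sum (quad A) G + real (k - card G) *\<^sub>R d"
        have w': "w' \<in> closure (convex hull (joint_num_range UNIV k A))"
          using eigenvectors_plus_essential_in_closure[OF G(2) oG ev True, of k] G(3) ik
            closure_mono[OF hull_subset[of "joint_num_range UNIV k A" convex]] by (auto simp: w'_def)
        have dg: "inner a d \<le> inner a (quad A g)" if g: "g \<in> G" for g
        proof (rule field_le_epsilon)
          fix e :: real assume "0 < e"
          from sup[OF this] obtain x where "norm x = 1" "\<forall>g\<in>G. cinner x g = 0" "inner a d - e < inner a (quad A x)"
            by blast
          then show "inner a d \<le> inner a (quad A g) + e" using Gle[OF _ g, of x] by simp
        qed
        have "inner a (w k) \<le> inner a w'"
          using joint_num_range_le_eigenvectors[OF G(2) oG ev dg le[OF a] mem[of k]] G(3) ik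
          by (simp add: w'_def inner_add_right of_nat_diff)
        then have "w k - w' = 0"
          using top[OF order_refl _ w'] by (intro open_ball_functional_eq_0[OF r, of a]) (auto simp: inner_diff_right)
        moreover have "d extreme_point_of joint_ess_num_range A"
          by (rule extreme_point_of_joint_ess[OF G(2) oG True r le])
        ultimately show ?thesis using G ik True by (intro disjI1 exI[of _ G]) (auto simp: w'_def d_def)
      next
        case False
        then have dU: "d \<in> U" using U[of i] ik by (simp add: d_def)
        obtain Y e where Y0: "finite Y" "0 < e"
          "\<nexists>x. norm x = 1 \<and> (\<forall>y\<in>Y. cinner x y = 0) \<and> norm (quad A x - d) < e"
          using False unfolding ess_points_def by blast
        then have Y: "finite Y" "0 < e" "\<And>x. norm x = 1 \<Longrightarrow> \<forall>y\<in>Y. cinner x y = 0 \<Longrightarrow> e \<le> norm (quad A x - d)"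
          by (auto simp flip: not_less)
        have "\<exists>x. norm x = 1 \<and> (\<forall>g\<in>G. cinner x g = 0) \<and> joint_eigenvector A d x"
        \<comment> \<open>As \<open>d\<close> is not essential, values at unit vectors orthogonal to
          \<open>Y\<close> stay at distance \<open>e\<close> from it;
          \<open>open_ball_functional_bound\<close> converts this distance into the gap
          \<open>r / 2 * e\<close>.\<close>
        proof (rule joint_eigenvector_of_gap[OF G(2) oG ev _ r _ le sup])
          show "finite (Y \<union> G)" using Y G by simp
          show "0 < r / 2 * e" using r Y(2) by simp
          fix x assume x: "\<forall>y\<in>Y \<union> G. cinner x y = 0"
          show "inner a (quad A x) \<le> (inner a d - r / 2 * e) * (norm x)\<^sup>2"
          proof (rule quad_homogeneous_le[OF _ x])
            fix u assume u: "norm u = 1" "\<forall>y\<in>Y \<union> G. cinner u y = 0"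
            have "r / 2 * norm (d - quad A u) \<le> inner a (d - quad A u)"
              using le[of _ u] u by (intro open_ball_functional_bound r) (auto simp: inner_diff_right)
            moreover have "r / 2 * e \<le> r / 2 * norm (d - quad A u)"
              using Y(3)[of u] u r by (intro mult_left_mono) (auto simp: norm_minus_commute)
            ultimately show "inner a (quad A u) \<le> inner a d - r / 2 * e" by (simp add: inner_diff_right)
          qed
        qed
        then obtain x where x: "norm x = 1" "\<forall>g\<in>G. cinner x g = 0" "joint_eigenvector A d x" by blast
        \<comment> \<open>\<open>x\<close> may lie outside \<open>B\<close>, but maximality supplies
          an \<open>f\<close> in \<open>B\<close> not orthogonal to it. Eigenvectors for different
          eigenvalues are orthogonal, so \<open>f\<close> has the eigenvalue \<open>d\<close>; and
          \<open>f\<close> is new because \<open>x\<close> is orthogonal to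
          \<open>G\<close>.\<close>
        obtain f where f: "f \<in> B" "cinner x f \<noteq> 0" using max[OF dU x(3,1)] by blast
        obtain v' where v': "joint_eigenvector A v' f" using B(2) f(1) by blast
        have "v' = d"
        proof -
          have "d $ j * cinner x f = v' $ j * cinner x f" for j
          proof -
            have "cinner (A j x) f = d $ j * cinner x f"
              using x(3) by (simp add: joint_eigenvector_def cinner_scaleC_left)
            moreover have "cinner (A j x) f = v' $ j * cinner x f" using v' by (simp add: joint_eigenvector_def)
            ultimately show ?thesis by metis
          qed
          then show ?thesis using f(2) by (simp add: vec_eq_iff)
        qed
        then have qf: "quad A f = d"
          using quad_joint_eigenvector[OF v'] orthonormal_set_norm[OF B(1) f(1)] by simp
        have fG: "f \<notin> G" using f(2) x(2) by blast
        have "inner a (quad A y) \<le> inner a (quad A g) * (norm y)\<^sup>2"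
          if "\<forall>g\<in>insert f G. cinner y g = 0" "g \<in> insert f G" for y g
          using that le[OF a, of y] Gle[of y g] qf by auto
        then show ?thesis using G f(1) fG qf
          by (intro disjI2 exI[of _ "insert f G"]) (auto simp: d_def)
      qed
    qed blast
  qed
  show ?thesis
  proof (rule ccontr)
    assume no: "\<not> ?thesis"
    then obtain G where "G \<subseteq> B" "finite G" "card G = k" "sum (quad A) G = w k"
      using step[of k] by blast
    then show False using no by metis
  qed
qed

end

text \<open>A vertex of a polytope is exposed, so the directions preferring \<open>v\<close> to all
  other vertices of \<open>V k\<close> form a nonempty open set. Directions in which two vertices of
  some \<open>V i\<close> tie lie in finitely many hyperplanes, a null set. Any other direction has
  a unique maximising vertex in each \<open>V i\<close>, and these persist in a ball around
  it.\<close>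

lemma generic_direction:
  fixes V :: "nat \<Rightarrow> 'v::euclidean_space set"
  assumes V: "\<And>i. i \<le> k \<Longrightarrow> polytope (V i) \<and> V i \<noteq> {}" and v: "v extreme_point_of V k"
  shows "\<exists>a r w. 0 < r \<and> w k = v \<and> (\<forall>i\<le>k. w i extreme_point_of V i \<and>
    (\<forall>b\<in>ball a r. \<forall>z\<in>V i. inner b z \<le> inner b (w i)))"
proof -
  let ?E = "\<lambda>i. {w. w extreme_point_of V i}"
  have fin: "finite (?E i)" and hull: "V i = convex hull (?E i)" if "i \<le> k" for i
    using polytope_hull_extreme V that by blast+
  have ne: "?E i \<noteq> {}" if "i \<le> k" for i using hull[OF that] V[OF that] by (metis convex_hull_empty)
  define O' where "O' = {a. \<forall>u\<in>?E k - {v}. inner a u < inner a v}"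
  have "{v} exposed_face_of V k"
    using v exposed_face_of_polyhedron[OF polytope_imp_polyhedron, of "V k" "{v}"] V[of k]
    by (simp add: face_of_singleton)
  then obtain c \<alpha> where c: "V k \<subseteq> {x. inner c x \<le> \<alpha>}" "{v} = V k \<inter> {x. inner c x = \<alpha>}"
    unfolding exposed_face_of_def by blast
  have "inner c u < inner c v" if u: "u \<in> ?E k - {v}" for u
  proof -
    have "u \<in> V k" using u by (auto simp: extreme_point_of_def)
    then have "inner c u \<le> \<alpha>" "inner c u \<noteq> \<alpha>" using c u by auto
    moreover have "inner c v = \<alpha>" using c by auto
    ultimately show ?thesis by simp
  qed
  then have cO: "c \<in> O'" by (simp add: O'_def)
  have open_dom: "open {a. \<forall>u\<in>S. inner a u < inner a (w::'v)}" if "finite S" for S w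
  proof -
    have "{a. \<forall>u\<in>S. inner a u < inner a w} = (\<Inter>u\<in>S. {a. inner a u < inner a w})" by auto
    moreover have "open {a. inner a u < inner a w}" for u
      by (intro open_Collect_less continuous_intros)
    ultimately show ?thesis using that by auto
  qed
  have "open O'" unfolding O'_def using fin[of k] by (intro open_dom) auto
  define N where "N = (\<Union>i\<in>{..k}. \<Union>x\<in>?E i. \<Union>y\<in>?E i - {x}. {a. inner (x - y) a = 0})"
  have "negligible N" unfolding N_def
    using fin by (intro negligible_Union) (auto intro!: negligible_Union negligible_hyperplane finite_imageI)
  moreover have "\<not> negligible O'" using open_not_negligible[OF \<open>open O'\<close>] cO by blast
  ultimately obtain a where a: "a \<in> O'" "a \<notin> N" using negligible_subset by blast
  have "\<exists>w. w \<in> ?E i \<and> (\<forall>u\<in>?E i - {w}. inner a u < inner a w)" if i: "i \<le> k" for i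
  proof -
    obtain w where w: "w \<in> ?E i" "\<And>u. u \<in> ?E i \<Longrightarrow> inner a u \<le> inner a w"
      using ex_is_arg_min_if_finite[OF fin[OF i] ne[OF i], of "\<lambda>v. - inner a v"]
      unfolding is_arg_min_def by (auto simp: not_less)
    have "inner a u < inner a w" if u: "u \<in> ?E i - {w}" for u
    proof -
      have "inner (w - u) a \<noteq> 0" using a(2) i w(1) u unfolding N_def by blast
      then have "inner a u \<noteq> inner a w" by (simp add: inner_diff_left inner_commute[of a])
      then show ?thesis using w(2)[of u] u by simp
    qed
    then show ?thesis using w(1) by blast
  qed
  then obtain w where w: "\<And>i. i \<le> k \<Longrightarrow> w i \<in> ?E i" "\<And>i u. i \<le> k \<Longrightarrow> u \<in> ?E i - {w i} \<Longrightarrow> inner a u < inner a (w i)"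
    by metis
  have wk: "w k = v"
  proof (rule ccontr)
    assume "w k \<noteq> v"
    then have "inner a (w k) < inner a v" "inner a v < inner a (w k)"
      using a(1) w(1)[of k] w(2)[of k v] v by (auto simp: O'_def)
    then show False by simp
  qed
  define D where "D = (\<Inter>i\<in>{..k}. {b. \<forall>u\<in>?E i - {w i}. inner b u < inner b (w i)})"
  have "open {b. \<forall>u\<in>?E i - {w i}. inner b u < inner b (w i)}" if "i \<le> k" for i
    using fin[OF that] by (intro open_dom) simp
  then have "open D" unfolding D_def by (intro open_INT) auto
  moreover have "a \<in> D" using w(2) by (simp add: D_def)
  ultimately obtain r where r: "0 < r" "ball a r \<subseteq> D" using open_contains_ball by blast
  have "inner b z \<le> inner b (w i)" if i: "i \<le> k" and b: "b \<in> ball a r" and z: "z \<in> V i" for i b z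
  proof -
    have "inner b u \<le> inner b (w i)" if "u \<in> ?E i" for u
    proof -
      have "\<forall>u\<in>?E i - {w i}. inner b u < inner b (w i)" using b r(2) i unfolding D_def by blast
      then show ?thesis using that by (cases "u = w i") (auto intro: less_imp_le)
    qed
    then have "convex hull (?E i) \<subseteq> {z. inner b z \<le> inner b (w i)}"
      by (intro hull_minimal convex_halfspace_le) auto
    then show ?thesis using z hull[OF i] by auto
  qed
  then have "\<forall>i\<le>k. w i extreme_point_of V i \<and> (\<forall>b\<in>ball a r. \<forall>z\<in>V i. inner b z \<le> inner b (w i))"
    using w(1) by simp
  then show ?thesis using r(1) wk by blast
qed

section \<open>Separability and diagonal operators\<close>

text \<open>Combinations over finite subsets of \<open>B\<close> with coefficients from a countable
  dense set of complex numbers are countable in number and dense.\<close>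

lemma separable_closure_span:
  fixes B :: "'a::complex_inner set"
  assumes "countable B"
  shows "separable_space (top_of_set (closure (complex_vector.span B)))"
proof -
  obtain Q :: "complex set" where Q: "countable Q" "\<And>X. open X \<Longrightarrow> X \<noteq> {} \<Longrightarrow> \<exists>d\<in>Q. d \<in> X"
    using countable_dense_setE by blast
  define C where "C = (\<Union>G\<in>{G. G \<subseteq> B \<and> finite G}. (\<lambda>q. \<Sum>g\<in>G. q g *\<^sub>C g) ` (PiE G (\<lambda>_. Q)))"
  have "countable C" unfolding C_def
    using countable_Collect_finite_subset[OF assms] Q(1)
    by (intro countable_UN countable_image countable_PiE) (auto simp: conj_commute)
  moreover have Cs: "C \<subseteq> complex_vector.span B"
    unfolding C_def
    by (auto intro!: complex_vector.span_sum complex_vector.span_scale intro: complex_vector.span_base)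
  moreover have "complex_vector.span B \<subseteq> closure C"
  proof
    fix x assume "x \<in> complex_vector.span B"
    then obtain G u where G: "finite G" "G \<subseteq> B" "x = (\<Sum>g\<in>G. u g *\<^sub>C g)"
      unfolding complex_vector.span_explicit by blast
    show "x \<in> closure C" unfolding closure_approachable
    proof (intro allI impI)
      fix e :: real assume e: "0 < e"
      define \<delta> where "\<delta> = e / ((\<Sum>g\<in>G. norm g) + 1)"
      have s: "0 \<le> (\<Sum>g\<in>G. norm g)" by (intro sum_nonneg) auto
      then have \<delta>: "0 < \<delta>" using e by (simp add: \<delta>_def)
      have "\<exists>d\<in>Q. d \<in> ball (u g) \<delta>" for g using \<delta> by (intro Q(2)) auto
      then obtain q where q: "\<And>g. q g \<in> Q" "\<And>g. cmod (u g - q g) < \<delta>"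
        by (metis dist_norm mem_ball)
      \<comment> \<open>\<open>restrict\<close> puts the coefficients into the extensional function
        space over \<open>G\<close>, which is countable.\<close>
      define y where "y = (\<Sum>g\<in>G. restrict q G g *\<^sub>C g)"
      have "restrict q G \<in> PiE G (\<lambda>_. Q)" using q(1) by auto
      then have "y \<in> C" unfolding C_def y_def using G by blast
      moreover have "dist y x < e"
      proof -
        have "x - y = (\<Sum>g\<in>G. (u g - q g) *\<^sub>C g)"
          by (simp add: G(3) y_def complex_vector.scale_left_diff_distrib sum_subtractf)
        also have "norm \<dots> \<le> (\<Sum>g\<in>G. \<delta> * norm g)"
          using less_imp_le[OF q(2)] by (intro sum_norm_le) (simp add: norm_scaleC mult_right_mono)
        also have "\<dots> = \<delta> * (\<Sum>g\<in>G. norm g)" by (simp add: sum_distrib_left)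
        also have "\<dots> < e" using e s by (simp add: \<delta>_def field_simps)
        finally show ?thesis by (simp add: dist_norm norm_minus_commute)
      qed
      ultimately show "\<exists>y\<in>C. dist y x < e" by blast
    qed
  qed
  then have "closure (complex_vector.span B) \<subseteq> closure C" by (intro closure_minimal) auto
  moreover have "C \<subseteq> closure (complex_vector.span B)" using Cs closure_subset by blast
  ultimately show ?thesis
    unfolding separable_space_def using Cs closure_mono[OF Cs]
    by (intro exI[of _ C]) (auto simp: closure_of_subtopology Int_absorb1)
qed

instance chilbert_space \<subseteq> banach ..

text \<open>The series of the diagonal operator with eigenvalues \<open>s n\<close>. Bessel bounds
  the sums of squared coefficients by \<open>(M * norm x)\<^sup>2\<close>, and orthonormality turns
  their convergence into the Cauchy criterion for vectors.\<close>

lemma orthonormal_series: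
  fixes f :: "nat \<Rightarrow> 'a::chilbert_space"
  assumes f: "\<And>m n. cinner (f m) (f n) = (if m = n then 1 else 0)"
    and s: "\<And>n. cmod (s n) \<le> M"
  shows "summable (\<lambda>n. (s n * cinner x (f n)) *\<^sub>C f n)"
    and "norm (\<Sum>n. (s n * cinner x (f n)) *\<^sub>C f n) \<le> M * norm x"
proof -
  have inj: "inj f" using f by (intro injI) (metis zero_neq_one)
  have on: "orthonormal_set (f ` I)" for I using f inj by (auto simp: orthonormal_set_def inj_eq)
  let ?c = "\<lambda>n. s n * cinner x (f n)"
  have M: "0 \<le> M" using s[of 0] norm_ge_zero order_trans by blast
  have nI: "(norm (\<Sum>n\<in>I. ?c n *\<^sub>C f n))\<^sup>2 = (\<Sum>n\<in>I. (cmod (?c n))\<^sup>2)" if I: "finite I" for I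
  proof -
    have "complex_of_real ((norm (\<Sum>n\<in>I. ?c n *\<^sub>C f n))\<^sup>2) = (\<Sum>n\<in>I. ?c n * cnj (?c n))"
      unfolding cinner_self[symmetric] by (rule orthonormal_family_sum[OF I f])
    also have "\<dots> = complex_of_real (\<Sum>n\<in>I. (cmod (?c n))\<^sup>2)"
      by (simp add: complex_norm_square del: of_real_power)
    finally show ?thesis by (simp only: of_real_eq_iff)
  qed
  have bound: "(\<Sum>n\<in>I. (cmod (?c n))\<^sup>2) \<le> (M * norm x)\<^sup>2" if I: "finite I" for I
  proof -
    have "(\<Sum>n\<in>I. (cmod (?c n))\<^sup>2) \<le> (\<Sum>n\<in>I. M\<^sup>2 * (cmod (cinner x (f n)))\<^sup>2)"
      unfolding norm_mult power_mult_distrib using s by (intro sum_mono mult_right_mono power_mono) auto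
    also have "\<dots> = M\<^sup>2 * (\<Sum>g\<in>f ` I. (cmod (cinner x g))\<^sup>2)"
      using inj by (simp add: sum_distrib_left sum.reindex inj_on_subset)
    also have "\<dots> \<le> M\<^sup>2 * (norm x)\<^sup>2"
      using I by (intro mult_left_mono Bessel_finite on) auto
    finally show ?thesis by (simp add: power_mult_distrib)
  qed
  have sq: "summable (\<lambda>n. (cmod (?c n))\<^sup>2)"
    by (rule summableI_nonneg_bounded[where x = "(M * norm x)\<^sup>2"]) (auto intro: bound)
  show sm: "summable (\<lambda>n. ?c n *\<^sub>C f n)"
    unfolding summable_Cauchy
  proof (intro allI impI)
    fix e :: real assume e: "0 < e"
    then obtain N where N: "\<And>m n. N \<le> m \<Longrightarrow> norm (\<Sum>n\<in>{m..<n}. (cmod (?c n))\<^sup>2) < e\<^sup>2"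
      using sq unfolding summable_Cauchy by (metis zero_less_power)
    have "norm (\<Sum>n\<in>{m..<n}. ?c n *\<^sub>C f n) < e" if "N \<le> m" for m n
    proof -
      have "(norm (\<Sum>n\<in>{m..<n}. ?c n *\<^sub>C f n))\<^sup>2 < e\<^sup>2"
        unfolding nI[OF finite_atLeastLessThan] using N[OF that, of n] by simp
      then show ?thesis using e by (simp add: power2_less_imp_less)
    qed
    then show "\<exists>N. \<forall>m\<ge>N. \<forall>n. norm (\<Sum>n\<in>{m..<n}. ?c n *\<^sub>C f n) < e" by blast
  qed
  have "norm (\<Sum>n<k. ?c n *\<^sub>C f n) \<le> M * norm x" for k
    by (rule power2_le_imp_le) (use nI[of "{..<k}"] bound[of "{..<k}"] M in auto)
  then show "norm (\<Sum>n. ?c n *\<^sub>C f n) \<le> M * norm x"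
    using tendsto_norm[OF summable_LIMSEQ[OF sm]] by (intro LIMSEQ_le_const2) auto
qed

text \<open>Infinite multiplicity is required because an essential point is repeated arbitrarily
  often as k grows. For empty \<open>D\<close>, as happens in finite dimension, the zero space
  does.\<close>

lemma diagonal_tuple_exists:
  fixes D :: "(complex ^ 'm::finite) set"
  assumes D: "countable D" "bounded D"
    and inf: "D \<noteq> {} \<Longrightarrow> \<exists>X :: 'k::chilbert_space set. infinite X \<and> orthonormal_set X"
  shows "\<exists>(K :: 'k set) F S. closed_csubspace K \<and> (\<forall>j. bounded_op_on K (S j)) \<and> is_onb K F \<and>
    diagonal_wrt F S \<and> (\<forall>f\<in>F. quad S f \<in> D) \<and> (\<forall>d\<in>D. infinite {f \<in> F. quad S f = d})"
proof (cases "D = {}")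
  case True
  have "closed_csubspace {0 :: 'k}" by (simp add: closed_csubspace_def)
  then show ?thesis using True
    by (intro exI[of _ "{0}"] exI[of _ "{}"] exI[of _ "\<lambda>_ x. x"])
      (auto simp: bounded_op_on_def is_onb_def diagonal_wrt_def orthonormal_set_def)
next
  case False
  then obtain X :: "'k set" where X: "infinite X" "orthonormal_set X" using inf by blast
  obtain f :: "nat \<Rightarrow> 'k" where fX: "inj f" "range f \<subseteq> X"
    using infinite_countable_subset[OF X(1)] by blast
  have f: "cinner (f m) (f n) = (if m = n then 1 else 0)" for m n
  proof -
    have "f m \<in> X" "f n \<in> X" using fX by auto
    then show ?thesis using X(2) fX(1) by (auto simp: orthonormal_set_def inj_eq)
  qed
  \<comment> \<open>The first coordinate of the decoded pair enumerates \<open>D\<close>; the second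
    makes each value occur infinitely often.\<close>
  define s where "s n = from_nat_into D (fst (prod_decode n))" for n
  have sD: "s n \<in> D" for n unfolding s_def by (rule from_nat_into[OF False])
  obtain M where M: "\<And>d. d \<in> D \<Longrightarrow> norm d \<le> M" using D(2) by (auto simp: bounded_iff)
  have sM: "cmod (s n $ j) \<le> M" for n j
    using M[OF sD[of n]] component_le_norm_cart order_trans Finite_Cartesian_Product.norm_nth_le by blast
  define S where "S j x = (\<Sum>n. (s n $ j * cinner x (f n)) *\<^sub>C f n)" for j x
  define F K where "F = range f" and "K = closure (complex_vector.span F)"
  have sm1: "summable (\<lambda>n. (s n $ j * cinner x (f n)) *\<^sub>C f n)" for j x
    by (rule orthonormal_series(1)[OF f sM])
  have sm2: "norm (S j x) \<le> M * norm x" for j x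
    unfolding S_def by (rule orthonormal_series(2)[OF f sM])
  have clK: "closed_csubspace K" unfolding K_def by (rule closed_csubspace_closure_span)
  have FK: "F \<subseteq> K" unfolding K_def by (rule subset_closure_span)
  have SK: "S j x \<in> K" for j x
  proof -
    have "(\<Sum>n<k. (s n $ j * cinner x (f n)) *\<^sub>C f n) \<in> complex_vector.span F" for k
      by (intro complex_vector.span_sum complex_vector.span_scale complex_vector.span_base) (auto simp: F_def)
    then show ?thesis unfolding K_def S_def closure_sequential using summable_LIMSEQ[OF sm1[of j x]]
      by (intro exI conjI allI) assumption+
  qed
  have "bounded_op_on K (S j)" for j
    unfolding bounded_op_on_def
  proof (intro conjI ballI allI exI[of _ M])
    show "S j (x + y) = S j x + S j y" for x y
      unfolding S_def suminf_add[OF sm1 sm1]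
      by (simp add: cinner_add_left distrib_left scaleC_add_left)
    show "S j (c *\<^sub>C x) = c *\<^sub>C S j x" for c x
      unfolding S_def bounded_linear.suminf[OF bounded_bilinear.bounded_linear_right[OF bounded_bilinear_scaleC] sm1]
      by (simp add: cinner_scaleC_left scaleC_scaleC mult_ac)
    show "norm (S j x) \<le> M * norm x" for x by (rule sm2)
  qed (rule SK)
  moreover have Sf: "S j (f m) = (s m $ j) *\<^sub>C f m" for j m
  proof -
    have "S j (f m) = (\<Sum>n. if n = m then (s m $ j) *\<^sub>C f m else 0)"
      unfolding S_def by (intro suminf_cong) (auto simp: f)
    also have "\<dots> = (s m $ j) *\<^sub>C f m"
      using suminf_finite[of "{m}" "\<lambda>n. if n = m then (s m $ j) *\<^sub>C f m else 0"] by simp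
    finally show ?thesis .
  qed
  moreover have q: "quad S (f m) = s m" for m
    by (simp add: quad_def vec_eq_iff Sf cinner_scaleC_left f)
  moreover have "infinite {g \<in> F. quad S g = d}" if d: "d \<in> D" for d
  proof -
    obtain i where i: "from_nat_into D i = d" using from_nat_into_surj[OF D(1) d] by blast
    have "range (\<lambda>l. f (prod_encode (i, l))) \<subseteq> {g \<in> F. quad S g = d}"
      using i by (auto simp: F_def q s_def)
    moreover have "inj (\<lambda>l. f (prod_encode (i, l)))"
      using fX(1) by (intro injI) (simp add: inj_eq prod_encode_eq)
    ultimately show ?thesis using finite_subset range_inj_infinite by metis
  qed
  moreover have "is_onb K F"
    using X(2) fX(2) orthonormal_set_subset FK by (auto simp: is_onb_def F_def K_def)
  moreover have "diagonal_wrt F S" unfolding diagonal_wrt_def F_def using Sf by blast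
  moreover have "\<forall>g\<in>F. quad S g \<in> D" unfolding F_def using q sD by simp
  ultimately show ?thesis using clK by blast
qed

section \<open>Essential points and eigenvectors of the tuple\<close>

context op_tuple
begin

text \<open>Ensures that the operators of the auxiliary summand are bounded.\<close>

lemma bounded_ess_points: "bounded (ess_points A)"
proof -
  have "\<forall>j. \<exists>M. \<forall>x. norm (A j x) \<le> norm x * M"
    using bounded_linear.bounded[OF bounded_opD(5)[OF bounded]] by blast
  then obtain M where M: "\<And>j x. norm (A j x) \<le> norm x * M j" by metis
  have "norm z \<le> sum M UNIV + 1" if z: "z \<in> ess_points A" for z
  proof -
    from ess_pointsE[OF z finite.emptyI zero_less_one] obtain x where
      x: "norm x = 1" "norm (quad A x - z) < 1" by blast
    have "norm (quad A x) \<le> (\<Sum>j\<in>UNIV. M j)"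
    proof (intro order_trans[OF norm_vec_le_sum] sum_mono)
      fix j
      show "cmod (quad A x $ j) \<le> M j"
        using cmod_cinner_le[of "A j x" x] M[of j x] x(1) by (simp add: quad_def)
    qed
    moreover have "norm z \<le> norm (quad A x) + norm (quad A x - z)"
      using norm_triangle_ineq4[of "quad A x" "quad A x - z"] by simp
    ultimately show ?thesis using x(2) by simp
  qed
  then show ?thesis unfolding bounded_iff by blast
qed

text \<open>An essential point requires unit vectors orthogonal to any finite set, which a finite
  orthonormal basis excludes. So the space is infinite-dimensional, and the comparison of
  \<open>hdim\<close> transfers this to the auxiliary space.\<close>

lemma infinite_orthonormal_of_ess_points:
  assumes "ess_points A \<noteq> {}" "hdim (UNIV :: 'a set) \<le> hdim (UNIV :: 'k::chilbert_space set)"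
  shows "\<exists>X :: 'k set. infinite X \<and> orthonormal_set X"
proof -
  obtain B where B: "is_onb (UNIV::'a set) B" "hdim (UNIV::'a set) = (if finite B then enat (card B) else \<infinity>)"
    by (rule hdim_UNIV_onb)
  have "infinite B"
  proof
    assume fin: "finite B"
    obtain z where "z \<in> ess_points A" using assms(1) by blast
    from ess_pointsE[OF this fin zero_less_one] obtain x where
      x: "norm x = 1" "\<And>y. y \<in> B \<Longrightarrow> cinner x y = 0" by blast
    have "B \<subseteq> ocomp {x}" using x(2) by (auto simp: ocomp_def cinner_eq_0_commute[of x])
    then have "closure (complex_vector.span B) \<subseteq> ocomp {x}"
      by (rule closure_span_minimal[OF closed_csubspace_ocomp])
    then have "cinner x x = 0" using B(1) by (auto simp: is_onb_def ocomp_def)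
    then show False using x(1) by (simp add: cinner_self)
  qed
  then have "hdim (UNIV :: 'k set) = \<infinity>" using B(2) assms(2) by simp
  then show ?thesis by (metis hdim_UNIV_onb is_onb_def enat.distinct(2))
qed

text \<open>Zorn's lemma with the admissible eigenvalues \<open>U\<close> fixed in advance, so that
  \<open>B\<close> depends neither on a vertex nor on k.\<close>

lemma maximal_eigenvector_set:
  "\<exists>B. orthonormal_set B \<and> (\<forall>e\<in>B. \<exists>v\<in>U. joint_eigenvector A v e) \<and>
    (\<forall>v\<in>U. \<forall>x. joint_eigenvector A v x \<longrightarrow> norm x = 1 \<longrightarrow> (\<exists>e\<in>B. cinner x e \<noteq> 0))"
proof -
  let ?C = "{B. orthonormal_set B \<and> (\<forall>e\<in>B. \<exists>v\<in>U. joint_eigenvector A v e)}"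
  have "\<exists>B\<in>?C. \<forall>X\<in>?C. B \<subseteq> X \<longrightarrow> X = B"
  proof (rule subset_Zorn')
    fix \<C> assume \<C>: "subset.chain ?C \<C>"
    have "orthonormal_set (\<Union> \<C>)"
    proof (clarsimp simp: orthonormal_set_def)
      fix X Y x y assume X: "X \<in> \<C>" "x \<in> X" and Y: "Y \<in> \<C>" "y \<in> Y"
      obtain Z where "Z \<in> \<C>" "x \<in> Z" "y \<in> Z"
        using \<C> X Y unfolding subset_chain_def by (metis in_mono)
      moreover from this have "orthonormal_set Z" using \<C> by (auto simp: subset_chain_def)
      ultimately show "(x = y \<longrightarrow> cinner y y = 1) \<and> (x \<noteq> y \<longrightarrow> cinner x y = 0)"
        by (auto simp: orthonormal_set_def)
    qed
    then show "\<Union> \<C> \<in> ?C" using \<C> by (auto simp: subset_chain_def)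
  qed
  then obtain B where B: "B \<in> ?C" "\<forall>X\<in>?C. B \<subseteq> X \<longrightarrow> X = B" by (elim bexE)
  have "\<exists>e\<in>B. cinner x e \<noteq> 0" if "v \<in> U" "joint_eigenvector A v x" "norm x = 1" for v x
  proof (rule ccontr)
    assume *: "\<not> ?thesis"
    then have "orthonormal_set (insert x B)" using B(1) that(3) by (intro orthonormal_set_insert) auto
    then have "insert x B \<in> ?C" using B(1) that by auto
    then have "insert x B = B" using B(2) by blast
    then have "cinner x x = 0" using * by blast
    then show False using that(3) by (simp add: cinner_self)
  qed
  moreover have "orthonormal_set B" "\<forall>e\<in>B. \<exists>v\<in>U. joint_eigenvector A v e" using B(1) by auto
  ultimately show ?thesis by (intro exI[of _ B]) blast
qed

text \<open>Among more than \<open>card Y\<close> eigenvectors some unit combination is orthogonal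
  to \<open>Y\<close>, and its value is still \<open>v\<close>; so infinite multiplicity would make
  \<open>v\<close> essential. With countably many eigenvalues this makes \<open>B\<close> countable
  and its closed span separable.\<close>

lemma finite_eigenvector_set:
  assumes C: "orthonormal_set C" "\<And>e. e \<in> C \<Longrightarrow> joint_eigenvector A v e" and v: "v \<notin> ess_points A"
  shows "finite C"
proof (rule ccontr)
  assume inf: "infinite C"
  have "\<exists>x. norm x = 1 \<and> (\<forall>y\<in>Y. cinner x y = 0) \<and> norm (quad A x - v) < e" if Y: "finite Y" "0 < e" for Y e
  proof -
    obtain C' where C': "C' \<subseteq> C" "finite C'" "card C' = Suc (card Y)"
      using infinite_arbitrarily_large[OF inf] by blast
    obtain x where x: "x \<in> complex_vector.span C'" "norm x = 1" "\<forall>y\<in>Y. cinner x y = 0"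
      using exists_unit_orthogonal[OF C'(2) orthonormal_set_subset[OF C(1) C'(1)] Y(1)] C'(3) by auto
    have "A j x = (v $ j) *\<^sub>C x" for j
    proof -
      have "complex_vector.subspace {x. A j x = (v $ j) *\<^sub>C x}"
        by (auto simp: complex_vector.subspace_def bounded_opD[OF bounded] scaleC_add_right scaleC_scaleC mult.commute)
      moreover have "C' \<subseteq> {x. A j x = (v $ j) *\<^sub>C x}" using C(2) C'(1) by (auto simp: joint_eigenvector_def)
      ultimately show ?thesis using complex_vector.span_minimal x(1) by blast
    qed
    then have "quad A x = v"
      using x(2) by (simp add: quad_def vec_eq_iff cinner_scaleC_left norm_eq_1_iff_cinner)
    then show ?thesis using x Y(2) by auto
  qed
  then show False using v unfolding ess_points_def by blast
qed

text \<open>Invariance of the span comes from the eigenvector equation, that of its complement from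
  the adjoint clause of \<open>joint_eigenvector\<close>.\<close>

lemma reducing_eigenvector_span:
  assumes "\<forall>e\<in>B. \<exists>v. joint_eigenvector A v e"
  shows "reducing A (closure (complex_vector.span B))"
  unfolding reducing_def
proof (intro conjI allI)
  let ?L = "closure (complex_vector.span B)"
  show L: "closed_csubspace ?L" by (rule closed_csubspace_closure_span)
  have sL: "complex_vector.subspace ?L" using L by (simp add: closed_csubspace_def)
  fix j
  have cont: "continuous_on UNIV (A j)" using linear_continuous_on[OF bounded_opD(5)[OF bounded]] .
  have "closed (A j -` ?L)" using cont by (simp add: closed_vimage continuous_on_eq_continuous_at)
  moreover have "complex_vector.subspace (A j -` ?L)"
    using csubspaceD[OF sL] by (auto simp: complex_vector.subspace_def bounded_opD[OF bounded])
  moreover have "B \<subseteq> A j -` ?L"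
  proof
    fix e assume e: "e \<in> B"
    then obtain v where "joint_eigenvector A v e" using assms by blast
    then show "e \<in> A j -` ?L" using subset_closure_span[of B] e csubspaceD(4)[OF sL]
      by (auto simp: joint_eigenvector_def)
  qed
  ultimately have "?L \<subseteq> A j -` ?L" by (intro closure_span_minimal) (auto simp: closed_csubspace_def)
  then show "A j ` ?L \<subseteq> ?L" by auto
  show "A j ` ocomp ?L \<subseteq> ocomp ?L"
  proof clarify
    fix y assume y: "y \<in> ocomp ?L"
    have "B \<subseteq> ocomp {A j y}"
    proof
      fix e assume e: "e \<in> B"
      then obtain v where "joint_eigenvector A v e" using assms by blast
      then have "cinner (A j y) e = v $ j * cinner y e" by (simp add: joint_eigenvector_def)
      also have "cinner y e = 0" using y e subset_closure_span[of B] by (auto simp: ocomp_def)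
      finally show "e \<in> ocomp {A j y}" by (simp add: ocomp_def cinner_eq_0_commute[of e])
    qed
    then have "?L \<subseteq> ocomp {A j y}" by (rule closure_span_minimal[OF closed_csubspace_ocomp])
    then show "A j y \<in> ocomp ?L" by (auto simp: ocomp_def cinner_eq_0_commute[of "A j y"])
  qed
qed

end

section \<open>Direct sums of subspaces, bases and operators\<close>

lemma cproj_eq:
  assumes "closed_csubspace L" "y \<in> L"
  shows "cproj L y = (y::'a::complex_inner)"
  unfolding cproj_def
proof (rule the_equality)
  show "y \<in> L \<and> y - y \<in> ocomp L" using assms(2) by (simp add: ocomp_def)
  fix z assume z: "z \<in> L \<and> y - z \<in> ocomp L"
  then have "y - z \<in> L" using assms csubspaceD(3) by (auto simp: closed_csubspace_def)
  then have "cinner (y - z) (y - z) = 0" using z by (auto simp: ocomp_def)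
  then show "z = y" by (simp add: cinner_self)
qed

lemma closed_csubspace_Times:
  assumes "closed_csubspace L" "closed_csubspace K"
  shows "closed_csubspace (L \<times> K)"
proof -
  have s: "complex_vector.subspace L" "complex_vector.subspace K" "closed L" "closed K"
    using assms by (simp_all add: closed_csubspace_def)
  have "complex_vector.subspace (L \<times> K)"
    unfolding complex_vector.subspace_def
  proof (intro conjI ballI allI)
    show "0 \<in> L \<times> K" using csubspaceD(1)[OF s(1)] csubspaceD(1)[OF s(2)] by (simp add: zero_prod_def)
    show "p + q \<in> L \<times> K" if "p \<in> L \<times> K" "q \<in> L \<times> K" for p q
      using that csubspaceD(2)[OF s(1)] csubspaceD(2)[OF s(2)] by (auto simp: mem_Times_iff)
    show "c *\<^sub>C p \<in> L \<times> K" if "p \<in> L \<times> K" for c p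
      using that csubspaceD(4)[OF s(1)] csubspaceD(4)[OF s(2)] by (auto simp: mem_Times_iff scaleC_prod_def)
  qed
  then show ?thesis using closed_Times[OF s(3,4)] by (simp add: closed_csubspace_def)
qed

lemma is_onb_Times:
  assumes L: "closed_csubspace L" "is_onb L B" and K: "closed_csubspace K" "is_onb K F"
  shows "is_onb (L \<times> K) ((\<lambda>e. (e, 0)) ` B \<union> (\<lambda>f. (0, f)) ` F)" (is "is_onb _ ?E")
proof -
  have sL: "complex_vector.subspace L" and sK: "complex_vector.subspace K"
    using L K by (auto simp: closed_csubspace_def)
  have E: "?E \<subseteq> L \<times> K"
    using L(2) K(2) csubspaceD(1)[OF sL] csubspaceD(1)[OF sK] by (auto simp: is_onb_def)
  have o: "cinner e e' = (if e = e' then 1 else 0)" if "e \<in> B" "e' \<in> B" for e e'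
    using L(2) that unfolding is_onb_def orthonormal_set_def by blast
  have o': "cinner e e' = (if e = e' then 1 else 0)" if "e \<in> F" "e' \<in> F" for e e'
    using K(2) that unfolding is_onb_def orthonormal_set_def by blast
  have n0: "0 \<notin> B" "0 \<notin> F" using o[of 0 0] o'[of 0 0] by auto
  have "orthonormal_set ?E"
    unfolding orthonormal_set_def
  proof (intro ballI)
    fix p q assume "p \<in> ?E" "q \<in> ?E"
    then show "cinner p q = (if p = q then 1 else 0)"
      using n0 by (elim UnE imageE) (auto simp: cinner_prod_def o o')
  qed
  moreover have "closure (complex_vector.span ?E) = L \<times> K"
  proof
    let ?M = "closure (complex_vector.span ?E)"
    show "?M \<subseteq> L \<times> K" by (rule closure_span_minimal[OF closed_csubspace_Times[OF L(1) K(1)] E])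
    have M: "closed ?M" "complex_vector.subspace ?M"
      using closed_csubspace_closure_span[of ?E] by (auto simp: closed_csubspace_def)
    have 1: "L \<subseteq> (\<lambda>x. (x, 0)) -` ?M"
    proof -
      have "closed ((\<lambda>x. (x, 0)) -` ?M)"
        by (intro closed_vimage M continuous_intros)
      moreover have "complex_vector.subspace ((\<lambda>x. (x, 0)) -` ?M)"
        unfolding complex_vector.subspace_def
      proof (intro conjI ballI allI; clarsimp)
        show "(0, 0) \<in> ?M" using csubspaceD(1)[OF M(2)] by (simp add: zero_prod_def)
        show "(x + y, 0) \<in> ?M" if "(x, 0) \<in> ?M" "(y, 0) \<in> ?M" for x y
          using csubspaceD(2)[OF M(2) that] by simp
        show "(c *\<^sub>C x, 0) \<in> ?M" if "(x, 0) \<in> ?M" for c x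
          using csubspaceD(4)[OF M(2) that, of c] by (simp add: scaleC_prod_def)
      qed
      moreover have "B \<subseteq> (\<lambda>x. (x, 0)) -` ?M" using subset_closure_span[of ?E] by auto
      ultimately have "closure (complex_vector.span B) \<subseteq> (\<lambda>x. (x, 0)) -` ?M"
        by (intro closure_span_minimal) (auto simp: closed_csubspace_def)
      then show ?thesis using L(2) by (simp add: is_onb_def)
    qed
    have 2: "K \<subseteq> (\<lambda>x. (0, x)) -` ?M"
    proof -
      have "closed ((\<lambda>x. (0, x)) -` ?M)"
        by (intro closed_vimage M continuous_intros)
      moreover have "complex_vector.subspace ((\<lambda>x. (0, x)) -` ?M)"
        unfolding complex_vector.subspace_def
      proof (intro conjI ballI allI; clarsimp)
        show "(0, 0) \<in> ?M" using csubspaceD(1)[OF M(2)] by (simp add: zero_prod_def)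
        show "(0, x + y) \<in> ?M" if "(0, x) \<in> ?M" "(0, y) \<in> ?M" for x y
          using csubspaceD(2)[OF M(2) that] by simp
        show "(0, c *\<^sub>C x) \<in> ?M" if "(0, x) \<in> ?M" for c x
          using csubspaceD(4)[OF M(2) that, of c] by (simp add: scaleC_prod_def)
      qed
      moreover have "F \<subseteq> (\<lambda>x. (0, x)) -` ?M" using subset_closure_span[of ?E] by auto
      ultimately have "closure (complex_vector.span F) \<subseteq> (\<lambda>x. (0, x)) -` ?M"
        by (intro closure_span_minimal) (auto simp: closed_csubspace_def)
      then show ?thesis using K(2) by (simp add: is_onb_def)
    qed
    show "L \<times> K \<subseteq> ?M"
    proof clarify
      fix x y assume "x \<in> L" "y \<in> K"
      then have "(x, 0) + (0, y) \<in> ?M" using 1 2 by (intro csubspaceD(2)[OF M(2)]) auto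
      then show "(x, y) \<in> ?M" by simp
    qed
  qed
  ultimately show ?thesis using E by (simp add: is_onb_def)
qed

lemma bounded_op_on_direct_sum:
  assumes L: "closed_csubspace L" and K: "closed_csubspace K"
    and R: "bounded_op_on L (R j)" and S: "bounded_op_on K (S j)"
  shows "bounded_op_on (L \<times> K) (direct_sum R S j)"
proof -
  obtain M where M: "\<forall>x\<in>L. norm (R j x) \<le> M * norm x" using R by (auto simp: bounded_op_on_def)
  obtain N where N: "\<forall>x\<in>K. norm (S j x) \<le> N * norm x" using S by (auto simp: bounded_op_on_def)
  have "norm (direct_sum R S j p) \<le> (\<bar>M\<bar> + \<bar>N\<bar>) * norm p" if p: "p \<in> L \<times> K" for p
  proof -
    obtain x y where xy: "p = (x, y)" "x \<in> L" "y \<in> K" using p by blast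
    have "norm x \<le> norm p" "norm y \<le> norm p" using norm_fst_le[of x y] norm_snd_le[of y x] xy by auto
    then have "M * norm x \<le> \<bar>M\<bar> * norm p" "N * norm y \<le> \<bar>N\<bar> * norm p"
      by (auto intro!: mult_mono)
    then have "norm (R j x) \<le> \<bar>M\<bar> * norm p" "norm (S j y) \<le> \<bar>N\<bar> * norm p"
      using M N xy by (meson order_trans)+
    moreover have "norm (R j x, S j y) \<le> norm (R j x) + norm (S j y)" by (rule norm_Pair_le)
    ultimately show ?thesis by (simp add: xy direct_sum_def distrib_right)
  qed
  then show ?thesis using R S
    by (auto simp: bounded_op_on_def direct_sum_def scaleC_prod_def)
qed

section \<open>The equivalence\<close>

context op_tuple
begin

lemma compression_eigenvector_span:
  assumes "\<forall>e\<in>B. \<exists>v. joint_eigenvector A v e" and x: "x \<in> closure (complex_vector.span B)"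
  shows "compression (closure (complex_vector.span B)) A j x = A j x"
proof -
  have "A j x \<in> closure (complex_vector.span B)"
    using reducing_eigenvector_span[OF assms(1)] x by (auto simp: reducing_def)
  then show ?thesis
    unfolding compression_def by (rule cproj_eq[OF closed_csubspace_closure_span])
qed

lemma bounded_op_on_compression:
  assumes "\<forall>e\<in>B. \<exists>v. joint_eigenvector A v e"
  shows "bounded_op_on (closure (complex_vector.span B)) (compression (closure (complex_vector.span B)) A j)"
proof -
  let ?L = "closure (complex_vector.span B)"
  have L: "complex_vector.subspace ?L" using closed_csubspace_closure_span by (auto simp: closed_csubspace_def)
  note c = compression_eigenvector_span[OF assms, where j = j]
  obtain M where M: "\<And>x. norm (A j x) \<le> M * norm x" using bounded[of j] by (auto simp: bounded_op_on_def)
  show ?thesis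
    unfolding bounded_op_on_def
  proof (intro conjI ballI allI exI[of _ M])
    show "compression ?L A j x \<in> ?L" if "x \<in> ?L" for x
      using reducing_eigenvector_span[OF assms] that c[OF that] by (auto simp: reducing_def)
    show "compression ?L A j (x + y) = compression ?L A j x + compression ?L A j y" if "x \<in> ?L" "y \<in> ?L" for x y
      using c that csubspaceD(2)[OF L that] by (simp add: bounded_opD(1)[OF bounded])
    show "compression ?L A j (b *\<^sub>C x) = b *\<^sub>C compression ?L A j x" if "x \<in> ?L" for b x
      using c that csubspaceD(4)[OF L that] by (simp add: bounded_opD(2)[OF bounded])
    show "norm (compression ?L A j x) \<le> M * norm x" if "x \<in> ?L" for x
      using M c that by simp
  qed
qed

lemma direct_sum_diagonal:
  fixes S :: "'m \<Rightarrow> 'k::chilbert_space \<Rightarrow> 'k"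
  assumes B: "\<forall>e\<in>B. \<exists>v. joint_eigenvector A v e"
    and S: "\<And>j. bounded_op_on K (S j)" "diagonal_wrt F S" "closed_csubspace K"
    and L: "L = closure (complex_vector.span B)"
  defines "D \<equiv> direct_sum (compression L A) S"
  shows "\<And>j. bounded_op_on (L \<times> K) (D j)"
    and "diagonal_wrt ((\<lambda>e. (e, 0)) ` B \<union> (\<lambda>f. (0, f)) ` F) D"
    and "\<And>e. e \<in> B \<Longrightarrow> quad D (e, 0) = quad A e"
    and "\<And>f. quad D (0, f) = quad S f"
proof -
  have clL: "closed_csubspace L" unfolding L by (rule closed_csubspace_closure_span)
  note sL = csubspaceD[OF conjunct1[OF clL[unfolded closed_csubspace_def]]]
  note sK = csubspaceD[OF conjunct1[OF S(3)[unfolded closed_csubspace_def]]]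
  have c: "compression L A j x = A j x" if "x \<in> L" for j x
    unfolding L by (rule compression_eigenvector_span[OF B]) (use that L in auto)
  have c0: "compression L A j 0 = 0" for j using c[OF sL(1)] by (simp add: bounded_opD(3)[OF bounded])
  have S0: "S j 0 = 0" for j
  proof -
    have "S j (0 + 0) = S j 0 + S j 0" using S(1)[of j] sK(1) unfolding bounded_op_on_def by blast
    then show ?thesis by simp
  qed
  have BL: "B \<subseteq> L" unfolding L by (rule subset_closure_span)
  have Dl: "D j (e, 0) = (A j e, 0)" if "e \<in> B" for j e
    using c[of e] BL that by (auto simp: D_def direct_sum_def S0)
  have Dr: "D j (0, f) = (0, S j f)" for j f by (simp add: D_def direct_sum_def c0)
  show "bounded_op_on (L \<times> K) (D j)" for j
    unfolding D_def using bounded_op_on_compression[OF B] S clL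
    by (intro bounded_op_on_direct_sum) (simp_all add: L)
  show "diagonal_wrt ((\<lambda>e. (e, 0)) ` B \<union> (\<lambda>f. (0, f)) ` F) D"
    unfolding diagonal_wrt_def
  proof (intro allI ballI)
    fix j p assume "p \<in> (\<lambda>e. (e, 0)) ` B \<union> (\<lambda>f. (0, f)) ` F"
    then consider e where "e \<in> B" "p = (e, 0)" | f where "f \<in> F" "p = (0, f)" by blast
    then show "\<exists>c. D j p = c *\<^sub>C p"
    proof cases
      case 1
      then obtain v where "joint_eigenvector A v e" using B by blast
      then show ?thesis using 1 Dl[of e j] by (intro exI[of _ "v $ j"]) (simp add: joint_eigenvector_def scaleC_prod_def)
    next
      case 2
      then obtain b where "S j f = b *\<^sub>C f" using S(2) unfolding diagonal_wrt_def by blast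
      then show ?thesis using 2 Dr[of j f] by (intro exI[of _ b]) (simp add: scaleC_prod_def)
    qed
  qed
  show "quad D (e, 0) = quad A e" if "e \<in> B" for e
    using Dl[OF that] by (simp add: quad_def cinner_prod_def)
  show "quad D (0, f) = quad S f" for f
    using Dr by (simp add: quad_def cinner_prod_def)
qed

text \<open>The same polytope is realised twice: by exact vectors in the diagonal model and by
  approximating ones in the original space. Both work with weights instead of hulls, which gives
  \<open>P\<close> for the closure of the range itself although the range is not known to be
  convex.\<close>

lemma diagonal_direct_sum_range:
  fixes S :: "'m \<Rightarrow> 'k::chilbert_space \<Rightarrow> 'k"
  assumes B: "orthonormal_set B" "\<forall>e\<in>B. \<exists>v. joint_eigenvector A v e"
    and K: "closed_csubspace K" "is_onb K F" and S: "\<And>j. bounded_op_on K (S j)" "diagonal_wrt F S"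
    and ess: "\<forall>f\<in>F. quad S f \<in> ess_points A"
    and k: "0 < k" and P: "polytope P" "P \<noteq> {}" "P = closure (convex hull (joint_num_range UNIV k A))"
    and ext: "\<forall>w. w extreme_point_of P \<longrightarrow> (\<exists>G\<subseteq>B. \<exists>H\<subseteq>F. finite G \<and> finite H \<and>
      card G + card H = k \<and> w = sum (quad A) G + sum (quad S) H)"
    and L: "L = closure (complex_vector.span B)"
  defines "D \<equiv> direct_sum (compression L A) S" and "E \<equiv> (\<lambda>e. (e, 0)) ` B \<union> (\<lambda>f. (0, f)) ` F"
  shows "is_onb (L \<times> K) E \<and> diagonal_wrt E D \<and>
    closure (joint_num_range UNIV k A) = joint_num_range (L \<times> K) k D \<and> joint_num_range (L \<times> K) k D = P"
proof -
  note D = direct_sum_diagonal[OF B(2) S K(1) L, folded D_def]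
  have LK: "closed_csubspace L" "is_onb L B"
    unfolding L using closed_csubspace_closure_span B(1) subset_closure_span by (auto simp: is_onb_def)
  have clLK: "closed_csubspace (L \<times> K)" by (rule closed_csubspace_Times[OF LK(1) K(1)])
  have onb: "is_onb (L \<times> K) E" unfolding E_def by (rule is_onb_Times[OF LK K])
  have diag: "diagonal_wrt E D" unfolding E_def by (rule D(2))
  have nz: "0 \<notin> B" "0 \<notin> F"
    using orthonormal_set_norm[of B 0] orthonormal_set_norm[of F 0] B(1) K(2) by (auto simp: is_onb_def)
  \<comment> \<open>Entries from \<open>B\<close> belong to true eigenvectors in the original space
    and those from \<open>F\<close> are essential points, the two kinds combined by
    \<open>weighted_sum_in_closure\<close>.\<close>
  have cover: "(\<Sum>g\<in>N. t g *\<^sub>R quad D g) \<in> closure (joint_num_range UNIV k A)"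
    if N: "finite N" "N \<subseteq> E" and t: "\<And>g. g \<in> N \<Longrightarrow> 0 \<le> t g \<and> t g \<le> 1" "sum t N = real k" for N t
  proof -
    define N1 N2 where "N1 = N \<inter> (\<lambda>e. (e, 0)) ` B" and "N2 = N \<inter> (\<lambda>f. (0, f)) ` F"
    have NN: "N = N1 \<union> N2" "N1 \<inter> N2 = {}" using N(2) nz by (auto simp: N1_def N2_def E_def)
    have fin: "finite N1" "finite N2" using N(1) by (auto simp: N1_def N2_def)
    have "\<forall>g\<in>N1. \<forall>h\<in>N1. cinner (fst g) (fst h) = (if g = h then 1 else 0)"
    proof (intro ballI)
      fix g h assume "g \<in> N1" "h \<in> N1"
      then obtain e e' where e: "e \<in> B" "e' \<in> B" "g = (e, 0)" "h = (e', 0)" unfolding N1_def by blast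
      then have "cinner e e' = (if e = e' then 1 else 0)" using B(1) unfolding orthonormal_set_def by blast
      then show "cinner (fst g) (fst h) = (if g = h then 1 else 0)" by (simp add: e)
    qed
    moreover have "\<forall>g\<in>N1. joint_eigenvector A (quad D g) (fst g)"
    proof
      fix g assume "g \<in> N1"
      then obtain e where e: "e \<in> B" "g = (e, 0)" by (auto simp: N1_def)
      obtain v where v: "joint_eigenvector A v e" using B(2) e(1) by blast
      then have "quad A e = v" using quad_joint_eigenvector[OF v] orthonormal_set_norm[OF B(1) e(1)] by simp
      then show "joint_eigenvector A (quad D g) (fst g)" using v e D(3) by simp
    qed
    moreover have "\<forall>h\<in>N2. quad D h \<in> ess_points A" using ess D(4) by (auto simp: N2_def)
    ultimately show ?thesis
      using weighted_sum_in_closure[OF fin(2,1) NN(2), of fst "quad D" t k] t unfolding NN(1)[symmetric] by blast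
  qed
  have hullP: "closure (joint_num_range UNIV k A) \<subseteq> P"
    unfolding P(3) by (intro closure_mono hull_subset)
  have sub: "sum (quad D) N \<in> P" if "N \<subseteq> E" "finite N" "card N = k" for N
    using cover[OF that(2,1), of "\<lambda>_. 1"] that(3) hullP by auto
  have extE: "\<exists>N\<subseteq>E. finite N \<and> card N = k \<and> w = sum (quad D) N" if w: "w extreme_point_of P" for w
  proof -
    obtain G H where GH: "G \<subseteq> B" "H \<subseteq> F" "finite G" "finite H" "card G + card H = k"
      "w = sum (quad A) G + sum (quad S) H" using ext w by blast
    let ?G = "(\<lambda>e. (e, 0::'k)) ` G" and ?H = "(\<lambda>f. (0::'a, f)) ` H"
    have disj: "?G \<inter> ?H = {}" using GH(1,2) nz by auto
    have inj: "inj_on (\<lambda>e. (e, 0::'k)) G" "inj_on (\<lambda>f. (0::'a, f)) H" by (auto simp: inj_on_def)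
    have "sum (quad D) (?G \<union> ?H) = sum (quad D) ?G + sum (quad D) ?H"
      using GH disj by (intro sum.union_disjoint) auto
    also have "sum (quad D) ?G = sum (quad A) G"
      unfolding sum.reindex[OF inj(1)] using D(3) GH(1) by (intro sum.cong) auto
    also have "sum (quad D) ?H = sum (quad S) H"
      unfolding sum.reindex[OF inj(2)] using D(4) by (intro sum.cong) auto
    finally have "w = sum (quad D) (?G \<union> ?H)" using GH(6) by simp
    moreover have "card (?G \<union> ?H) = k"
      using card_Un_disjoint[OF _ _ disj] GH by (simp add: card_image inj)
    moreover have "?G \<union> ?H \<subseteq> E" using GH(1,2) by (auto simp: E_def)
    moreover have "finite (?G \<union> ?H)" using GH by simp
    ultimately show ?thesis by blast
  qed
  have range: "joint_num_range (L \<times> K) k D = P"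
    by (rule diagonal_joint_num_range[OF clLK D(1) onb diag P(1,2) k sub extE])
  have "P \<subseteq> closure (joint_num_range UNIV k A)"
  proof
    fix z assume z: "z \<in> P"
    obtain G t where G: "finite G" "G \<subseteq> E" and
      t: "\<And>g. g \<in> G \<Longrightarrow> 0 \<le> t g \<and> t g \<le> 1" "sum t G = real k" "z = (\<Sum>g\<in>G. t g *\<^sub>R quad D g)"
      using polytope_subset_sum_weights[OF P(1) z extE] by metis
    show "z \<in> closure (joint_num_range UNIV k A)" unfolding t(3) by (rule cover[OF G t(1,2)])
  qed
  then show ?thesis using onb diag range hullP by blast
qed

lemma diagonal_model_exists:
  assumes poly: "\<And>k. 0 < k \<Longrightarrow> enat k < hdim (UNIV :: 'a set) \<Longrightarrow>
      polytope (closure (convex hull (joint_num_range UNIV k A)))"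
    and room: "hdim (UNIV :: 'a set) \<le> hdim (UNIV :: 'k::chilbert_space set)"
  shows "\<exists>(L :: 'a set) (K :: 'k set) D. diagonal_model A L K D \<and>
    (\<forall>k. 0 < k \<and> enat k < hdim (UNIV :: 'a set) \<longrightarrow>
      closure (joint_num_range UNIV k A) = joint_num_range (L \<times> K) k D \<and>
      polytope (joint_num_range (L \<times> K) k D))"
proof -
  define P where "P k = closure (convex hull (joint_num_range UNIV k A))" for k
  \<comment> \<open>The zeroth range is included so that the first spectral value, too, is a
    difference of vertices.\<close>
  have P0: "P 0 = {0}" by (simp add: P_def joint_num_range_quad)
  have P: "polytope (P k)" if "enat k < hdim (UNIV :: 'a set)" for k
  proof (cases "k = 0")
    case True
    then show ?thesis using P0 by (simp add: polytope_sing)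
  next
    case False
    then show ?thesis unfolding P_def using poly that by simp
  qed
  have ne: "P k \<noteq> {}" if k: "enat k < hdim (UNIV :: 'a set)" for k
  proof -
    obtain C :: "'a set" where "finite C" "orthonormal_set C" "card C = k"
      using orthonormal_of_card_le_hdim[OF less_imp_le[OF k]] by blast
    then have "sum (quad A) C \<in> joint_num_range UNIV k A" by (intro joint_num_rangeI) auto
    then show ?thesis unfolding P_def by (metis closure_eq_empty convex_hull_eq_empty empty_iff)
  qed
  \<comment> \<open>All candidates for spectral values, for every k and every generic direction at
    once; each index contributes finitely many.\<close>
  define W where "W = (\<Union>i\<in>{i. enat (Suc i) < hdim (UNIV :: 'a set)}.
    (\<lambda>(w, w'). w - w') ` ({w. w extreme_point_of P (Suc i)} \<times> {w. w extreme_point_of P i}))"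
  have fin: "finite {w. w extreme_point_of P i}" if "enat i < hdim (UNIV :: 'a set)" for i
    using polytope_hull_extreme(2)[OF P[OF that]] .
  have "finite ({w. w extreme_point_of P (Suc i)} \<times> {w. w extreme_point_of P i})"
    if "enat (Suc i) < hdim (UNIV :: 'a set)" for i
  proof -
    have "enat i < hdim (UNIV :: 'a set)" using order_less_trans[OF _ that, of "enat i"] by simp
    then show ?thesis using fin that by (intro finite_cartesian_product) auto
  qed
  then have "countable W" unfolding W_def
    by (intro countable_UN countable_image countableI_type) (auto intro: countable_finite)
  define U where "U = W - ess_points A"
  \<comment> \<open>Values that the auxiliary summand has to carry. Extremality is imposed because
    \<open>diagonal_model\<close> demands it of the entries of \<open>S\<close>;
    \<open>generic_vertex_decomposition\<close> provides it.\<close>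
  define V where "V = {d \<in> W. d \<in> ess_points A \<and> d extreme_point_of joint_ess_num_range A}"
  have UV: "countable U" "countable V" unfolding U_def V_def
    by (rule countable_subset[OF _ \<open>countable W\<close>]; blast)+
  obtain B where B: "orthonormal_set B" "\<And>e. e \<in> B \<Longrightarrow> \<exists>v\<in>U. joint_eigenvector A v e"
    "\<And>v x. v \<in> U \<Longrightarrow> joint_eigenvector A v x \<Longrightarrow> norm x = 1 \<Longrightarrow> \<exists>e\<in>B. cinner x e \<noteq> 0"
    using maximal_eigenvector_set[of U] by blast
  have "finite {e \<in> B. joint_eigenvector A v e}" if "v \<in> U" for v
    using that by (intro finite_eigenvector_set[of _ v] orthonormal_set_subset[OF B(1)]) (auto simp: U_def)
  then have "countable (\<Union>v\<in>U. {e \<in> B. joint_eigenvector A v e})"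
    by (intro countable_UN UV(1)) (auto intro: countable_finite)
  moreover have "B \<subseteq> (\<Union>v\<in>U. {e \<in> B. joint_eigenvector A v e})" using B(2) by blast
  ultimately have cB: "countable B" using countable_subset by blast
  have bV: "bounded V" by (rule bounded_subset[OF bounded_ess_points]) (auto simp: V_def)
  have iV: "\<exists>X :: 'k set. infinite X \<and> orthonormal_set X" if "V \<noteq> {}"
    using infinite_orthonormal_of_ess_points[OF _ room] that by (auto simp: V_def)
  have "\<exists>(K :: 'k set) F S. closed_csubspace K \<and> (\<forall>j. bounded_op_on K (S j)) \<and>
      is_onb K F \<and> diagonal_wrt F S \<and> (\<forall>f\<in>F. quad S f \<in> V) \<and> (\<forall>d\<in>V. infinite {f \<in> F. quad S f = d})"
    by (rule diagonal_tuple_exists[OF UV(2) bV iV])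
  then obtain K :: "'k set" and F S where "closed_csubspace K \<and> (\<forall>j. bounded_op_on K (S j)) \<and>
      is_onb K F \<and> diagonal_wrt F S \<and> (\<forall>f\<in>F. quad S f \<in> V) \<and> (\<forall>d\<in>V. infinite {f \<in> F. quad S f = d})"
    by (elim exE)
  then have K: "closed_csubspace K" "\<And>j. bounded_op_on K (S j)" "is_onb K F"
    "diagonal_wrt F S" "\<And>f. f \<in> F \<Longrightarrow> quad S f \<in> V" "\<And>d. d \<in> V \<Longrightarrow> infinite {f \<in> F. quad S f = d}"
    by blast+
  define L where "L = closure (complex_vector.span B)"
  define D where "D = direct_sum (compression L A) S"
  have ev: "\<forall>e\<in>B. \<exists>v. joint_eigenvector A v e" using B(2) by blast
  have ess: "\<forall>f\<in>F. quad S f \<in> ess_points A" using K(5) by (simp add: V_def)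
  have ext: "\<exists>G\<subseteq>B. \<exists>H\<subseteq>F. finite G \<and> finite H \<and> card G + card H = k \<and> w = sum (quad A) G + sum (quad S) H"
    if k: "enat k < hdim (UNIV :: 'a set)" and w: "w extreme_point_of P k" for k w
  proof -
    have ik: "enat i < hdim (UNIV :: 'a set)" if "i \<le> k" for i
      using that k by (meson enat_ord_simps(1) order_le_less_trans)
    obtain a r u where "0 < r \<and> u k = w \<and> (\<forall>i\<le>k. u i extreme_point_of P i \<and>
        (\<forall>b\<in>ball a r. \<forall>z\<in>P i. inner b z \<le> inner b (u i)))"
      using generic_direction[of k P w] P ne ik w by blast
    then have r: "0 < r" "u k = w" and u: "\<And>i. i \<le> k \<Longrightarrow> u i extreme_point_of P i"
      "\<And>i b z. i \<le> k \<Longrightarrow> b \<in> ball a r \<Longrightarrow> z \<in> P i \<Longrightarrow> inner b z \<le> inner b (u i)"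
      by blast+
    have u0: "u 0 = 0" using u(1)[of 0] P0 by (simp add: extreme_point_of_def)
    have uP: "u i \<in> P i" if "i \<le> k" for i using u(1)[OF that] by (simp add: extreme_point_of_def)
    have uW: "u (Suc i) - u i \<in> W" if "i < k" for i
      unfolding W_def using u(1)[of i] u(1)[of "Suc i"] ik[of "Suc i"] that
      by (intro UN_I[of i] image_eqI[of _ _ "(u (Suc i), u i)"]) auto
    have "\<exists>G\<subseteq>B. finite G \<and> (card G = k \<and> u k = sum (quad A) G \<or>
      card G < k \<and> (\<exists>d. d = u (Suc (card G)) - u (card G) \<and> d \<in> ess_points A \<and>
      d extreme_point_of joint_ess_num_range A \<and> u k = sum (quad A) G + real (k - card G) *\<^sub>R d))"
    proof (rule generic_vertex_decomposition[where a = a and r = r and U = U])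
      show "0 < r" "u 0 = 0" "orthonormal_set B" by (fact r(1) u0 B(1))+
      show "\<exists>v\<in>U. joint_eigenvector A v e" if "e \<in> B" for e by (rule B(2)[OF that])
      show "\<exists>e\<in>B. cinner x e \<noteq> 0" if "v \<in> U" "joint_eigenvector A v x" "norm x = 1" for x v
        by (rule B(3)[OF that])
      show "inner b z \<le> inner b (u i)"
        if "i \<le> k" "b \<in> ball a r" "z \<in> closure (convex hull (joint_num_range UNIV i A))" for i b z
        using u(2)[OF that(1,2)] that(3) by (simp only: P_def)
      show "u i \<in> closure (convex hull (joint_num_range UNIV i A))" if "i \<le> k" for i
        using uP[OF that] by (simp only: P_def)
      show "u (Suc i) - u i \<in> U" if "i < k" "u (Suc i) - u i \<notin> ess_points A" for i
        using uW that by (simp add: U_def)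
    qed
    then obtain G where G: "G \<subseteq> B" "finite G" and alt: "card G = k \<and> u k = sum (quad A) G \<or>
      card G < k \<and> (\<exists>d. d = u (Suc (card G)) - u (card G) \<and> d \<in> ess_points A \<and>
      d extreme_point_of joint_ess_num_range A \<and> u k = sum (quad A) G + real (k - card G) *\<^sub>R d)"
      by blast
    from alt show ?thesis
    proof
      assume "card G = k \<and> u k = sum (quad A) G"
      then show ?thesis using G r(2) by (intro exI[of _ G] conjI exI[of _ "{}"]) auto
    next
      assume "card G < k \<and> (\<exists>d. d = u (Suc (card G)) - u (card G) \<and> d \<in> ess_points A \<and>
        d extreme_point_of joint_ess_num_range A \<and> u k = sum (quad A) G + real (k - card G) *\<^sub>R d)"
      then obtain d where d: "card G < k" "d = u (Suc (card G)) - u (card G)" "d \<in> ess_points A"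
        "d extreme_point_of joint_ess_num_range A" "u k = sum (quad A) G + real (k - card G) *\<^sub>R d" by blast
      then have "d \<in> V" using uW by (simp add: V_def)
      \<comment> \<open>Infinite multiplicity in \<open>F\<close> supplies as many copies of
        \<open>d\<close> as this \<open>k\<close> requires.\<close>
      then obtain H where H: "H \<subseteq> {f \<in> F. quad S f = d}" "finite H" "card H = k - card G"
        using infinite_arbitrarily_large[OF K(6)] by blast
      have "sum (quad S) H = (\<Sum>f\<in>H. d)" using H(1) by (intro sum.cong) auto
      also have "\<dots> = real (k - card G) *\<^sub>R d" using H(3) by (simp add: sum_constant_scaleR del: sum_constant)
      finally have "w = sum (quad A) G + sum (quad S) H" using d(5) r(2) by simp
      then show ?thesis using G H d(1) by (intro exI[of _ G] conjI exI[of _ H]) auto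
    qed
  qed
  have range: "closure (joint_num_range UNIV k A) = joint_num_range (L \<times> K) k D \<and>
      polytope (joint_num_range (L \<times> K) k D)"
    if "0 < k" "enat k < hdim (UNIV :: 'a set)" for k
  proof -
    have "\<forall>w. w extreme_point_of P k \<longrightarrow> (\<exists>G\<subseteq>B. \<exists>H\<subseteq>F. finite G \<and> finite H \<and>
        card G + card H = k \<and> w = sum (quad A) G + sum (quad S) H)" using ext[OF that(2)] by blast
    from diagonal_direct_sum_range[OF B(1) ev K(1,3,2,4) ess that(1) P[OF that(2)] ne[OF that(2)] P_def this L_def]
    show ?thesis using P[OF that(2)] by (simp add: D_def)
  qed
  have "diagonal_model A L K D"
    unfolding diagonal_model_def
  proof (intro exI[of _ S] conjI allI)
    show "reducing A L" unfolding L_def by (rule reducing_eigenvector_span[OF ev])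
    show "separable_space (top_of_set L)" unfolding L_def by (rule separable_closure_span[OF cB])
    show "\<exists>F. is_onb K F \<and> diagonal_wrt F S \<and> (\<forall>f\<in>F. diagonal_entry S f extreme_point_of joint_ess_num_range A)"
      using K(3,4,5) by (intro exI[of _ F]) (auto simp: diagonal_entry_def quad_def V_def)
    have "is_onb L B" using B(1) subset_closure_span by (auto simp: L_def is_onb_def)
    moreover have "closed_csubspace L" unfolding L_def by (rule closed_csubspace_closure_span)
    ultimately show "\<exists>E. is_onb (L \<times> K) E \<and> diagonal_wrt E D"
      using is_onb_Times[OF _ _ K(1,3)] direct_sum_diagonal(2)[OF ev K(2,4,1) L_def, folded D_def] by blast
  qed (simp_all add: K D_def)
  then show ?thesis using range by (intro exI[of _ L] exI[of _ K] exI[of _ D]) blast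
qed

end

theorem theorem7p3:
  fixes A :: "'m::finite \<Rightarrow> 'a::chilbert_space \<Rightarrow> 'a"
  assumes bounded: "\<And>j. bounded_op_on UNIV (A j)"
    and aux_room: "hdim (UNIV :: 'a set) \<le> hdim (UNIV :: 'k::chilbert_space set)"
  defines "cond_a \<equiv>
      (\<forall>k. 0 < k \<and> enat k < hdim (UNIV :: 'a set) \<longrightarrow>
         polytope (closure (joint_num_range UNIV k A)))"
    and "cond_b \<equiv>
      (\<forall>k. 0 < k \<and> enat k < hdim (UNIV :: 'a set) \<longrightarrow>
         polytope (closure (convex hull (joint_num_range UNIV k A))))"
    and "cond_c \<equiv>
      (\<exists>(L :: 'a set) (K :: 'k set) D. diagonal_model A L K D \<and>
         (\<forall>k. 0 < k \<and> enat k < hdim (UNIV :: 'a set) \<longrightarrow>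
            closure (joint_num_range UNIV k A) = joint_num_range (L \<times> K) k D \<and>
            polytope (joint_num_range (L \<times> K) k D)))"
  shows "(cond_a \<longleftrightarrow> cond_b) \<and> (cond_b \<longleftrightarrow> cond_c)"
proof -
  interpret op_tuple A by unfold_locales (rule bounded)
  have ab: "cond_b" if a: "cond_a"
    unfolding cond_b_def
  proof (intro allI impI)
    fix k assume "0 < k \<and> enat k < hdim (UNIV :: 'a set)"
    then have p: "polytope (closure (joint_num_range UNIV k A))" using a by (simp add: cond_a_def)
    \<comment> \<open>A polytope is convex, so taking the hull does not leave the closure.\<close>
    have "convex hull (joint_num_range UNIV k A) \<subseteq> closure (joint_num_range UNIV k A)"
      by (intro hull_minimal closure_subset polytope_imp_convex[OF p])
    then have "closure (convex hull (joint_num_range UNIV k A)) = closure (joint_num_range UNIV k A)"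
      by (intro antisym closure_minimal closed_closure closure_mono hull_subset)
    then show "polytope (closure (convex hull (joint_num_range UNIV k A)))" using p by simp
  qed
  have bc: "cond_c" if "cond_b"
    unfolding cond_c_def using that by (intro diagonal_model_exists aux_room) (simp add: cond_b_def)
  have ca: "cond_a" if "cond_c"
    using that unfolding cond_a_def cond_c_def by metis
  show ?thesis using ab bc ca by blast
qed

end
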